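(* Let $n\ge1$, let $\eta$ be a composition in $\mathbb{Z}_{\ge0}^n$, and let $e_{n-1}(z)=\sum_{1\le i_1<\dots<i_{n-1}\le n}z_{i_1}\cdots z_{i_{n-1}}$. Write $\eta+(i^n)=(\eta_1+i,\dots,\eta_n+i)$, $\eta^R=(\eta_n,\dots,\eta_1)$, $\min(\eta)$ and $\max(\eta)$ for the smallest and largest part of $\eta$, and $\eta':=\eta-(\min(\eta)^n)$. Let $$\nu=\left(-\eta'+(\max(\eta')^n)\right)^R .$$ Then $$e_{n-1}(z)E_\eta(z;q^{-1},t^{-1})=\sum_{I\in\mathbb{J}_\nu^I}a_{\nu,c_I(\nu)}\,E_{\lambda+(\min(\eta)^n)}(z;q^{-1},t^{-1}),$$ where, for each $I$, $\lambda=-c_I(\nu)^R+\left((\max(\nu)+1)^n\right)$ and $$a_{\nu,c_I(\nu)}=\frac{-(q-1)\,d'_\nu(q^{-1},t^{-1})\,A_I(\overline\nu)\,\widetilde B_I(\overline\nu)}{q^{\nu_{\min(I)}+1}(t-1)\,d'_{c_I(\nu)}(q^{-1},t^{-1})}.$$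
   Context: Polynomials are in $z=(z_1,\dots,z_n)$ over $\mathbb{Q}(q,t)$, with $q,t$ indeterminates. A composition is $\eta=(\eta_1,\dots,\eta_n)\in\mathbb{Z}_{\ge0}^n$; $|\eta|=\sum_i\eta_i$; $z^\eta=z_1^{\eta_1}\cdots z_n^{\eta_n}$. Put $$l'_\eta(i)=\#\{j<i:\eta_j\ge\eta_i\}+\#\{j>i:\eta_j>\eta_i\},\quad \overline\eta_i=q^{\eta_i}t^{-l'_\eta(i)},\quad \overline\eta=(\overline\eta_1,\dots,\overline\eta_n).$$ Empty products equal 1. Nonsymmetric Macdonald polynomials: let $s_i$ exchange $z_i$ and $z_{i+1}$ in a function, $(\tau_1f)(z)=f(qz_1,z_2,\dots,z_n)$, $\omega=s_{n-1}\cdots s_1\tau_1$, $T_i=t+\frac{tz_i-z_{i+1}}{z_i-z_{i+1}}(s_i-1)$, $Y_i=t^{-n+i}T_i\cdots T_{n-1}\,\omega\, T_1^{-1}\cdots T_{i-1}^{-1}$ ($1\le i\le n$). $E_\eta(z;q,t)$ is the unique polynomial with $Y_iE_\eta=\overline\eta_iE_\eta$ for all $i$ and of the form $z^\eta+\sum_{\nu\prec\eta}b_{\eta\nu}z^\nu$. Here, for $|\mu|=|\eta|$, $\mu\prec\eta$ iff $\mu^+<\eta^+$, or $\mu^+=\eta^+$ and $\mu<\eta$; $\eta^+$ is the partition obtained by permuting the parts of $\eta$, and $\mu<\eta$ means $\mu\neq\eta$ and $\sum_{i=1}^p(\eta_i-\mu_i)\ge0$ for all $1\le p\le n$. $E_\eta(z;q^{-1},t^{-1})$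 is obtained by replacing $q,t$ by $q^{-1},t^{-1}$ in the coefficients. Functions: $\widehat a(x,y)=\frac{(t-1)x}{x-y}$, $\widehat b(x,y)=\frac{x-ty}{x-y}$, and for $I=\{t_1<\dots<t_s\}\ne\emptyset$ (so $\min(I)=t_1$), $$A_I(z)=\widehat a\left(\tfrac{z_{t_s}}q,z_{t_1}\right)\prod_{u=1}^{s-1}\widehat a(z_{t_u},z_{t_{u+1}}),$$ $$\widetilde B_I(z)=\left(qz_{t_1}-t^{-n+1}\right)\prod_{u=1}^{s}\prod_{j=t_{u-1}+1}^{t_u-1}\widehat b(z_{t_u},z_j)\prod_{j=t_s+1}^{n}\widehat b(qz_{t_1},z_j),\quad t_0:=0.$$ Maximal sets (for a composition $\nu$): a nonempty $I=\{t_1<\dots<t_s\}\subseteq\{1,\dots,n\}$ is maximal with respect to $\nu$ iff (1) $\nu_j\ne\nu_{t_u}$ for $j=t_{u-1}+1,\dots,t_u-1$ and $u=1,\dots,s$ (with $t_0:=0$), and (2) $\nu_j\neq\nu_{t_1}+1$ for $j=t_s+1,\dots,n$. $\mathbb{J}^I_\nu$ is the set of all $I$ maximal with respect to $\nu$. The composition $c_I(\nu)$ is defined by $(c_I(\nu))_{t_k}=\nu_{t_{k+1}}$ for $k=1,\dots,s-1$, $(c_I(\nu))_{t_s}=\nu_{t_1}+1$, $(c_I(\nu))_j=\nu_j$ for $j\notin I$. Constants: $d'_\nu(q^{-1},t^{-1})=\prod_{(i,j):\,1\le i\le n,\,1\le j\le\nu_i}\left(1-q^{-a_\nu(i,j)-1}t^{-l_\nu(i,j)}\right)$,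 $a_\nu(i,j)=\nu_i-j$, $l_\nu(i,j)=\#\{k>i: j\le\nu_k\le\nu_i\}+\#\{k<i: j\le\nu_k+1\le\nu_i\}$. *)

theory Defs
  imports
    "HOL-Computational_Algebra.Computational_Algebra"
    "HOL-Computational_Algebra.Field_as_Ring"
    "HOL-Library.Poly_Mapping"
begin

section \<open>The coefficient field and the polynomial ring\<close>

text \<open>
  The field \<open>\<rat>(q,t)\<close> is the fraction field of \<open>\<rat>[q][t]\<close>; the inner polynomial variable is \<open>q\<close>,
  the outer one is \<open>t\<close>.
\<close>

type_synonym qt = "rat poly poly fract"

definition qvar :: qt where
  "qvar = to_fract [:[:0, 1:]:]"

definition tvar :: qt where
  "tvar = to_fract [:0, 1:]"

text \<open>
  \<open>qt_inverted f\<close> is \<open>f(q\<^sup>-\<^sup>1, t\<^sup>-\<^sup>1)\<close>: both variables are substituted in the numerator and in the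
  denominator of \<open>f\<close>.
\<close>

definition eval_inverted :: "rat poly poly \<Rightarrow> qt" where
  "eval_inverted p =
     poly (map_poly (\<lambda>r. poly (map_poly (\<lambda>c. to_fract [:[:c:]:]) r) (inverse qvar)) p)
       (inverse tvar)"

definition qt_inverted :: "qt \<Rightarrow> qt" where
  "qt_inverted f =
     eval_inverted (fst (quot_of_fract f)) / eval_inverted (snd (quot_of_fract f))"

text \<open>
  Polynomials over \<open>\<rat>(q,t)\<close> in variables \<open>z\<^sub>i\<close> indexed by natural numbers: finitely supported maps
  from exponent vectors to coefficients. Only \<open>z\<^sub>1, \<dots>, z\<^sub>n\<close> are used.
\<close>

type_synonym zpoly = "(nat \<Rightarrow>\<^sub>0 nat) \<Rightarrow>\<^sub>0 qt"

definition Const :: "qt \<Rightarrow> zpoly" where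
  "Const c = Poly_Mapping.single 0 c"

definition Z :: "nat \<Rightarrow> zpoly" where
  "Z i = Poly_Mapping.single (Poly_Mapping.single i 1) 1"

definition zsubst :: "(nat \<Rightarrow> zpoly) \<Rightarrow> zpoly \<Rightarrow> zpoly" where
  "zsubst \<sigma> f =
     (\<Sum>m\<in>Poly_Mapping.keys f.
        Const (Poly_Mapping.lookup f m) *
        (\<Prod>i\<in>Poly_Mapping.keys m. \<sigma> i ^ Poly_Mapping.lookup m i))"

definition elem_sym :: "nat \<Rightarrow> nat \<Rightarrow> zpoly" where
  "elem_sym n r = (\<Sum>S\<in>{S. S \<subseteq> {1..n} \<and> card S = r}. \<Prod>i\<in>S. Z i)"

section \<open>Compositions\<close>

text \<open>
  A composition \<open>(\<eta>\<^sub>1, \<dots>, \<eta>\<^sub>n)\<close> is represented by a function \<open>\<eta> :: nat \<Rightarrow> nat\<close>, of which only the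
  values on \<open>{1..n}\<close> matter; the length \<open>n\<close> is passed separately.
\<close>

definition zpow :: "nat \<Rightarrow> (nat \<Rightarrow> nat) \<Rightarrow> zpoly" where
  "zpow n \<eta> = (\<Prod>i=1..n. Z i ^ \<eta> i)"

definition min_part :: "nat \<Rightarrow> (nat \<Rightarrow> nat) \<Rightarrow> nat" where
  "min_part n \<eta> = Min (\<eta> ` {1..n})"

definition max_part :: "nat \<Rightarrow> (nat \<Rightarrow> nat) \<Rightarrow> nat" where
  "max_part n \<eta> = Max (\<eta> ` {1..n})"

definition rev_comp :: "nat \<Rightarrow> (nat \<Rightarrow> nat) \<Rightarrow> nat \<Rightarrow> nat" where
  "rev_comp n \<eta> i = \<eta> (n + 1 - i)"

definition leg' :: "nat \<Rightarrow> (nat \<Rightarrow> nat) \<Rightarrow> nat \<Rightarrow> nat" where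
  "leg' n \<eta> i =
     card {j\<in>{1..n}. j < i \<and> \<eta> j \<ge> \<eta> i} + card {j\<in>{1..n}. j > i \<and> \<eta> j > \<eta> i}"

definition eta_bar :: "nat \<Rightarrow> (nat \<Rightarrow> nat) \<Rightarrow> nat \<Rightarrow> qt" where
  "eta_bar n \<eta> i = qvar ^ \<eta> i * tvar powi (- int (leg' n \<eta> i))"

definition sorted_comp :: "nat \<Rightarrow> (nat \<Rightarrow> nat) \<Rightarrow> nat \<Rightarrow> nat" where
  "sorted_comp n \<eta> i = rev (sort (map \<eta> [1..<n+1])) ! (i - 1)"

definition comp_eq :: "nat \<Rightarrow> (nat \<Rightarrow> nat) \<Rightarrow> (nat \<Rightarrow> nat) \<Rightarrow> bool" where
  "comp_eq n \<mu> \<eta> \<longleftrightarrow> (\<forall>i\<in>{1..n}. \<mu> i = \<eta> i)"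

definition dom_less :: "nat \<Rightarrow> (nat \<Rightarrow> nat) \<Rightarrow> (nat \<Rightarrow> nat) \<Rightarrow> bool" where
  "dom_less n \<mu> \<eta> \<longleftrightarrow>
     \<not> comp_eq n \<mu> \<eta> \<and> (\<forall>p\<in>{1..n}. (\<Sum>i=1..p. int (\<eta> i) - int (\<mu> i)) \<ge> 0)"

definition comp_prec :: "nat \<Rightarrow> (nat \<Rightarrow> nat) \<Rightarrow> (nat \<Rightarrow> nat) \<Rightarrow> bool" where
  "comp_prec n \<mu> \<eta> \<longleftrightarrow>
     (\<Sum>i=1..n. \<mu> i) = (\<Sum>i=1..n. \<eta> i) \<and>
     (dom_less n (sorted_comp n \<mu>) (sorted_comp n \<eta>) \<or>
      comp_eq n (sorted_comp n \<mu>) (sorted_comp n \<eta>) \<and> dom_less n \<mu> \<eta>)"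

section \<open>Nonsymmetric Macdonald polynomials\<close>

definition s_op :: "nat \<Rightarrow> zpoly \<Rightarrow> zpoly" where
  "s_op i = zsubst (\<lambda>j. if j = i then Z (i + 1) else if j = i + 1 then Z i else Z j)"

definition tau1 :: "zpoly \<Rightarrow> zpoly" where
  "tau1 = zsubst (\<lambda>j. if j = 1 then Const qvar * Z 1 else Z j)"

definition omega :: "nat \<Rightarrow> zpoly \<Rightarrow> zpoly" where
  "omega n f = foldr s_op (rev [1..<n]) (tau1 f)"

text \<open>
  The quotient of \<open>(t z\<^sub>i - z\<^bsub>i+1\<^esub>) (s\<^sub>i f - f)\<close> by \<open>z\<^sub>i - z\<^bsub>i+1\<^esub>\<close> is again a polynomial, since
  \<open>s\<^sub>i f - f\<close> vanishes at \<open>z\<^sub>i = z\<^bsub>i+1\<^esub>\<close>, and it is unique as there are no zero divisors.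
\<close>

definition T_op :: "nat \<Rightarrow> zpoly \<Rightarrow> zpoly" where
  "T_op i f =
     Const tvar * f +
     (THE g. (Z i - Z (i + 1)) * g = (Const tvar * Z i - Z (i + 1)) * (s_op i f - f))"

definition Y_op :: "nat \<Rightarrow> nat \<Rightarrow> zpoly \<Rightarrow> zpoly" where
  "Y_op n i f =
     Const (tvar powi (- int n + int i)) *
     foldr T_op [i..<n] (omega n (foldr (\<lambda>j. inv (T_op j)) [1..<i] f))"

text \<open>
  The inclusion of supports says that \<open>E - z\<^sup>\<eta>\<close> is a linear combination of the monomials \<open>z\<^sup>\<nu>\<close>
  in \<open>z\<^sub>1, \<dots>, z\<^sub>n\<close> with \<open>\<nu> \<prec> \<eta>\<close>.
\<close>

definition is_nonsym_macdonald :: "nat \<Rightarrow> (nat \<Rightarrow> nat) \<Rightarrow> zpoly \<Rightarrow> bool" where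
  "is_nonsym_macdonald n \<eta> E \<longleftrightarrow>
     Poly_Mapping.keys (E - zpow n \<eta>)
       \<subseteq> {m. Poly_Mapping.keys m \<subseteq> {1..n} \<and> comp_prec n (Poly_Mapping.lookup m) \<eta>} \<and>
     (\<forall>i\<in>{1..n}. Y_op n i E = Const (eta_bar n \<eta> i) * E)"

definition nonsym_macdonald :: "nat \<Rightarrow> (nat \<Rightarrow> nat) \<Rightarrow> zpoly" where
  "nonsym_macdonald n \<eta> = (THE E. is_nonsym_macdonald n \<eta> E)"

definition nonsym_macdonald_inverted :: "nat \<Rightarrow> (nat \<Rightarrow> nat) \<Rightarrow> zpoly" where
  "nonsym_macdonald_inverted n \<eta> = Poly_Mapping.map qt_inverted (nonsym_macdonald n \<eta>)"

section \<open>Pieri-type coefficients\<close>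

text \<open>
  For \<open>I = {t\<^sub>1 < \<dots> < t\<^sub>s}\<close>, \<open>nth_elem I u\<close> is \<open>t\<^sub>u\<close>, with the convention \<open>t\<^sub>0 = 0\<close>; \<open>s\<close> is \<open>card I\<close>.
\<close>

definition nth_elem :: "nat set \<Rightarrow> nat \<Rightarrow> nat" where
  "nth_elem I u = (if u = 0 then 0 else sorted_list_of_set I ! (u - 1))"

definition a_hat :: "qt \<Rightarrow> qt \<Rightarrow> qt" where
  "a_hat x y = (tvar - 1) * x / (x - y)"

definition b_hat :: "qt \<Rightarrow> qt \<Rightarrow> qt" where
  "b_hat x y = (x - tvar * y) / (x - y)"

definition A_fun :: "nat set \<Rightarrow> (nat \<Rightarrow> qt) \<Rightarrow> qt" where
  "A_fun I z =
     a_hat (z (nth_elem I (card I)) / qvar) (z (nth_elem I 1)) *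
     (\<Prod>u=1..card I - 1. a_hat (z (nth_elem I u)) (z (nth_elem I (u + 1))))"

definition B_fun :: "nat \<Rightarrow> nat set \<Rightarrow> (nat \<Rightarrow> qt) \<Rightarrow> qt" where
  "B_fun n I z =
     (qvar * z (nth_elem I 1) - tvar powi (- int n + 1)) *
     (\<Prod>u=1..card I. \<Prod>j\<in>{nth_elem I (u - 1)<..<nth_elem I u}. b_hat (z (nth_elem I u)) (z j)) *
     (\<Prod>j\<in>{nth_elem I (card I)<..n}. b_hat (qvar * z (nth_elem I 1)) (z j))"

definition maximal_sets :: "nat \<Rightarrow> (nat \<Rightarrow> nat) \<Rightarrow> nat set set" where
  "maximal_sets n \<nu> =
     {I. I \<noteq> {} \<and> I \<subseteq> {1..n} \<and>
         (\<forall>u\<in>{1..card I}. \<forall>j\<in>{nth_elem I (u - 1)<..<nth_elem I u}. \<nu> j \<noteq> \<nu> (nth_elem I u)) \<and>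
         (\<forall>j\<in>{nth_elem I (card I)<..n}. \<nu> j \<noteq> \<nu> (nth_elem I 1) + 1)}"

text \<open>For \<open>j = t\<^sub>k\<close> with \<open>k < s\<close>, the least element of \<open>I\<close> above \<open>j\<close> is \<open>t\<^bsub>k+1\<^esub>\<close>.\<close>

definition c_comp :: "nat set \<Rightarrow> (nat \<Rightarrow> nat) \<Rightarrow> nat \<Rightarrow> nat" where
  "c_comp I \<nu> j =
     (if j \<notin> I then \<nu> j
      else if j = Max I then \<nu> (Min I) + 1
      else \<nu> (Min {k\<in>I. k > j}))"

definition arm :: "(nat \<Rightarrow> nat) \<Rightarrow> nat \<Rightarrow> nat \<Rightarrow> nat" where
  "arm \<nu> i j = \<nu> i - j"

definition leg :: "nat \<Rightarrow> (nat \<Rightarrow> nat) \<Rightarrow> nat \<Rightarrow> nat \<Rightarrow> nat" where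
  "leg n \<nu> i j =
     card {k\<in>{1..n}. k > i \<and> j \<le> \<nu> k \<and> \<nu> k \<le> \<nu> i} +
     card {k\<in>{1..n}. k < i \<and> j \<le> \<nu> k + 1 \<and> \<nu> k + 1 \<le> \<nu> i}"

text \<open>\<open>d'_inverted n \<nu>\<close> is \<open>d'\<^sub>\<nu>(q\<^sup>-\<^sup>1, t\<^sup>-\<^sup>1)\<close>.\<close>

definition d'_inverted :: "nat \<Rightarrow> (nat \<Rightarrow> nat) \<Rightarrow> qt" where
  "d'_inverted n \<nu> =
     (\<Prod>i=1..n. \<Prod>j=1..\<nu> i.
        1 - qvar powi (- int (arm \<nu> i j) - 1) * tvar powi (- int (leg n \<nu> i j)))"

definition pieri_coeff :: "nat \<Rightarrow> (nat \<Rightarrow> nat) \<Rightarrow> nat set \<Rightarrow> qt" where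
  "pieri_coeff n \<nu> I =
     (- (qvar - 1) * d'_inverted n \<nu> * A_fun I (eta_bar n \<nu>) * B_fun n I (eta_bar n \<nu>)) /
     (qvar ^ (\<nu> (Min I) + 1) * (tvar - 1) * d'_inverted n (c_comp I \<nu>))"

text \<open>
  \<open>compl_rev n M \<eta>\<close> is \<open>(-\<eta> + (M\<^sup>n))\<^sup>R = -\<eta>\<^sup>R + (M\<^sup>n)\<close>, for \<open>M\<close> at least the largest part of \<open>\<eta>\<close>
  (so that the subtraction of natural numbers is exact).
\<close>

definition compl_rev :: "nat \<Rightarrow> nat \<Rightarrow> (nat \<Rightarrow> nat) \<Rightarrow> nat \<Rightarrow> nat" where
  "compl_rev n M \<eta> = rev_comp n (\<lambda>i. M - \<eta> i)"

end

theory Submission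
  imports Defs
begin

text \<open>
  Put \<open>x\<^sub>i = \<Prod>\<^bsub>j\<noteq>i\<^esub> z\<^sub>j\<close>, so that \<open>e\<^bsub>n-1\<^esub> = \<Sum>\<^sub>i x\<^sub>i\<close> and \<open>x\<^sub>i = t\<^sup>-\<^sup>1 T\<^sub>i x\<^bsub>i+1\<^esub> T\<^sub>i\<close>. The operator \<open>z\<^sub>n \<omega>\<close> maps
  \<open>E\<^sub>\<eta>\<close> to a multiple of \<open>E\<close> at \<open>(\<eta>\<^sub>2, \<dots>, \<eta>\<^sub>n, \<eta>\<^sub>1 + 1)\<close>, and \<open>x\<^sub>n z\<^sub>n \<omega> = e\<^sub>n \<omega>\<close>, where \<open>e\<^sub>n\<close> raises all parts of the
  index and \<open>\<omega> = t\<^bsup>n-1\<^esup> T\<^bsub>n-1\<^esub>\<^sup>-\<^sup>1 \<cdots> T\<^sub>1\<^sup>-\<^sup>1 Y\<^sub>1\<close>. So every \<open>x\<^sub>i\<close> is a shift of the index between two products of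
  Demazure--Lusztig operators. In the basis of the \<open>E\<^bsub>(M,\<dots>,M) - \<nu>\<^sup>R\<^esub>\<close>, suitably normalized, each \<open>T\<^sub>k\<close> acts by a
  two-term formula whose coefficients are values of \<open>a_hat\<close> and \<open>b_hat\<close>, and the products expand into a sum
  over the maximal sets \<open>I\<close> that contain the position in question. With \<open>y\<close> the spectral vector of \<open>\<nu>\<close>
  and \<open>m\<^sub>i\<close> the entry of \<open>y\<close> that follows \<open>y\<^sub>i\<close> in the cyclic order of \<open>I\<close> (multiplied by \<open>q\<close> after the last
  element), the coefficient of \<open>I\<close> depends on \<open>i \<in> I\<close> only through the factor \<open>1/m\<^sub>i - 1/y\<^sub>i\<close>, so the sum
  over \<open>i\<close> telescopes. Inverting \<open>q\<close> and \<open>t\<close> at the end gives the stated form.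
\<close>

section \<open>The coefficient field\<close>

text \<open>Since E_\<eta> is given by a definite description, its existence and uniqueness come
  first. It is generated from 1 by z_n \<omega> and by intertwiners T_i - const, with an order that
  implies \<prec> and that both steps respect; triangularity of the Y_i is then deduced from
  existence instead of being computed. Reversal enters because e_{n-1}(z) = e_n(z) e_1(1/z):
  negating and reversing the index exchanges e_{n-1} with e_1 up to a shift, which is why sets and
  moves typical of multiplication by e_1 describe the answer. The normalization is division by
  d'_\<nu>. It is chosen so that the swapped polynomial has the same coefficient in T_k whether
  \<nu>_k is smaller or larger than \<nu>_{k+1}; without it the expansion over paths would depend on
  the relative order of the parts. It is also the origin of the quotient of two d' in the
  coefficients. All computations use q and t. Coefficientwise inversion is a ring homomorphism that
  fixes e_{n-1}, so one application to the finished identity suffices; for this the substitution of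
  q^-1 and t^-1 must be shown to be injective.\<close>

definition ring_hom :: "('a::comm_ring_1 \<Rightarrow> 'b::comm_ring_1) \<Rightarrow> bool" where
  "ring_hom h \<longleftrightarrow> h 1 = 1 \<and> (\<forall>a b. h (a + b) = h a + h b) \<and> (\<forall>a b. h (a * b) = h a * h b)"

lemma ring_hom_1: "ring_hom h \<Longrightarrow> h 1 = 1"
  and ring_hom_add: "ring_hom h \<Longrightarrow> h (a + b) = h a + h b"
  and ring_hom_mult: "ring_hom h \<Longrightarrow> h (a * b) = h a * h b"
  by (simp_all add: ring_hom_def)

lemma ring_hom_0: "ring_hom h \<Longrightarrow> h 0 = 0"
  using ring_hom_add[of h 0 0] by simp

lemma ring_hom_uminus: "ring_hom h \<Longrightarrow> h (- a) = - h a"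
  using ring_hom_add[of h a "- a"] ring_hom_0[of h] by (simp add: eq_neg_iff_add_eq_0 add.commute)

lemma ring_hom_diff: "ring_hom h \<Longrightarrow> h (a - b) = h a - h b"
  using ring_hom_add[of h a "- b"] ring_hom_uminus[of h b] by simp

lemma ring_hom_power: "ring_hom h \<Longrightarrow> h (a ^ n) = h a ^ n"
  by (induction n) (simp_all add: ring_hom_1 ring_hom_mult)

lemma ring_hom_sum: "ring_hom h \<Longrightarrow> h (sum f A) = (\<Sum>x\<in>A. h (f x))"
  by (induction A rule: infinite_finite_induct) (simp_all add: ring_hom_0 ring_hom_add)

lemma ring_hom_prod: "ring_hom h \<Longrightarrow> h (prod f A) = (\<Prod>x\<in>A. h (f x))"
  by (induction A rule: infinite_finite_induct) (simp_all add: ring_hom_1 ring_hom_mult)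

lemmas ring_hom_simps =
  ring_hom_0 ring_hom_1 ring_hom_add ring_hom_mult ring_hom_uminus ring_hom_diff ring_hom_power

lemma field_hom_inverse:
  fixes h :: "'a::field \<Rightarrow> 'b::field"
  assumes "ring_hom h"
  shows "h (inverse a) = inverse (h a)"
proof (cases "a = 0")
  case False
  then have "h a * h (inverse a) = 1"
    using ring_hom_mult[OF assms, of a "inverse a"] ring_hom_1[OF assms] by simp
  then show ?thesis
    by (metis inverse_unique)
qed (simp add: ring_hom_0 assms)

lemma field_hom_divide:
  fixes h :: "'a::field \<Rightarrow> 'b::field"
  assumes "ring_hom h"
  shows "h (a / b) = h a / h b"
  by (simp add: divide_inverse ring_hom_mult field_hom_inverse assms)

section \<open>Evaluation homomorphisms and injectivity of the substitution of q^-1 and t^-1\<close>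

lemma ring_hom_poly_map_poly:
  assumes h: "ring_hom h"
  shows "ring_hom (\<lambda>p. poly (map_poly h p) x)"
proof -
  note pC = map_poly_pCons[of h, OF ring_hom_0[OF h]]
  have add: "poly (map_poly h (p + r)) x = poly (map_poly h p) x + poly (map_poly h r) x" for p r
    by (induction p r rule: poly_induct2) (simp_all add: pC ring_hom_simps[OF h] algebra_simps)
  have sm: "poly (map_poly h (smult a r)) x = h a * poly (map_poly h r) x" for a r
    by (induction r) (simp_all add: pC ring_hom_simps[OF h] algebra_simps)
  have "poly (map_poly h (p * r)) x = poly (map_poly h p) x * poly (map_poly h r) x" for p r
    by (induction p) (simp_all add: pC add sm ring_hom_simps[OF h] algebra_simps)
  moreover have "poly (map_poly h 1) x = 1"
    by (simp add: one_pCons pC ring_hom_simps[OF h])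
  ultimately show ?thesis
    using add by (simp add: ring_hom_def)
qed

text \<open>A root 1/x of p is a root x of the reflected polynomial, so transcendence of x passes to
  its inverse. It serves once for q over the rationals and once for t over polynomials in
  q^-1.\<close>

lemma poly_map_poly_inverse_inj:
  fixes h :: "'a::idom \<Rightarrow> 'b::field"
  assumes h: "ring_hom h" and inj: "\<And>a. h a = 0 \<Longrightarrow> a = 0" and "x \<noteq> 0"
    and trans: "\<And>p. poly (map_poly h p) x = 0 \<Longrightarrow> p = 0"
    and "poly (map_poly h p) (inverse x) = 0"
  shows "p = 0"
proof -
  have deg: "degree (map_poly h p) = degree p"
    by (rule degree_map_poly) (use inj in auto)
  have "map_poly h (reflect_poly p) = reflect_poly (map_poly h p)"
    by (rule poly_eqI) (simp add: coeff_map_poly coeff_reflect_poly ring_hom_0[OF h] deg)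
  moreover have "poly (reflect_poly (map_poly h p)) x = 0"
    using assms(3,5) by (simp add: poly_reflect_poly_nz)
  ultimately have "reflect_poly p = 0"
    by (intro trans) simp
  then show ?thesis by simp
qed

lemma ring_hom_to_fract_const: "ring_hom (\<lambda>c. to_fract [:[:c:]:])"
  by (simp add: ring_hom_def flip: one_pCons to_fract_add to_fract_mult)

lemma poly_to_fract_const_qvar: "poly (map_poly (\<lambda>c. to_fract [:[:c:]:]) r) qvar = to_fract [:r:]"
  by (induction r) (simp_all add: map_poly_pCons qvar_def flip: to_fract_add to_fract_mult)

definition eval_inverse_q :: "rat poly \<Rightarrow> qt" where
  "eval_inverse_q r = poly (map_poly (\<lambda>c. to_fract [:[:c:]:]) r) (inverse qvar)"

lemma ring_hom_eval_inverse_q: "ring_hom eval_inverse_q"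
  unfolding eval_inverse_q_def using ring_hom_poly_map_poly[OF ring_hom_to_fract_const] .

lemma qvar_nz [simp]: "qvar \<noteq> 0" and tvar_nz [simp]: "tvar \<noteq> 0"
  by (simp_all add: qvar_def tvar_def)

lemma eval_inverse_q_eq_0: "eval_inverse_q r = 0 \<Longrightarrow> r = 0"
  unfolding eval_inverse_q_def
  by (erule poly_map_poly_inverse_inj[rotated 4])
    (simp_all add: ring_hom_to_fract_const poly_to_fract_const_qvar)

text \<open>Substituting 1/q leaves only a power of q in the denominator. A bound N valid for
  several r at once permits clearing all coefficients of a polynomial in t together.\<close>

lemma eval_inverse_q_denominator:
  assumes "degree r \<le> N"
  shows "\<exists>s. qvar ^ N * eval_inverse_q r = to_fract [:s:]"
proof -
  let ?h = "\<lambda>c. to_fract [:[:c:]:] :: qt"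
  have deg: "degree (map_poly ?h r) = degree r"
    by (rule degree_map_poly) auto
  have "map_poly ?h (reflect_poly r) = reflect_poly (map_poly ?h r)"
    by (rule poly_eqI) (simp add: coeff_map_poly coeff_reflect_poly deg)
  then have "to_fract [:reflect_poly r:] = qvar ^ degree r * eval_inverse_q r"
    using poly_to_fract_const_qvar[of "reflect_poly r"]
    by (simp add: eval_inverse_q_def poly_reflect_poly_nz deg)
  then have "qvar ^ N * eval_inverse_q r = qvar ^ (N - degree r) * to_fract [:reflect_poly r:]"
    using assms by (simp add: mult.assoc flip: power_add)
  also have "\<dots> = to_fract [:[:0, 1:] ^ (N - degree r) * reflect_poly r:]"
  proof -
    have "qvar ^ k = to_fract [:[:0, 1:] ^ k:]" for k
    proof (induction k)
      case (Suc k)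
      have "qvar ^ Suc k = to_fract ([:[:0, 1:]:] * [:[:0, 1:] ^ k:])"
        unfolding power_Suc Suc to_fract_mult by (simp only: qvar_def)
      then show ?case by simp
    qed (simp flip: one_pCons)
    then have "qvar ^ (N - degree r) * to_fract [:reflect_poly r:]
        = to_fract ([:[:0, 1:] ^ (N - degree r):] * [:reflect_poly r:])"
      by (simp only: to_fract_mult)
    then show ?thesis by simp
  qed
  finally show ?thesis by blast
qed

text \<open>The evaluation point is t itself: this is the transcendence hypothesis required by
  \<open>poly_map_poly_inverse_inj\<close>. After multiplication by q^N the relation lives in the
  polynomial ring in q and t, where the coefficients of the t^i vanish separately.\<close>

lemma poly_eval_inverse_q_tvar:
  assumes "poly (map_poly eval_inverse_q p) tvar = 0"
  shows "p = 0"
proof -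
  define N where "N = Max (insert 0 ((\<lambda>i. degree (coeff p i)) ` {..degree p}))"
  have N: "degree (coeff p i) \<le> N" for i
  proof (cases "i \<le> degree p")
    case True
    then show ?thesis unfolding N_def by (intro Max_ge) auto
  qed (simp add: coeff_eq_0)
  obtain s where s: "\<And>i. qvar ^ N * eval_inverse_q (coeff p i) = to_fract [:s i:]"
    using eval_inverse_q_denominator[OF N] by metis
  have t: "tvar ^ i = to_fract (monom 1 i)" for i
    by (induction i) (simp_all add: tvar_def monom_Suc monom_0 mult.commute flip: to_fract_mult one_pCons)
  have deg: "degree (map_poly eval_inverse_q p) = degree p"
    by (rule degree_map_poly) (use eval_inverse_q_eq_0 in auto)
  have "0 = qvar ^ N * (\<Sum>i\<le>degree p. eval_inverse_q (coeff p i) * tvar ^ i)"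
    using assms deg by (simp add: poly_altdef coeff_map_poly ring_hom_0[OF ring_hom_eval_inverse_q])
  also have "\<dots> = (\<Sum>i\<le>degree p. to_fract ([:s i:] * monom 1 i))"
    by (simp only: sum_distrib_left s t to_fract_mult flip: mult.assoc)
  also have "\<dots> = to_fract (\<Sum>i\<le>degree p. monom (s i) i)"
    by (simp add: smult_monom del: to_fract_mult)
  finally have z: "(\<Sum>i\<le>degree p. monom (s i) i) = 0"
    by (metis to_fract_eq_0_iff)
  have "s i = 0" if "i \<le> degree p" for i
    using arg_cong[OF z, of "\<lambda>p. coeff p i"] that by (simp add: coeff_sum)
  then have "coeff p i = 0" if "i \<le> degree p" for i
    using s[of i] that eval_inverse_q_eq_0[of "coeff p i"] by simp
  then show ?thesis
    by (metis le_refl leading_coeff_0_iff)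
qed

lemma eval_inverted_altdef: "eval_inverted p = poly (map_poly eval_inverse_q p) (inverse tvar)"
  by (simp add: eval_inverted_def eval_inverse_q_def[abs_def])

lemma ring_hom_eval_inverted: "ring_hom eval_inverted"
  unfolding eval_inverted_altdef[abs_def]
  using ring_hom_poly_map_poly[OF ring_hom_eval_inverse_q] .

lemma eval_inverted_eq_0: "eval_inverted p = 0 \<Longrightarrow> p = 0"
  unfolding eval_inverted_altdef
  by (erule poly_map_poly_inverse_inj[rotated 4])
    (auto simp: ring_hom_eval_inverse_q eval_inverse_q_eq_0 poly_eval_inverse_q_tvar)

text \<open>\<open>qt_inverted\<close> reads off one normalized representative. Independence of it
  follows by cross multiplication, where injectivity of \<open>eval_inverted\<close> keeps both
  denominators nonzero.\<close>

lemma qt_inverted_Fract: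
  assumes "b \<noteq> 0"
  shows "qt_inverted (Fract a b) = eval_inverted a / eval_inverted b"
proof -
  obtain c d where cd: "quot_of_fract (Fract a b) = (c, d)" by fastforce
  then have d: "d \<noteq> 0" "Fract c d = Fract a b"
    using snd_quot_of_fract_nonzero[of "Fract a b"] Fract_quot_of_fract[of "Fract a b"] by auto
  then have "c * b = a * d"
    using assms by (simp add: eq_fract)
  then have "eval_inverted c * eval_inverted b = eval_inverted a * eval_inverted d"
    by (metis ring_hom_mult[OF ring_hom_eval_inverted])
  moreover have "eval_inverted b \<noteq> 0" "eval_inverted d \<noteq> 0"
    using assms d eval_inverted_eq_0 by auto
  ultimately show ?thesis
    by (simp add: qt_inverted_def cd frac_eq_eq)
qed

lemma ring_hom_qt_inverted: "ring_hom qt_inverted"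
proof -
  have nz: "eval_inverted b \<noteq> 0" if "b \<noteq> 0" for b
    using that eval_inverted_eq_0 by auto
  note [simp] = qt_inverted_Fract ring_hom_simps[OF ring_hom_eval_inverted] nz
  have "qt_inverted (x + y) = qt_inverted x + qt_inverted y" for x y
    by (cases x; cases y) (simp add: field_simps)
  moreover have "qt_inverted (x * y) = qt_inverted x * qt_inverted y" for x y
    by (cases x; cases y) simp
  moreover have "qt_inverted 1 = 1"
    by (simp add: One_fract_def)
  ultimately show ?thesis by (simp add: ring_hom_def)
qed

lemma qt_inverted_qvar: "qt_inverted qvar = inverse qvar"
  and qt_inverted_tvar: "qt_inverted tvar = inverse tvar"
proof -
  note [simp] = ring_hom_simps[OF ring_hom_eval_inverted] ring_hom_simps[OF ring_hom_eval_inverse_q]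
    map_poly_pCons
  have c: "eval_inverse_q [:0, 1:] = inverse qvar"
    by (simp add: eval_inverse_q_def map_poly_pCons flip: one_pCons)
  show "qt_inverted qvar = inverse qvar"
    by (simp add: qvar_def to_fract_def qt_inverted_Fract, simp add: eval_inverted_altdef c qvar_def to_fract_def)
  show "qt_inverted tvar = inverse tvar"
    by (simp add: tvar_def to_fract_def qt_inverted_Fract, simp add: eval_inverted_altdef tvar_def to_fract_def)
qed

text \<open>These are distinct monomials of a polynomial ring in two variables. Every separation of
  eigenvalues below comes down to this fact.\<close>

lemma qvar_tvar_power_eq_iff:
  "qvar ^ i * tvar ^ j = qvar ^ k * tvar ^ l \<longleftrightarrow> i = k \<and> j = l"
proof
  have "qvar ^ i * tvar ^ j = to_fract (monom (monom 1 i) j)" for i j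
  proof -
    have "qvar ^ i = to_fract [:monom 1 i:]"
      by (induction i) (simp_all add: qvar_def monom_Suc flip: to_fract_mult one_pCons)
    moreover have "tvar ^ j = to_fract (monom 1 j)"
      by (induction j) (simp_all add: tvar_def monom_Suc flip: to_fract_mult)
    ultimately show ?thesis
      by (simp add: smult_monom flip: to_fract_mult)
  qed
  moreover assume "qvar ^ i * tvar ^ j = qvar ^ k * tvar ^ l"
  ultimately show "i = k \<and> j = l"
    by (auto simp: monom_eq_iff')
qed simp

lemma qvar_tvar_powi_eq_1:
  assumes "qvar powi a * tvar powi b = 1"
  shows "a = 0 \<and> b = 0"
proof -
  have split: "x powi k = x ^ nat k / x ^ nat (- k)" if "x \<noteq> 0" for x :: qt and k
    using that by (cases "k \<ge> 0") (simp_all add: power_int_def field_simps)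
  have "qvar ^ nat a * tvar ^ nat b = qvar ^ nat (- a) * tvar ^ nat (- b)"
    using assms by (simp add: split field_simps)
  then show ?thesis
    by (auto simp: qvar_tvar_power_eq_iff)
qed

lemma qvar_tvar_powi_eq_iff:
  "qvar powi a * tvar powi b = qvar powi c * tvar powi d \<longleftrightarrow> a = c \<and> b = d"
proof
  assume "qvar powi a * tvar powi b = qvar powi c * tvar powi d"
  then have "qvar powi (a - c) * tvar powi (b - d) = 1"
    by (simp add: power_int_diff field_simps)
  then show "a = c \<and> b = d"
    using qvar_tvar_powi_eq_1 by fastforce
qed simp

section \<open>The polynomial ring\<close>

abbreviation lookup where "lookup \<equiv> Poly_Mapping.lookup"
abbreviation keys where "keys \<equiv> Poly_Mapping.keys"

definition mon :: "(nat \<Rightarrow>\<^sub>0 nat) \<Rightarrow> zpoly" where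
  "mon m = Poly_Mapping.single m 1"

lemma ring_hom_Const: "ring_hom Const"
  by (simp add: ring_hom_def Const_def single_add mult_single)

lemmas Const_simps = ring_hom_simps[OF ring_hom_Const]

lemma lookup_Const_mult [simp]: "lookup (Const c * f) m = c * lookup f m"
proof -
  have "lookup (Poly_Mapping.map ((*) c) f) m = c * lookup f m"
    by transfer (simp add: when_def)
  then show ?thesis
    by (simp add: Const_def mult_map_scale_conv_mult)
qed

lemma lookup_mon: "lookup (mon m) k = (if k = m then 1 else 0)"
  by (simp add: mon_def lookup_single when_def)

lemma Const_eq_0_iff [simp]: "Const c = 0 \<longleftrightarrow> c = 0"
  unfolding Const_def by (metis lookup_single_eq lookup_zero single_zero)

lemma Const_inverse_cancel: "c \<noteq> 0 \<Longrightarrow> Const (inverse c) * (Const c * f) = f"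
  by (simp add: Const_simps flip: Const_simps(4) mult.assoc)

lemma keys_Const_mult: "keys (Const c * f) \<subseteq> keys f"
  by (auto simp: in_keys_iff)

lemma mon_add: "mon (m + k) = mon m * mon k"
  by (simp add: mon_def mult_single)

lemma mon_0: "mon 0 = 1"
  by (simp add: mon_def)

lemma mon_single: "mon (Poly_Mapping.single i k) = Z i ^ k"
proof (induction k)
  case (Suc k)
  have "mon (Poly_Mapping.single i (Suc k)) = mon (Poly_Mapping.single i 1) * mon (Poly_Mapping.single i k)"
    by (simp flip: mon_add single_add)
  also have "\<dots> = Z i * Z i ^ k"
    unfolding Suc by (simp add: Z_def mon_def)
  finally show ?case by simp
qed (simp add: mon_0)

lemma mon_sum: "mon (sum f A) = (\<Prod>x\<in>A. mon (f x))"
  by (induction A rule: infinite_finite_induct) (simp_all add: mon_0 mon_add)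

lemma exponent_sum_singles:
  fixes m :: "'a \<Rightarrow>\<^sub>0 nat"
  assumes "finite A" "keys m \<subseteq> A"
  shows "m = (\<Sum>i\<in>A. Poly_Mapping.single i (lookup m i))"
proof (rule poly_mapping_eqI)
  fix k
  show "lookup m k = lookup (\<Sum>i\<in>A. Poly_Mapping.single i (lookup m i)) k"
    using assms by (auto simp: lookup_sum lookup_single when_def sum.delta in_keys_iff)
qed

lemma mon_eq_prod:
  assumes "finite A" "keys m \<subseteq> A"
  shows "mon m = (\<Prod>i\<in>A. Z i ^ lookup m i)"
  by (subst exponent_sum_singles[OF assms]) (simp only: mon_sum mon_single)

lemma zpoly_sum_mons:
  assumes "finite A" "keys f \<subseteq> A"
  shows "f = (\<Sum>m\<in>A. Const (lookup f m) * mon m)"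
proof (rule poly_mapping_eqI)
  fix k
  show "lookup f k = lookup (\<Sum>m\<in>A. Const (lookup f m) * mon m) k"
    using assms by (auto simp: lookup_sum lookup_mon in_keys_iff if_distrib sum.delta cong: if_cong)
qed

lemma zpoly_induct [case_names mon add]:
  assumes "\<And>c m. P (Const c * mon m)" and "\<And>f g. P f \<Longrightarrow> P g \<Longrightarrow> P (f + g)"
  shows "P f"
proof -
  have "P (\<Sum>m\<in>A. Const (lookup f m) * mon m)" if "finite A" for A
    using that
  proof (induction A)
    case empty
    then show ?case using assms(1)[of 0] by (simp add: Const_simps)
  qed (simp add: assms)
  from this[of "keys f"] show ?thesis
    by (simp flip: zpoly_sum_mons)
qed

lemma zsubst_eq_sum:
  assumes "finite A" "keys f \<subseteq> A"
  shows "zsubst \<sigma> f = (\<Sum>m\<in>A. Const (lookup f m) * (\<Prod>i\<in>keys m. \<sigma> i ^ lookup m i))"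
  unfolding zsubst_def
  by (rule sum.mono_neutral_left) (use assms in \<open>auto simp: in_keys_iff Const_simps\<close>)

lemma zsubst_add: "zsubst \<sigma> (f + g) = zsubst \<sigma> f + zsubst \<sigma> g"
  using keys_add[of f g]
  by (simp add: zsubst_eq_sum[of "keys f \<union> keys g"] lookup_add Const_simps distrib_right sum.distrib)

lemma zsubst_mon:
  assumes "finite A" "keys m \<subseteq> A"
  shows "zsubst \<sigma> (Const c * mon m) = Const c * (\<Prod>i\<in>A. \<sigma> i ^ lookup m i)"
proof -
  have "(\<Prod>i\<in>keys m. \<sigma> i ^ lookup m i) = (\<Prod>i\<in>A. \<sigma> i ^ lookup m i)"
    by (rule prod.mono_neutral_left) (use assms in \<open>auto simp: in_keys_iff\<close>)
  moreover have "keys (Const c * mon m) \<subseteq> {m}"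
    by (auto simp: in_keys_iff lookup_mon split: if_splits)
  ultimately show ?thesis
    by (simp add: zsubst_eq_sum[of "{m}"] lookup_mon)
qed

lemma zsubst_Const [simp]: "zsubst \<sigma> (Const c) = Const c"
  using zsubst_mon[of "{}" 0 \<sigma> c] by (simp add: mon_0)

lemma zsubst_Z [simp]: "zsubst \<sigma> (Z i) = \<sigma> i"
  using zsubst_mon[of "{i}" "Poly_Mapping.single i 1" \<sigma> 1]
  by (simp add: mon_single Const_simps del: single_one)

lemma ring_hom_zsubst: "ring_hom (zsubst \<sigma>)"
proof -
  have mm: "zsubst \<sigma> (Const c * mon m * (Const d * mon k))
      = zsubst \<sigma> (Const c * mon m) * zsubst \<sigma> (Const d * mon k)" for c d m k
  proof -
    let ?A = "keys m \<union> keys k"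
    have "Const c * mon m * (Const d * mon k) = Const (c * d) * mon (m + k)"
      by (simp add: Const_simps mon_add)
    moreover have "zsubst \<sigma> (Const (c * d) * mon (m + k))
        = Const (c * d) * (\<Prod>i\<in>?A. \<sigma> i ^ lookup (m + k) i)"
      by (rule zsubst_mon) (use keys_add[of m k] in auto)
    ultimately show ?thesis
      by (simp only: zsubst_mon[of ?A m] zsubst_mon[of ?A k] finite_Un finite_keys Un_upper1 Un_upper2
          lookup_add power_add prod.distrib Const_simps mult_ac simp_thms)
  qed
  have "zsubst \<sigma> (Const c * mon m * g) = zsubst \<sigma> (Const c * mon m) * zsubst \<sigma> g" for c m g
    by (induction g rule: zpoly_induct) (simp_all add: mm zsubst_add distrib_left)
  then have "zsubst \<sigma> (f * g) = zsubst \<sigma> f * zsubst \<sigma> g" for f g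
    by (induction f rule: zpoly_induct) (simp_all add: zsubst_add distrib_right)
  moreover have "zsubst \<sigma> 1 = 1"
    using zsubst_Const[of \<sigma> 1] by (simp add: Const_simps)
  ultimately show ?thesis
    by (simp add: ring_hom_def zsubst_add)
qed

definition alg_hom :: "(zpoly \<Rightarrow> zpoly) \<Rightarrow> bool" where
  "alg_hom \<phi> \<longleftrightarrow> ring_hom \<phi> \<and> (\<forall>c. \<phi> (Const c) = Const c)"

lemma alg_hom_ring_hom: "alg_hom \<phi> \<Longrightarrow> ring_hom \<phi>"
  and alg_hom_Const: "alg_hom \<phi> \<Longrightarrow> \<phi> (Const c) = Const c"
  by (simp_all add: alg_hom_def)

lemmas alg_hom_simps = ring_hom_simps[OF alg_hom_ring_hom] alg_hom_Const

lemma alg_hom_zsubst: "alg_hom (zsubst \<sigma>)"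
  by (simp add: alg_hom_def ring_hom_zsubst)

lemma alg_hom_comp: "alg_hom \<phi> \<Longrightarrow> alg_hom \<psi> \<Longrightarrow> alg_hom (\<lambda>f. \<phi> (\<psi> f))"
  by (simp add: alg_hom_def ring_hom_def)

lemma alg_hom_id: "alg_hom (\<lambda>f. f)"
  by (simp add: alg_hom_def ring_hom_def)

text \<open>Relations between substitutions, such as the braid relation of the s_i, then only have
  to be compared on the variables.\<close>

lemma alg_hom_ext:
  assumes "alg_hom \<phi>" "alg_hom \<psi>" "\<And>i. \<phi> (Z i) = \<psi> (Z i)"
  shows "\<phi> f = \<psi> f"
proof (induction f rule: zpoly_induct)
  case (mon c m)
  show ?case
    using assms
    by (simp add: mon_eq_prod[of "keys m"] alg_hom_simps ring_hom_prod[OF alg_hom_ring_hom])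
qed (use assms in \<open>simp add: alg_hom_simps\<close>)

section \<open>The substitutions s_i and \<omega> as algebra homomorphisms\<close>

lemma alg_hom_s_op: "alg_hom (s_op i)"
  unfolding s_op_def by (rule alg_hom_zsubst)

lemma s_op_Z: "s_op i (Z j) = (if j = i then Z (i + 1) else if j = i + 1 then Z i else Z j)"
  by (simp add: s_op_def)

lemmas s_op_simps = alg_hom_simps[OF alg_hom_s_op]

lemma s_op_s_op [simp]: "s_op i (s_op i f) = f"
  by (rule alg_hom_ext[OF alg_hom_comp[OF alg_hom_s_op alg_hom_s_op] alg_hom_id])
    (simp add: s_op_Z)

lemma s_op_commute:
  assumes "i + 1 < j"
  shows "s_op i (s_op j f) = s_op j (s_op i f)"
  by (rule alg_hom_ext[OF alg_hom_comp[OF alg_hom_s_op alg_hom_s_op] alg_hom_comp[OF alg_hom_s_op alg_hom_s_op]])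
    (use assms in \<open>auto simp: s_op_Z\<close>)

lemma s_op_braid: "s_op i (s_op (Suc i) (s_op i f)) = s_op (Suc i) (s_op i (s_op (Suc i) f))"
  by (rule alg_hom_ext[OF alg_hom_comp[OF alg_hom_s_op alg_hom_comp[OF alg_hom_s_op alg_hom_s_op]]
        alg_hom_comp[OF alg_hom_s_op alg_hom_comp[OF alg_hom_s_op alg_hom_s_op]]])
    (auto simp: s_op_Z)

lemma omega_Suc: "n \<ge> 1 \<Longrightarrow> omega (Suc n) f = s_op n (omega n f)"
  by (simp add: omega_def)

lemma alg_hom_omega: "alg_hom (omega n)"
proof (induction n)
  case 0
  then show ?case by (simp add: omega_def[abs_def] tau1_def[abs_def] alg_hom_zsubst)
next
  case (Suc n)
  show ?case
  proof (cases "n = 0")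
    case True
    then show ?thesis by (simp add: omega_def[abs_def] tau1_def[abs_def] alg_hom_zsubst)
  next
    case False
    then show ?thesis
      using alg_hom_comp[OF alg_hom_s_op Suc, of n] by (simp add: omega_Suc fun_eq_iff alg_hom_def ring_hom_def)
  qed
qed

lemmas omega_simps = alg_hom_simps[OF alg_hom_omega]

lemma omega_Z:
  assumes "n \<ge> 1"
  shows "omega n (Z j) = (if j = 1 then Const qvar * Z n else if 2 \<le> j \<and> j \<le> n then Z (j - 1) else Z j)"
  using assms
proof (induction n rule: dec_induct)
  case base
  then show ?case by (simp add: omega_def tau1_def)
next
  case (step n)
  then show ?case by (auto simp: omega_Suc s_op_simps s_op_Z)
qed

lemma Z_eq_iff [simp]: "Z i = Z j \<longleftrightarrow> i = j"
proof
  assume "Z i = Z j"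
  then have "lookup (Z i) (Poly_Mapping.single i 1) = lookup (Z j) (Poly_Mapping.single i 1)" by simp
  then have "Poly_Mapping.single j 1 = (Poly_Mapping.single i 1 :: nat \<Rightarrow>\<^sub>0 nat)"
    by (auto simp: Z_def lookup_single when_def split: if_splits)
  then have "lookup (Poly_Mapping.single j 1) i = (lookup (Poly_Mapping.single i 1) i :: nat)"
    by simp
  then show "i = j"
    by (auto simp: lookup_single when_def split: if_splits)
qed simp

lemma Z_nz [simp]: "Z i \<noteq> 0"
  unfolding Z_def by (metis keys_single keys_zero insert_not_empty zero_neq_one)

text \<open>The elements f for which d divides \<phi>(f) - f form a subalgebra, by \<phi>(fg) - fg =
  \<phi>(f)(\<phi>(g) - g) + (\<phi>(f) - f)g. With \<phi> = s_i this makes the divided difference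
  in T_i a polynomial.\<close>

lemma alg_hom_dvd_diff:
  assumes "alg_hom \<phi>" "\<And>i. d dvd \<phi> (Z i) - Z i"
  shows "d dvd \<phi> f - f"
proof -
  have mult: "d dvd \<phi> (f * g) - f * g" if "d dvd \<phi> f - f" "d dvd \<phi> g - g" for f g
  proof -
    have "\<phi> (f * g) - f * g = \<phi> f * (\<phi> g - g) + (\<phi> f - f) * g"
      using assms by (simp add: alg_hom_simps algebra_simps)
    then show ?thesis using that by simp
  qed
  have one: "d dvd \<phi> 1 - 1"
    using assms by (simp add: alg_hom_simps)
  have pow: "d dvd \<phi> (Z i ^ k) - Z i ^ k" for i k
    by (induction k) (use one in simp, use mult[of "Z i"] assms(2) in simp)
  have prod: "d dvd \<phi> (\<Prod>i\<in>A. Z i ^ e i) - (\<Prod>i\<in>A. Z i ^ e i)" for A and e :: "nat \<Rightarrow> nat"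
    by (induction A rule: infinite_finite_induct) (use one mult pow in simp_all)
  show ?thesis
  proof (induction f rule: zpoly_induct)
    case (mon c m)
    have "d dvd \<phi> (Const c) - Const c"
      using assms(1) by (simp add: alg_hom_Const)
    then show ?case
      using mult prod[of "lookup m" "keys m"] by (simp add: mon_eq_prod[of "keys m"])
  next
    case (add f g)
    have "\<phi> (f + g) - (f + g) = (\<phi> f - f) + (\<phi> g - g)"
      using assms(1) by (simp add: alg_hom_simps)
    then show ?case using add by (simp only: dvd_add)
  qed
qed

section \<open>Demazure--Lusztig operators\<close>

text \<open>The denominator is cleared. Since z_i - z_{i+1} is not a zero divisor, this equation
  characterizes T_i f, and identities can be checked without leaving the polynomial ring.\<close>

lemma T_op_eq:
  "(Z i - Z (i + 1)) * T_op i f =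
     (1 - Const tvar) * Z (i + 1) * f + (Const tvar * Z i - Z (i + 1)) * s_op i f"
proof -
  have "Z i - Z (i + 1) dvd s_op i f - f"
  proof (rule alg_hom_dvd_diff[OF alg_hom_s_op])
    fix j
    have "s_op i (Z j) - Z j = 0 \<or> s_op i (Z j) - Z j = - (Z i - Z (i + 1))
        \<or> s_op i (Z j) - Z j = Z i - Z (i + 1)"
      by (auto simp: s_op_Z)
    then show "Z i - Z (i + 1) dvd s_op i (Z j) - Z j"
      by (metis dvd_0_right dvd_minus_iff dvd_refl)
  qed
  then obtain h where h: "s_op i f - f = (Z i - Z (i + 1)) * h" by blast
  define g where "g = (Const tvar * Z i - Z (i + 1)) * h"
  have g: "(Z i - Z (i + 1)) * g = (Const tvar * Z i - Z (i + 1)) * (s_op i f - f)"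
    unfolding g_def h by (simp add: mult_ac)
  have nz: "Z i - Z (i + 1) \<noteq> 0" by simp
  have "(THE g. (Z i - Z (i + 1)) * g = (Const tvar * Z i - Z (i + 1)) * (s_op i f - f)) = g"
  proof (rule the_equality)
    show "g' = g" if "(Z i - Z (i + 1)) * g' = (Const tvar * Z i - Z (i + 1)) * (s_op i f - f)" for g'
      using that g nz mult_left_cancel by metis
  qed (rule g)
  then have "(Z i - Z (i + 1)) * T_op i f
      = (Z i - Z (i + 1)) * (Const tvar * f) + (Const tvar * Z i - Z (i + 1)) * (s_op i f - f)"
    unfolding T_op_def by (simp only: distrib_left g)
  then show ?thesis by (simp add: algebra_simps)
qed

lemma T_op_unique:
  assumes "(Z i - Z (i + 1)) * g =
     (1 - Const tvar) * Z (i + 1) * f + (Const tvar * Z i - Z (i + 1)) * s_op i f"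
  shows "T_op i f = g"
proof -
  have "(Z i - Z (i + 1)) * T_op i f = (Z i - Z (i + 1)) * g"
    unfolding T_op_eq assms ..
  then show ?thesis by simp
qed

lemma T_op_add: "T_op i (f + g) = T_op i f + T_op i g"
  by (rule T_op_unique) (simp only: distrib_left T_op_eq, simp add: s_op_simps algebra_simps)

lemma T_op_mult: "s_op i g = g \<Longrightarrow> T_op i (g * f) = g * T_op i f"
proof (rule T_op_unique)
  assume g: "s_op i g = g"
  have "(Z i - Z (i + 1)) * (g * T_op i f) = g * ((Z i - Z (i + 1)) * T_op i f)"
    by (simp add: mult_ac)
  then show "(Z i - Z (i + 1)) * (g * T_op i f) =
    (1 - Const tvar) * Z (i + 1) * (g * f) + (Const tvar * Z i - Z (i + 1)) * s_op i (g * f)"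
    unfolding T_op_eq by (simp add: s_op_simps g algebra_simps)
qed

lemma T_op_Const: "T_op i (Const c * f) = Const c * T_op i f"
  by (rule T_op_mult) (simp add: s_op_simps)

lemma T_op_0: "T_op i 0 = 0"
  using T_op_Const[of i 0 0] by (simp add: Const_simps)

lemma T_op_minus: "T_op i (- f) = - T_op i f"
  using T_op_add[of i f "- f"] T_op_0[of i] by (simp add: add_eq_0_iff)

lemma T_op_diff: "T_op i (f - g) = T_op i f - T_op i g"
  using T_op_add[of i f "- g"] T_op_minus[of i g] by simp

lemma s_op_T_op:
  "(Z (i + 1) - Z i) * s_op i (T_op i f) =
     (1 - Const tvar) * Z i * s_op i f + (Const tvar * Z (i + 1) - Z i) * f"
  using arg_cong[OF T_op_eq[of i f], of "s_op i"]
  by (simp add: s_op_simps s_op_Z)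

text \<open>The Hecke relation (T_i - t)(T_i + 1) = 0. The second application of T_i needs s_i T_i
  f, so the cleared formula is used once directly and once reflected.\<close>

lemma T_op_quadratic: "T_op i (T_op i f) = (Const tvar - 1) * T_op i f + Const tvar * f"
proof -
  define x y t u v su g where "x = Z i" and "y = Z (i + 1)" and "t = Const tvar" and "u = T_op i f"
    and "v = T_op i u" and "su = s_op i u" and "g = s_op i f"
  note defs = x_def[symmetric] y_def[symmetric] t_def[symmetric] g_def[symmetric]
  have 1: "(x - y) * u = (1 - t) * y * f + (t * x - y) * g"
    using T_op_eq[of i f] unfolding defs u_def[symmetric] .
  have 2: "(x - y) * v = (1 - t) * y * u + (t * x - y) * su"
    using T_op_eq[of i u] unfolding defs v_def[symmetric] su_def[symmetric] .
  have 3: "(y - x) * su = (1 - t) * x * g + (t * y - x) * f"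
    using s_op_T_op[of i f] unfolding defs u_def[symmetric] su_def[symmetric] .
  have "(x - y) * ((x - y) * (v - ((t - 1) * u + t * f))) = 0"
    using 1 2 3 by algebra
  moreover have "x - y \<noteq> 0"
    by (simp add: x_def y_def)
  ultimately have "v = (t - 1) * u + t * f"
    by simp
  then show ?thesis
    by (simp add: v_def t_def u_def)
qed

text \<open>Solves the quadratic relation for the inverse; \<open>inv_T_op\<close> identifies it
  with the \<open>inv\<close> that occurs in \<open>Y_op\<close>.\<close>

definition T_inv :: "nat \<Rightarrow> zpoly \<Rightarrow> zpoly" where
  "T_inv i f = Const (inverse tvar) * (T_op i f - (Const tvar - 1) * f)"

lemma Const_tvar_inverse: "Const tvar * Const (inverse tvar) = 1"
  by (simp flip: Const_simps)

lemma T_op_T_inv [simp]: "T_op i (T_inv i f) = f" and T_inv_T_op [simp]: "T_inv i (T_op i f) = f"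
proof -
  have 0: "Const (inverse tvar) * (Const tvar * f) = f"
    by (simp add: Const_inverse_cancel)
  have "T_op i ((Const tvar - 1) * f) = (Const tvar - 1) * T_op i f"
    by (rule T_op_mult) (simp add: s_op_simps)
  then show "T_op i (T_inv i f) = f"
    using 0 by (simp add: T_inv_def T_op_Const T_op_diff T_op_quadratic)
  show "T_inv i (T_op i f) = f"
    using 0 by (simp add: T_inv_def T_op_quadratic)
qed

lemma inv_T_op: "inv (T_op i) = T_inv i"
  by (rule inv_unique_comp) (simp_all add: fun_eq_iff)

lemma T_inv_Const: "T_inv i (Const c * f) = Const c * T_inv i f"
  by (simp only: T_inv_def T_op_Const) (simp add: algebra_simps)

lemma T_inv_add: "T_inv i (f + g) = T_inv i f + T_inv i g"
  by (simp only: T_inv_def T_op_add) (simp add: algebra_simps)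

lemma T_inv_mult: "s_op i g = g \<Longrightarrow> T_inv i (g * f) = g * T_inv i f"
  by (simp only: T_inv_def T_op_mult) (simp add: algebra_simps)

text \<open>Instances: conjugation by \<open>\<omega>\<close>, by \<open>\<omega>\<^sup>2\<close> in the affine case, and the commutation of distant generators.\<close>

lemma T_op_intertwine:
  assumes \<phi>: "alg_hom \<phi>" and c: "c \<noteq> 0"
    and Z: "\<phi> (Z i) = Const c * Z k" "\<phi> (Z (i + 1)) = Const c * Z (k + 1)"
    and s: "\<And>f. \<phi> (s_op i f) = s_op k (\<phi> f)"
  shows "\<phi> (T_op i f) = T_op k (\<phi> f)"
proof -
  have "Const c * ((Z k - Z (k + 1)) * \<phi> (T_op i f)) = Const c *
    ((1 - Const tvar) * Z (k + 1) * \<phi> f + (Const tvar * Z k - Z (k + 1)) * s_op k (\<phi> f))"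
    using arg_cong[OF T_op_eq[of i f], of \<phi>]
    by (simp only: alg_hom_simps[OF \<phi>] Z s) (simp add: algebra_simps)
  then have "(Z k - Z (k + 1)) * \<phi> (T_op i f) =
    (1 - Const tvar) * Z (k + 1) * \<phi> f + (Const tvar * Z k - Z (k + 1)) * s_op k (\<phi> f)"
    using c by simp
  then show ?thesis by (simp add: T_op_unique)
qed

lemma T_op_s_op_commute:
  assumes "i + 1 < j \<or> j + 1 < i"
  shows "s_op j (T_op i f) = T_op i (s_op j f)"
  by (rule T_op_intertwine[of _ 1])
    (use assms in \<open>auto simp: alg_hom_s_op s_op_Z Const_simps s_op_commute s_op_commute[symmetric]\<close>)

lemma T_op_commute:
  assumes "i + 1 < j \<or> j + 1 < i"
  shows "T_op i (T_op j f) = T_op j (T_op i f)"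
proof (rule T_op_unique[symmetric, of j])
  let ?a = "(1 - Const tvar) * Z (j + 1)" and ?b = "Const tvar * Z j - Z (j + 1)"
  have sZ: "s_op i (Z j) = Z j" "s_op i (Z (j + 1)) = Z (j + 1)"
    using assms by (auto simp: s_op_Z)
  \<comment> \<open>T_i is linear over polynomials invariant under s_i, and z_j, z_{j+1} are
    invariant here. So T_i can be applied to the equation that characterizes T_j f.\<close>
  have "(Z j - Z (j + 1)) * T_op i (T_op j f) = T_op i ((Z j - Z (j + 1)) * T_op j f)"
    by (rule T_op_mult[symmetric]) (simp only: s_op_simps sZ)
  also have "\<dots> = T_op i (?a * f) + T_op i (?b * s_op j f)"
    unfolding T_op_eq T_op_add ..
  also have "T_op i (?a * f) = ?a * T_op i f"
    by (rule T_op_mult) (simp only: s_op_simps sZ)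
  also have "T_op i (?b * s_op j f) = ?b * T_op i (s_op j f)"
    by (rule T_op_mult) (simp only: s_op_simps sZ)
  also have "T_op i (s_op j f) = s_op j (T_op i f)"
    using assms by (simp add: T_op_s_op_commute)
  finally show "(Z j - Z (j + 1)) * T_op i (T_op j f)
    = (1 - Const tvar) * Z (j + 1) * T_op i f + (Const tvar * Z j - Z (j + 1)) * s_op j (T_op i f)" .
qed

text \<open>The braid relation as an identity among the six images f, f1, f2, f12, f21, f121 of f
  under the permutations of x, y, z. Each hypothesis is the cleared formula for a T, transported by
  a permutation; abstract unknowns keep the algebra small.\<close>

lemma braid_identity:
  fixes x y z t f :: "'a::idom"
  assumes nz: "x \<noteq> y" "x \<noteq> z" "y \<noteq> z"
    and a: "(x - y) * a = (1 - t) * y * f + (t * x - y) * f1"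
    and s2a: "(x - z) * s2a = (1 - t) * z * f2 + (t * x - z) * f21"
    and b: "(y - z) * b = (1 - t) * z * a + (t * y - z) * s2a"
    and s1a: "(y - x) * s1a = (1 - t) * x * f1 + (t * y - x) * f"
    and s12a: "(y - z) * s12a = (1 - t) * z * f12 + (t * y - z) * f121"
    and s1b: "(x - z) * s1b = (1 - t) * z * s1a + (t * x - z) * s12a"
    and c: "(x - y) * c = (1 - t) * y * b + (t * x - y) * s1b"
    and a': "(y - z) * a' = (1 - t) * z * f + (t * y - z) * f2"
    and s1a': "(x - z) * s1a' = (1 - t) * z * f1 + (t * x - z) * f12"
    and b': "(x - y) * b' = (1 - t) * y * a' + (t * x - y) * s1a'"
    and s2a': "(z - y) * s2a' = (1 - t) * y * f2 + (t * z - y) * f"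
    and s21a': "(x - y) * s21a' = (1 - t) * y * f21 + (t * x - y) * f121"
    and s2b': "(x - z) * s2b' = (1 - t) * z * s2a' + (t * x - z) * s21a'"
    and c': "(y - z) * c' = (1 - t) * z * b' + (t * y - z) * s2b'"
  shows "c = c'"
proof -
  \<comment> \<open>V is the common denominator after two applications. The third one adds a factor
    x - y on one side and y - z on the other, so the two sides meet over (x - y)(y - z)V.\<close>
  define V where "V = (x - y) * (x - z) * (y - z)"
  have "V * b = (1 - t) * z * (x - z) * ((x - y) * a) + (t * y - z) * (x - y) * ((x - z) * s2a)"
    unfolding V_def using b by algebra
  then have Vb: "V * b = (1 - t) * z * (x - z) * ((1 - t) * y * f + (t * x - y) * f1)
      + (t * y - z) * (x - y) * ((1 - t) * z * f2 + (t * x - z) * f21)"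
    unfolding a s2a .
  have "V * s1b = (t * x - z) * (x - y) * ((y - z) * s12a) - (1 - t) * z * (y - z) * ((y - x) * s1a)"
    unfolding V_def using s1b by algebra
  then have Vs1b: "V * s1b = (t * x - z) * (x - y) * ((1 - t) * z * f12 + (t * y - z) * f121)
      - (1 - t) * z * (y - z) * ((1 - t) * x * f1 + (t * y - x) * f)"
    unfolding s12a s1a .
  have "(x - y) * (V * c) = (1 - t) * y * (V * b) + (t * x - y) * (V * s1b)"
    using c by algebra
  note Vc = this[unfolded Vb Vs1b]
  have "V * b' = (1 - t) * y * (x - z) * ((y - z) * a') + (t * x - y) * (y - z) * ((x - z) * s1a')"
    unfolding V_def using b' by algebra
  then have Vb': "V * b' = (1 - t) * y * (x - z) * ((1 - t) * z * f + (t * y - z) * f2)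
      + (t * x - y) * (y - z) * ((1 - t) * z * f1 + (t * x - z) * f12)"
    unfolding a' s1a' .
  have "V * s2b' = (t * x - z) * (y - z) * ((x - y) * s21a') - (1 - t) * z * (x - y) * ((z - y) * s2a')"
    unfolding V_def using s2b' by algebra
  then have Vs2b': "V * s2b' = (t * x - z) * (y - z) * ((1 - t) * y * f21 + (t * x - y) * f121)
      - (1 - t) * z * (x - y) * ((1 - t) * y * f2 + (t * z - y) * f)"
    unfolding s21a' s2a' .
  have "(y - z) * (V * c') = (1 - t) * z * (V * b') + (t * y - z) * (V * s2b')"
    using c' by algebra
  note Vc' = this[unfolded Vb' Vs2b']
  have "(x - y) * (y - z) * V * (c - c') = (y - z) * ((x - y) * (V * c)) - (x - y) * ((y - z) * (V * c'))"
    by algebra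
  also have "\<dots> = 0"
    unfolding Vc Vc' by algebra
  finally show ?thesis
    using nz by (simp add: V_def)
qed

lemma T_op_eq_image:
  assumes "alg_hom \<phi>"
  shows "(\<phi> (Z i) - \<phi> (Z (i + 1))) * \<phi> (T_op i f) =
     (1 - Const tvar) * \<phi> (Z (i + 1)) * \<phi> f + (Const tvar * \<phi> (Z i) - \<phi> (Z (i + 1))) * \<phi> (s_op i f)"
  using arg_cong[OF T_op_eq[of i f], of \<phi>] by (simp only: alg_hom_simps[OF assms])

lemma T_op_braid:
  "T_op i (T_op (Suc i) (T_op i f)) = T_op (Suc i) (T_op i (T_op (Suc i) f))"
proof -
  let ?s1 = "s_op i" and ?s2 = "s_op (Suc i)"
  have 12: "alg_hom (\<lambda>f. ?s1 (?s2 f))" and 21: "alg_hom (\<lambda>f. ?s2 (?s1 f))"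
    by (rule alg_hom_comp[OF alg_hom_s_op alg_hom_s_op])+
  define x y z t where "x = Z i" and "y = Z (Suc i)" and "z = Z (Suc (Suc i))" and "t = Const tvar"
  have nz: "x \<noteq> y" "x \<noteq> z" "y \<noteq> z" by (simp_all add: x_def y_def z_def)
  have sZ: "?s1 x = y" "?s1 y = x" "?s1 z = z" "?s2 x = x" "?s2 y = z" "?s2 z = y"
    by (simp_all add: x_def y_def z_def s_op_Z)
  have T1: "(\<phi> x - \<phi> y) * \<phi> (T_op i f) = (1 - t) * \<phi> y * \<phi> f + (t * \<phi> x - \<phi> y) * \<phi> (?s1 f)"
    if "alg_hom \<phi>" for \<phi> f
    using T_op_eq_image[OF that, of i f] by (simp only: x_def y_def t_def Suc_eq_plus1)
  have T2: "(\<phi> y - \<phi> z) * \<phi> (T_op (Suc i) f)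
      = (1 - t) * \<phi> z * \<phi> f + (t * \<phi> y - \<phi> z) * \<phi> (?s2 f)" if "alg_hom \<phi>" for \<phi> f
    using T_op_eq_image[OF that, of "Suc i" f] by (simp only: y_def z_def t_def Suc_eq_plus1)
  note s1 = alg_hom_s_op[of i] and s2 = alg_hom_s_op[of "Suc i"] and id = alg_hom_id
  show ?thesis
    by (rule braid_identity[OF nz T1[OF id, of f] T1[OF s2, of f, unfolded sZ]
          T2[OF id, of "T_op i f"] T1[OF s1, of f, unfolded sZ s_op_s_op] T1[OF 12, of f, unfolded sZ]
          T2[OF s1, of "T_op i f", unfolded sZ] T1[OF id, of "T_op (Suc i) (T_op i f)"]
          T2[OF id, of f] T2[OF s1, of f, unfolded sZ] T1[OF id, of "T_op (Suc i) f"]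
          T2[OF s2, of f, unfolded sZ s_op_s_op] T2[OF 21, of f, unfolded sZ s_op_braid[of i f, symmetric]]
          T1[OF s2, of "T_op (Suc i) f", unfolded sZ] T2[OF id, of "T_op i (T_op (Suc i) f)"]])
qed

lemma T_op_Z:
  "T_op i (Z i * f) = Z (i + 1) * (T_op i f - (Const tvar - 1) * f)"
proof (rule T_op_unique)
  have "(Z i - Z (i + 1)) * (Z (i + 1) * (T_op i f - (Const tvar - 1) * f))
      = Z (i + 1) * ((Z i - Z (i + 1)) * T_op i f) - (Z i - Z (i + 1)) * Z (i + 1) * (Const tvar - 1) * f"
    by (simp add: algebra_simps)
  then show "(Z i - Z (i + 1)) * (Z (i + 1) * (T_op i f - (Const tvar - 1) * f)) =
    (1 - Const tvar) * Z (i + 1) * (Z i * f) + (Const tvar * Z i - Z (i + 1)) * s_op i (Z i * f)"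
    unfolding T_op_eq by (simp add: s_op_simps s_op_Z algebra_simps)
qed

lemma T_op_Z_Suc:
  "T_op i (Z (i + 1) * f) = Z i * T_op i f + (Const tvar - 1) * Z (i + 1) * f"
proof (rule T_op_unique)
  have "(Z i - Z (i + 1)) * (Z i * T_op i f + (Const tvar - 1) * Z (i + 1) * f)
      = Z i * ((Z i - Z (i + 1)) * T_op i f) + (Z i - Z (i + 1)) * Z (i + 1) * (Const tvar - 1) * f"
    by (simp add: algebra_simps)
  then show "(Z i - Z (i + 1)) * (Z i * T_op i f + (Const tvar - 1) * Z (i + 1) * f) =
    (1 - Const tvar) * Z (i + 1) * (Z (i + 1) * f) + (Const tvar * Z i - Z (i + 1)) * s_op i (Z (i + 1) * f)"
    unfolding T_op_eq by (simp add: s_op_simps s_op_Z algebra_simps)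
qed

text \<open>Crossing a variable replaces T_i by its inverse. This is what moves a factor from the
  direct product in Y_i to the product of inverses.\<close>

lemma T_op_Z_inv: "T_op i (Z i * f) = Const tvar * (Z (i + 1) * T_inv i f)"
proof -
  have "Const tvar * T_inv i f = T_op i f - (Const tvar - 1) * f"
    by (simp add: T_inv_def Const_tvar_inverse flip: mult.assoc)
  then show ?thesis
    by (simp only: T_op_Z mult.left_commute[of "Const tvar"])
qed

lemma T_inv_Z_Suc: "T_inv i (Z (i + 1) * f) = Const (inverse tvar) * (Z i * T_op i f)"
proof -
  have "T_op i (Const (inverse tvar) * (Z i * T_op i f)) = Z (i + 1) * f"
    by (simp add: T_op_Const T_op_Z_inv Const_inverse_cancel del: add_Suc_right)
  then show ?thesis by (metis T_inv_T_op)
qed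

lemma T_inv_commute_of:
  assumes "\<And>f. \<phi> (T_op i f) = T_op k (\<phi> f)"
  shows "\<phi> (T_inv i f) = T_inv k (\<phi> f)"
  by (metis assms T_inv_T_op T_op_T_inv)

lemma T_op_T_inv_commute:
  assumes "i + 1 < j \<or> j + 1 < i"
  shows "T_op i (T_inv j f) = T_inv j (T_op i f)"
  by (rule T_inv_commute_of[of "T_op i"]) (rule T_op_commute[OF assms])

text \<open>The braid relation with inverses brought to both sides, in the form that lets a
  generator cross a product of inverses.\<close>

lemma T_inv_T_inv_T_op:
  "T_inv i (T_inv (Suc i) (T_op i f)) = T_op (Suc i) (T_inv i (T_inv (Suc i) f))"
proof -
  have "T_op (Suc i) (T_op i (T_op (Suc i) (T_inv i (T_inv (Suc i) f)))) = T_op i f"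
    by (simp flip: T_op_braid)
  then show ?thesis by (metis T_inv_T_op)
qed

section \<open>Conjugation of the Hecke generators by \<omega>\<close>

lemma omega_s_op:
  assumes "1 \<le> i" "i + 1 < n"
  shows "omega n (s_op (i + 1) f) = s_op i (omega n f)"
  by (rule alg_hom_ext[OF alg_hom_comp[OF alg_hom_omega alg_hom_s_op] alg_hom_comp[OF alg_hom_s_op alg_hom_omega]])
    (use assms in \<open>auto simp: omega_Z s_op_Z s_op_simps\<close>)

lemma omega_T_op:
  assumes "1 \<le> i" "i + 1 < n"
  shows "omega n (T_op (i + 1) f) = T_op i (omega n f)"
proof (rule T_op_intertwine[OF alg_hom_omega, of 1])
  show "omega n (s_op (i + 1) f) = s_op i (omega n f)" for f
    by (rule omega_s_op[OF assms])
qed (use assms in \<open>auto simp: omega_Z Const_simps\<close>)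

lemma omega_T_inv:
  assumes "1 \<le> i" "i + 1 < n"
  shows "omega n (T_inv (i + 1) f) = T_inv i (omega n f)"
  by (rule T_inv_commute_of[of "omega n"]) (rule omega_T_op[OF assms])

text \<open>A single \<omega> would turn s_1 into an affine reflection, which is not among the s_i.
  After two steps the pair z_1, z_2 has become q z_{n-1}, q z_n, again a pair of neighbours.\<close>

lemma omega_omega_s_op:
  assumes "2 \<le> n"
  shows "omega n (omega n (s_op 1 f)) = s_op (n - 1) (omega n (omega n f))"
proof (rule alg_hom_ext[OF alg_hom_comp[OF alg_hom_omega alg_hom_comp[OF alg_hom_omega alg_hom_s_op]]
        alg_hom_comp[OF alg_hom_s_op alg_hom_comp[OF alg_hom_omega alg_hom_omega]]])
  fix i
  have 1: "omega n (Z 1) = Const qvar * Z n" and 2: "omega n (Z 2) = Z 1"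
    and n: "omega n (Z n) = Z (n - 1)"
    using assms by (simp_all add: omega_Z)
  have n1: "Suc (n - 1) = n" using assms by simp
  consider "i = 1" | "i = 2" | "3 \<le> i" "i \<le> n" | "i = 0 \<or> n < i" by linarith
  then show "omega n (omega n (s_op 1 (Z i))) = s_op (n - 1) (omega n (omega n (Z i)))"
  proof cases
    case 1
    have "s_op 1 (Z 1) = Z 2" by (simp add: s_op_Z numeral_2_eq_2)
    moreover have "s_op (n - 1) (Z (n - 1)) = Z n" using n1 by (simp add: s_op_Z)
    ultimately show ?thesis
      by (simp only: \<open>i = 1\<close> 2 \<open>omega n (Z 1) = _\<close> n s_op_simps omega_simps)
  next
    case 2
    have "s_op 1 (Z 2) = Z 1" by (simp add: s_op_Z)
    then show ?thesis
      using 2 assms by (simp only: \<open>omega n (Z 1) = _\<close> \<open>omega n (Z 2) = _\<close> omega_simps n s_op_simps)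
        (simp add: s_op_Z)
  next
    case 3
    then have "omega n (Z i) = Z (i - 1)" "omega n (Z (i - 1)) = Z (i - 1 - 1)" "s_op 1 (Z i) = Z i"
      by (auto simp: omega_Z s_op_Z)
    then show ?thesis using 3 by (auto simp: s_op_Z)
  next
    case 4
    then have "omega n (Z i) = Z i" "s_op 1 (Z i) = Z i" "s_op (n - 1) (Z i) = Z i"
      using assms by (auto simp: omega_Z s_op_Z)
    then show ?thesis by simp
  qed
qed

lemma omega_omega_T_op:
  assumes "2 \<le> n"
  shows "omega n (omega n (T_op 1 f)) = T_op (n - 1) (omega n (omega n f))"
proof (rule T_op_intertwine[OF alg_hom_comp[OF alg_hom_omega alg_hom_omega], of qvar])
  show "omega n (omega n (s_op 1 f)) = s_op (n - 1) (omega n (omega n f))" for f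
    by (rule omega_omega_s_op[OF assms])
qed (use assms in \<open>auto simp: omega_Z omega_simps\<close>)

lemma omega_omega_T_inv:
  assumes "2 \<le> n"
  shows "omega n (omega n (T_inv 1 f)) = T_inv (n - 1) (omega n (omega n f))"
  by (rule T_inv_commute_of[of "\<lambda>f. omega n (omega n f)"]) (rule omega_omega_T_op[OF assms])

section \<open>Cherednik operators\<close>

lemma foldr_commute:
  assumes "\<And>k f. k \<in> set xs \<Longrightarrow> g (h k f) = h k (g f)"
  shows "g (foldr h xs f) = foldr h xs (g f)"
  using assms by (induction xs) simp_all

lemma foldr_shift:
  assumes "\<And>k f. m \<le> k \<Longrightarrow> k < n \<Longrightarrow> g (h (Suc k) f) = h k (g f)"
  shows "g (foldr h [Suc m..<Suc n] f) = foldr h [m..<n] (g f)"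
proof -
  have "g (foldr h (map Suc xs) f) = foldr h xs (g f)" if "set xs \<subseteq> {m..<n}" for xs
    using that assms by (induction xs) auto
  then show ?thesis by (simp add: map_Suc_upt[symmetric] del: upt_Suc)
qed

lemma upt_split: "i \<le> j \<Longrightarrow> j \<le> n \<Longrightarrow> [i..<n] = [i..<j] @ [j..<n]" for n :: nat
  by (metis le_iff_add upt_add_eq_append)

lemma Y_op_eq:
  "Y_op n i f = Const (tvar powi (int i - int n)) *
     foldr T_op [i..<n] (omega n (foldr T_inv [1..<i] f))"
  by (simp add: Y_op_def inv_T_op add.commute)

lemma foldr_T_op_Const: "foldr T_op xs (Const c * f) = Const c * foldr T_op xs f"
  by (induction xs) (simp_all add: T_op_Const)

lemma foldr_T_inv_Const: "foldr T_inv xs (Const c * f) = Const c * foldr T_inv xs f"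
  by (induction xs) (simp_all add: T_inv_Const)

lemma foldr_T_op_add: "foldr T_op xs (f + g) = foldr T_op xs f + foldr T_op xs g"
  by (induction xs) (simp_all add: T_op_add)

lemma foldr_T_inv_add: "foldr T_inv xs (f + g) = foldr T_inv xs f + foldr T_inv xs g"
  by (induction xs) (simp_all add: T_inv_add)

lemma Y_op_add: "Y_op n i (f + g) = Y_op n i f + Y_op n i g"
  by (simp add: Y_op_eq foldr_T_inv_add foldr_T_op_add omega_simps distrib_left)

lemma Y_op_Const: "Y_op n i (Const c * f) = Const c * Y_op n i f"
  by (simp only: Y_op_eq foldr_T_inv_Const foldr_T_op_Const omega_simps mult.left_commute)

lemma Y_op_minus: "Y_op n i (- f) = - Y_op n i f"
  using Y_op_Const[of n i "- 1" f] by (simp add: Const_simps)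

lemma Y_op_diff: "Y_op n i (f - g) = Y_op n i f - Y_op n i g"
  using Y_op_add[of n i f "- g"] by (simp add: Y_op_minus)

text \<open>The factor T_i on the right cancels the last inverse in Y_{i+1}, and the one on the left
  lengthens the direct product to that of Y_i. The scalar t comes from the different normalizations
  of Y_i and Y_{i+1}.\<close>

lemma T_Y_T:
  assumes "1 \<le> i" "i < n"
  shows "T_op i (Y_op n (Suc i) (T_op i f)) = Const tvar * Y_op n i f"
proof -
  have "foldr T_inv [1..<Suc i] (T_op i f) = foldr T_inv [1..<i] f"
    using assms by simp
  moreover have "foldr T_op [i..<n] g = T_op i (foldr T_op [Suc i..<n] g)" for g
    using assms by (simp add: upt_conv_Cons)
  moreover have "tvar powi (int (Suc i) - int n) = tvar * tvar powi (int i - int n)"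
    using power_int_add_1[of tvar "int i - int n"] by (simp add: algebra_simps)
  ultimately show ?thesis
    by (simp add: Y_op_eq T_op_Const Const_simps mult_ac del: upt_Suc)
qed

text \<open>T_j commutes with the factors before T_{j-1}, is exchanged for T_{j-1} at the block
  T_{j-1} T_j by the braid relation, and commutes with the rest.\<close>

lemma T_op_foldr_T_op:
  assumes "i < j" "j < n"
  shows "T_op j (foldr T_op [i..<n] f) = foldr T_op [i..<n] (T_op (j - 1) f)"
proof -
  obtain k where j: "j = Suc k" using assms by (cases j) auto
  have split: "[i..<n] = [i..<k] @ [k, Suc k] @ [Suc (Suc k)..<n]"
    using assms unfolding j by (simp add: upt_split[of i k n] upt_conv_Cons[of k] upt_conv_Cons[of "Suc k"])
  have c: "T_op k (foldr T_op [Suc (Suc k)..<n] f) = foldr T_op [Suc (Suc k)..<n] (T_op k f)"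
    by (rule foldr_commute) (simp add: T_op_commute)
  show ?thesis
    unfolding split foldr_append j
    by (subst foldr_commute[of _ "T_op (Suc k)"], (auto simp: T_op_commute)[1])
      (simp add: T_op_braid[symmetric] c)
qed

lemma foldr_T_inv_T_op:
  assumes "1 \<le> j" "j + 1 < i"
  shows "foldr T_inv [1..<i] (T_op j f) = T_op (Suc j) (foldr T_inv [1..<i] f)"
proof -
  have split: "[1..<i] = [1..<j] @ [j, Suc j] @ [Suc (Suc j)..<i]"
    using assms by (simp add: upt_split[of "Suc 0" j i] upt_conv_Cons[of j] upt_conv_Cons[of "Suc j"])
  have c: "T_op j (foldr T_inv [Suc (Suc j)..<i] f) = foldr T_inv [Suc (Suc j)..<i] (T_op j f)"
    by (rule foldr_commute) (simp add: T_op_T_inv_commute)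
  show ?thesis
    unfolding split foldr_append
    by (subst foldr_commute[of _ "T_op (Suc j)"], (auto simp: T_op_T_inv_commute)[1])
      (simp add: c[symmetric] T_inv_T_inv_T_op)
qed

text \<open>For i < j, \<omega> lowers the index of T_j by one and the product T_i ... T_{n-1}
  raises it again. For j + 1 < i the product of inverses raises it and \<omega> lowers it. The two
  remaining generators are governed by \<open>T_Y_T\<close>.\<close>

lemma T_Y_commute:
  assumes "1 \<le> i" "i \<le> n" "1 \<le> j" "j < n" "j \<noteq> i" "j + 1 \<noteq> i"
  shows "T_op j (Y_op n i f) = Y_op n i (T_op j f)"
proof (cases "i < j")
  case True
  have 1: "foldr T_inv [1..<i] (T_op j f) = T_op j (foldr T_inv [1..<i] f)"
    by (rule foldr_commute[symmetric]) (use True in \<open>auto simp: T_op_T_inv_commute\<close>)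
  have "omega n (T_op j g) = T_op (j - 1) (omega n g)" for g
    using omega_T_op[of "j - 1" n g] assms True by simp
  then show ?thesis
    using assms True by (simp only: Y_op_eq T_op_Const 1 T_op_foldr_T_op)
next
  case False
  then have j: "j + 1 < i" using assms by simp
  have "omega n (T_op (Suc j) g) = T_op j (omega n g)" for g
    using omega_T_op[of j n g] assms j by simp
  moreover have "T_op j (foldr T_op [i..<n] g) = foldr T_op [i..<n] (T_op j g)" for g
    by (rule foldr_commute) (use j in \<open>auto simp: T_op_commute\<close>)
  ultimately show ?thesis
    using assms j by (simp only: Y_op_eq T_op_Const foldr_T_inv_T_op)
qed

definition Phi :: "nat \<Rightarrow> zpoly \<Rightarrow> zpoly" where
  "Phi n f = Z n * omega n f"

lemma Phi_Const: "Phi n (Const c * f) = Const c * Phi n f"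
  by (simp add: Phi_def omega_simps mult_ac)

lemma T_op_Z_commute: "j \<noteq> i \<Longrightarrow> j \<noteq> i + 1 \<Longrightarrow> T_op i (Z j * f) = Z j * T_op i f"
  by (rule T_op_mult) (simp add: s_op_Z)

lemma T_inv_Z_commute: "j \<noteq> i \<Longrightarrow> j \<noteq> i + 1 \<Longrightarrow> T_inv i (Z j * f) = Z j * T_inv i f"
  by (rule T_inv_mult) (simp add: s_op_Z)

text \<open>Under \<omega> the variable z_n becomes z_{n-1}, which the last factor T_{n-1} turns
  back into z_n at the price of an inverse. That inverse crosses \<omega>^2 as the inverse of T_1
  and becomes the first of the inverses in Y_{i+1}.\<close>

lemma Y_Phi:
  assumes "1 \<le> i" "i < n"
  shows "Y_op n i (Phi n f) = Phi n (Y_op n (Suc i) f)"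
proof -
  define g where "g = foldr T_inv [Suc 1..<Suc i] f"
  have 1: "foldr T_inv [1..<i] (Z n * h) = Z n * foldr T_inv [1..<i] h" for h
    by (rule foldr_commute[symmetric]) (use assms in \<open>auto simp: T_inv_Z_commute\<close>)
  have 2: "foldr T_inv [1..<i] (omega n f) = omega n g"
    unfolding g_def by (rule foldr_shift[symmetric]) (use assms omega_T_inv in auto)
  have 3: "omega n (Z n) = Z (n - 1)"
    using assms by (simp add: omega_Z)
  have "[i..<n] = [i..<n - 1] @ [n - 1]"
    using upt_split[of i "n - 1" n] upt_conv_Cons[of "n - 1" n] assms by simp
  then have 4: "foldr T_op [i..<n] (Z (n - 1) * h)
      = Const tvar * (Z n * foldr T_op [i..<n - 1] (T_inv (n - 1) h))" for h
  proof -
    have "foldr T_op [i..<n] (Z (n - 1) * h)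
        = foldr T_op [i..<n - 1] (Const tvar * (Z n * T_inv (n - 1) h))"
      using assms T_op_Z_inv[of "n - 1" h] \<open>[i..<n] = _\<close> by simp
    also have "\<dots> = Const tvar * foldr T_op [i..<n - 1] (Z n * T_inv (n - 1) h)"
      by (rule foldr_T_op_Const)
    also have "foldr T_op [i..<n - 1] (Z n * T_inv (n - 1) h) = Z n * foldr T_op [i..<n - 1] (T_inv (n - 1) h)"
      by (rule foldr_commute[symmetric]) (auto simp: T_op_Z_commute)
    finally show ?thesis .
  qed
  have 5: "T_inv (n - 1) (omega n (omega n g)) = omega n (omega n (T_inv 1 g))"
    by (rule omega_omega_T_inv[symmetric]) (use assms in simp)
  have 6: "foldr T_op [i..<n - 1] (omega n h) = omega n (foldr T_op [Suc i..<n] h)" for h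
  proof -
    have "omega n (foldr T_op [Suc i..<Suc (n - 1)] h) = foldr T_op [i..<n - 1] (omega n h)"
      by (rule foldr_shift) (use assms omega_T_op in auto)
    then show ?thesis using assms by simp
  qed
  have 7: "T_inv 1 g = foldr T_inv [1..<Suc i] f"
  proof -
    have "[1..<Suc i] = 1 # [Suc 1..<Suc i]"
      using assms by (intro upt_conv_Cons) simp
    then show ?thesis by (simp add: g_def del: upt_Suc)
  qed
  have "tvar powi (int (Suc i) - int n) = tvar * tvar powi (int i - int n)"
    using power_int_add_1[of tvar "int i - int n"] by (simp add: algebra_simps)
  then show ?thesis
    by (simp only: Y_op_eq Phi_def 1 2 3 4 5 6 7 omega_simps Const_simps mult_ac)
qed

lemma foldr_T_inv_Z:
  assumes "1 \<le> i"
  shows "foldr T_inv [1..<i] (Z i * f) = Const (tvar powi (1 - int i)) * (Z 1 * foldr T_op [1..<i] f)"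
  using assms
proof (induction i arbitrary: f rule: dec_induct)
  case base
  then show ?case by (simp add: Const_simps)
next
  case (step i)
  have "foldr T_inv [1..<Suc i] (Z (Suc i) * f)
      = Const (inverse tvar) * foldr T_inv [1..<i] (Z i * T_op i f)"
    using step.hyps T_inv_Z_Suc[of i f] by (simp add: foldr_T_inv_Const)
  also have "\<dots> = Const (tvar powi (1 - int (Suc i))) * (Z 1 * foldr T_op [1..<Suc i] f)"
  proof -
    have "tvar powi (1 - int (Suc i)) = inverse tvar * tvar powi (1 - int i)"
      using power_int_diff[of tvar "1 - int i" 1] by (simp add: field_simps)
    moreover have "foldr T_op [1..<Suc i] f = foldr T_op [1..<i] (T_op i f)"
      using step.hyps by simp
    ultimately show ?thesis
      by (simp only: step.IH Const_simps mult.assoc)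
  qed
  finally show ?case .
qed

text \<open>The inverses in Y_n carry z_n down to z_1 and turn into the direct product of Y_1; the
  factor q then comes from \<omega> z_1 = q z_n.\<close>

lemma Y_n_Phi:
  assumes "1 \<le> n"
  shows "Y_op n n (Phi n f) = Const qvar * Phi n (Y_op n 1 f)"
proof -
  have "omega n (Z 1) = Const qvar * Z n"
    using assms by (simp add: omega_Z)
  then show ?thesis
    unfolding Y_op_eq Phi_def foldr_T_inv_Z[OF assms] omega_simps
    by (simp add: omega_simps Const_simps(2) mult.left_commute)
qed

section \<open>Multiplication by e_n, and \<omega> expressed through Y_1\<close>

definition e_top :: "nat \<Rightarrow> zpoly" where
  "e_top n = (\<Prod>j=1..n. Z j)"

lemma s_op_prod:
  assumes "i \<in> A \<longleftrightarrow> i + 1 \<in> A" "finite A"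
  shows "s_op i (\<Prod>j\<in>A. Z j) = (\<Prod>j\<in>A. Z j)"
proof -
  let ?\<tau> = "\<lambda>j. if j = i then i + 1 else if j = i + 1 then i else j"
  have "s_op i (\<Prod>j\<in>A. Z j) = (\<Prod>j\<in>A. Z (?\<tau> j))"
    unfolding ring_hom_prod[OF alg_hom_ring_hom[OF alg_hom_s_op]]
    by (rule prod.cong) (auto simp: s_op_Z)
  also have "\<dots> = (\<Prod>j\<in>A. Z j)"
    by (rule prod.reindex_bij_witness[of _ ?\<tau> ?\<tau>]) (use assms in auto)
  finally show ?thesis .
qed

lemma s_op_e_top: "1 \<le> i \<Longrightarrow> i < n \<Longrightarrow> s_op i (e_top n) = e_top n"
  unfolding e_top_def by (rule s_op_prod) auto

lemma omega_e_top:
  assumes "1 \<le> n"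
  shows "omega n (e_top n) = Const qvar * e_top n"
proof -
  have split: "{1..n} = insert 1 {2..n}" using assms by auto
  have "omega n (e_top n) = Const qvar * Z n * (\<Prod>j=2..n. Z (j - 1))"
    unfolding e_top_def split ring_hom_prod[OF alg_hom_ring_hom[OF alg_hom_omega]]
    using assms by (simp add: omega_Z)
  also have "(\<Prod>j=2..n. Z (j - 1)) = (\<Prod>j=1..<n. Z j)"
    by (rule prod.reindex_bij_witness[of _ "\<lambda>j. j + 1" "\<lambda>j. j - 1"]) auto
  also have "Const qvar * Z n * (\<Prod>j=1..<n. Z j) = Const qvar * e_top n"
    using assms by (simp add: e_top_def prod.last_plus atLeastLessThanSuc_atLeastAtMost mult_ac)
  finally show ?thesis .
qed

lemma Y_e_top:
  assumes "1 \<le> i" "i \<le> n"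
  shows "Y_op n i (e_top n * f) = Const qvar * (e_top n * Y_op n i f)"
proof -
  have "foldr T_inv [1..<i] (e_top n * f) = e_top n * foldr T_inv [1..<i] f" for f
    by (rule foldr_commute[symmetric]) (use assms in \<open>auto simp: T_inv_mult s_op_e_top\<close>)
  moreover have "foldr T_op [i..<n] (e_top n * f) = e_top n * foldr T_op [i..<n] f" for f
    by (rule foldr_commute[symmetric]) (use assms in \<open>auto simp: T_op_mult s_op_e_top\<close>)
  ultimately show ?thesis
    using assms by (simp add: Y_op_eq omega_simps omega_e_top foldr_T_op_Const mult.assoc mult.left_commute)
qed

text \<open>On an eigenfunction of Y_1 this replaces \<omega> by a scalar times a product of inverse
  generators.\<close>

lemma omega_eq_Y_1:
  assumes "1 \<le> n"
  shows "omega n f = Const (tvar ^ (n - 1)) * foldr T_inv (rev [1..<n]) (Y_op n 1 f)"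
proof -
  have "foldr T_inv (rev xs) (foldr T_op xs g) = g" for xs g
    by (induction xs arbitrary: g) simp_all
  then have "foldr T_inv (rev [1..<n]) (Y_op n 1 f) = Const (tvar powi (1 - int n)) * omega n f"
    by (simp add: Y_op_eq foldr_T_inv_Const)
  moreover have "tvar ^ (n - 1) * tvar powi (1 - int n) = 1"
    using assms power_int_add[of tvar "int (n - 1)" "1 - int n"] by (simp add: of_nat_diff del: power_int_of_nat flip: power_int_of_nat)
  then have "Const (tvar ^ (n - 1)) * (Const (tvar powi (1 - int n)) * omega n f) = omega n f"
    by (simp add: Const_simps(2) flip: mult.assoc Const_simps(4))
  ultimately show ?thesis by simp
qed

section \<open>Compositions and their spectral vectors\<close>

declare One_nat_def [simp del]

definition swp :: "nat \<Rightarrow> (nat \<Rightarrow> 'a) \<Rightarrow> nat \<Rightarrow> 'a" where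
  "swp i v = v(i := v (Suc i), Suc i := v i)"

lemma swp_simps [simp]: "swp i v i = v (Suc i)" "swp i v (Suc i) = v i"
  "j \<noteq> i \<Longrightarrow> j \<noteq> Suc i \<Longrightarrow> swp i v j = v j" "swp i (swp i v) = v"
  by (auto simp: swp_def fun_eq_iff)

definition phi :: "nat \<Rightarrow> (nat \<Rightarrow> nat) \<Rightarrow> nat \<Rightarrow> nat" where
  "phi n \<eta> j = (if j = n then \<eta> 1 + 1 else \<eta> (j + 1))"

text \<open>A strict total order of the positions in which \<open>leg'\<close> is the rank. Hence
  the powers of t in a spectral vector are pairwise distinct.\<close>

definition ranks_before :: "(nat \<Rightarrow> nat) \<Rightarrow> nat \<Rightarrow> nat \<Rightarrow> bool" where
  "ranks_before \<eta> j i \<longleftrightarrow> \<eta> i < \<eta> j \<or> \<eta> i = \<eta> j \<and> j < i"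

lemma leg'_eq_card: "leg' n \<eta> i = card {j\<in>{1..n}. ranks_before \<eta> j i}"
proof -
  have "{j\<in>{1..n}. ranks_before \<eta> j i}
      = {j\<in>{1..n}. j < i \<and> \<eta> j \<ge> \<eta> i} \<union> {j\<in>{1..n}. j > i \<and> \<eta> j > \<eta> i}"
  proof -
    have "ranks_before \<eta> j i \<longleftrightarrow> j < i \<and> \<eta> j \<ge> \<eta> i \<or> j > i \<and> \<eta> j > \<eta> i" for j
      by (cases j i rule: linorder_cases) (auto simp: ranks_before_def)
    then show ?thesis by auto
  qed
  moreover have "card ({j\<in>{1..n}. j < i \<and> \<eta> j \<ge> \<eta> i} \<union> {j\<in>{1..n}. j > i \<and> \<eta> j > \<eta> i}) = leg' n \<eta> i"
    unfolding leg'_def by (rule card_Un_disjoint) auto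
  ultimately show ?thesis by simp
qed

lemma leg'_less:
  assumes "ranks_before \<eta> j k" "j \<in> {1..n}"
  shows "leg' n \<eta> j < leg' n \<eta> k"
proof -
  let ?A = "{l\<in>{1..n}. ranks_before \<eta> l j}"
  have "insert j ?A \<subseteq> {l\<in>{1..n}. ranks_before \<eta> l k}"
    using assms unfolding ranks_before_def by force
  then have "card (insert j ?A) \<le> leg' n \<eta> k"
    unfolding leg'_eq_card by (rule card_mono[rotated]) simp
  moreover have "j \<notin> ?A" by (simp add: ranks_before_def)
  ultimately show ?thesis by (simp add: leg'_eq_card)
qed

lemma leg'_bij:
  assumes "bij_betw \<pi> {1..n} {1..n}" "i \<in> {1..n}"
    and "\<And>j. j \<in> {1..n} \<Longrightarrow> ranks_before \<eta> j i \<longleftrightarrow> ranks_before \<eta>' (\<pi> j) (\<pi> i)"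
  shows "leg' n \<eta>' (\<pi> i) = leg' n \<eta> i"
proof -
  have "{j\<in>{1..n}. ranks_before \<eta>' j (\<pi> i)} = \<pi> ` {j\<in>{1..n}. ranks_before \<eta> j i}"
  proof (rule set_eqI)
    fix y
    show "y \<in> {j\<in>{1..n}. ranks_before \<eta>' j (\<pi> i)} \<longleftrightarrow> y \<in> \<pi> ` {j\<in>{1..n}. ranks_before \<eta> j i}"
    proof
      assume y: "y \<in> {j\<in>{1..n}. ranks_before \<eta>' j (\<pi> i)}"
      then have "y \<in> \<pi> ` {1..n}" using assms(1) by (simp add: bij_betw_def)
      then obtain x where "x \<in> {1..n}" "y = \<pi> x" by blast
      then show "y \<in> \<pi> ` {j\<in>{1..n}. ranks_before \<eta> j i}"
        using assms(3)[of x] y by blast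
    next
      assume "y \<in> \<pi> ` {j\<in>{1..n}. ranks_before \<eta> j i}"
      then show "y \<in> {j\<in>{1..n}. ranks_before \<eta>' j (\<pi> i)}"
        using assms(3) bij_betwE[OF assms(1)] by blast
    qed
  qed
  moreover have "inj_on \<pi> {j\<in>{1..n}. ranks_before \<eta> j i}"
    using assms(1) by (auto simp: bij_betw_def intro: inj_on_subset)
  ultimately show ?thesis
    by (simp add: leg'_eq_card card_image)
qed

lemma leg'_cong: "(\<And>j. j \<in> {1..n} \<Longrightarrow> \<eta> j = \<eta>' j) \<Longrightarrow> i \<in> {1..n} \<Longrightarrow> leg' n \<eta> i = leg' n \<eta>' i"
  unfolding leg'_eq_card by (rule arg_cong[of _ _ card]) (auto simp: ranks_before_def)

lemma eta_bar_cong: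
  assumes "\<And>j. j \<in> {1..n} \<Longrightarrow> \<eta> j = \<eta>' j" "i \<in> {1..n}"
  shows "eta_bar n \<eta> i = eta_bar n \<eta>' i"
proof -
  have "leg' n \<eta> i = leg' n \<eta>' i" by (rule leg'_cong) (use assms in auto)
  then show ?thesis using assms by (simp add: eta_bar_def)
qed

lemma leg'_swp:
  assumes "1 \<le> i" "i < n" "\<eta> i \<noteq> \<eta> (Suc i)" "j \<in> {1..n}"
  shows "leg' n (swp i \<eta>) j = swp i (leg' n \<eta>) j"
proof -
  define \<tau> where "\<tau> j = (if j = i then Suc i else if j = Suc i then i else j)" for j
  have \<tau>: "\<tau> (\<tau> j) = j" for j by (simp add: \<tau>_def)
  have "bij_betw \<tau> {1..n} {1..n}"
    by (rule bij_betw_byWitness[of _ \<tau>]) (use assms in \<open>auto simp: \<tau>_def\<close>)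
  then have "leg' n (swp i \<eta>) (\<tau> k) = leg' n \<eta> k" if "k \<in> {1..n}" for k
    using that by (rule leg'_bij) (use assms in \<open>auto simp: \<tau>_def ranks_before_def swp_def\<close>)
  from this[of "\<tau> j"] show ?thesis
    using assms by (auto simp: \<tau> \<tau>_def swp_def split: if_splits)
qed

lemma eta_bar_swp:
  assumes "1 \<le> i" "i < n" "\<eta> i \<noteq> \<eta> (Suc i)" "j \<in> {1..n}"
  shows "eta_bar n (swp i \<eta>) j = swp i (eta_bar n \<eta>) j"
  using leg'_swp[OF assms] by (auto simp: eta_bar_def swp_def)

text \<open>The moved part grows by one and goes to the end. A part that exceeded it by one now ties
  with it and still precedes it by position, so no comparison changes.\<close>

lemma leg'_phi:
  assumes "j \<in> {1..n}"
  shows "leg' n (phi n \<eta>) j = (if j = n then leg' n \<eta> 1 else leg' n \<eta> (j + 1))"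
proof -
  define \<tau> where "\<tau> j = (if j = 1 then n else j - 1)" for j
  have "bij_betw \<tau> {1..n} {1..n}"
    by (rule bij_betw_byWitness[of _ "\<lambda>j. if j = n then 1 else j + 1"]) (auto simp: \<tau>_def)
  then have "leg' n (phi n \<eta>) (\<tau> k) = leg' n \<eta> k" if "k \<in> {1..n}" for k
    using that by (rule leg'_bij) (use that in \<open>auto simp: \<tau>_def ranks_before_def phi_def\<close>)
  from this[of "if j = n then 1 else j + 1"] show ?thesis
    using assms by (auto simp: \<tau>_def split: if_splits)
qed

lemma eta_bar_phi:
  assumes "j \<in> {1..n}"
  shows "eta_bar n (phi n \<eta>) j = (if j = n then qvar * eta_bar n \<eta> 1 else eta_bar n \<eta> (j + 1))"
  using leg'_phi[OF assms] by (simp add: eta_bar_def phi_def power_add mult.commute)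

lemma eta_bar_eq_powi: "eta_bar n \<eta> i = qvar powi (int (\<eta> i)) * tvar powi (- int (leg' n \<eta> i))"
  by (simp add: eta_bar_def)

lemma eta_bar_nz [simp]: "eta_bar n \<eta> i \<noteq> 0"
  by (simp add: eta_bar_def)

lemma eta_bar_eq_iff:
  "eta_bar n \<eta> i = eta_bar n \<nu> j \<longleftrightarrow> \<eta> i = \<nu> j \<and> leg' n \<eta> i = leg' n \<nu> j"
  by (simp only: eta_bar_eq_powi qvar_tvar_powi_eq_iff) simp

lemma eta_bar_inj:
  assumes "j \<in> {1..n}" "k \<in> {1..n}" "j \<noteq> k"
  shows "eta_bar n \<eta> j \<noteq> eta_bar n \<eta> k"
proof -
  have "ranks_before \<eta> j k \<or> ranks_before \<eta> k j"
    using assms by (auto simp: ranks_before_def)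
  then show ?thesis
    using leg'_less[of \<eta> j k n] leg'_less[of \<eta> k j n] assms by (auto simp: eta_bar_eq_iff)
qed

lemma leg'_equal_parts:
  assumes "1 \<le> i" "i < n" "\<eta> i = \<eta> (Suc i)"
  shows "leg' n \<eta> (Suc i) = Suc (leg' n \<eta> i)"
proof -
  have "{j\<in>{1..n}. ranks_before \<eta> j (Suc i)} = insert i {j\<in>{1..n}. ranks_before \<eta> j i}"
    using assms by (auto simp: ranks_before_def)
  then show ?thesis
    by (simp add: leg'_eq_card ranks_before_def)
qed

text \<open>Equal neighbours have consecutive ranks. The ratio t obtained here later rules out the
  spectral vector with the two entries exchanged.\<close>

lemma eta_bar_equal_parts:
  assumes "1 \<le> i" "i < n" "\<eta> i = \<eta> (Suc i)"
  shows "eta_bar n \<eta> i = tvar * eta_bar n \<eta> (Suc i)"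
proof -
  have "tvar powi (- int (leg' n \<eta> i)) = tvar * tvar powi (- int (Suc (leg' n \<eta> i)))"
    using power_int_add_1[of tvar "- int (Suc (leg' n \<eta> i))"] by (simp add: mult.commute)
  then show ?thesis
    unfolding eta_bar_def leg'_equal_parts[OF assms] assms(3)
    by (simp only: mult.left_commute)
qed

section \<open>An order on compositions\<close>

text \<open>
  Extend \<open>\<eta>\<close> to all positions by \<open>\<eta>\<^bsub>j+n\<^esub> = \<eta>\<^sub>j + 1\<close>. Then \<open>hgt n \<eta> p k\<close> is the number of cells in columns
  beyond \<open>k\<close> of the window of the \<open>n\<close> rows \<open>p + 1, \<dots>, p + n\<close>. Unlike \<open>\<prec>\<close>, the resulting order is preserved by
  the raising operator \<open>phi\<close>, which just moves the window.
\<close>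

definition hgt :: "nat \<Rightarrow> (nat \<Rightarrow> nat) \<Rightarrow> nat \<Rightarrow> nat \<Rightarrow> nat" where
  "hgt n \<eta> p k = (\<Sum>j=1..n. (if j \<le> p then \<eta> j + 1 else \<eta> j) - k)"

definition comp_le :: "nat \<Rightarrow> (nat \<Rightarrow> nat) \<Rightarrow> (nat \<Rightarrow> nat) \<Rightarrow> bool" where
  "comp_le n \<nu> \<eta> \<longleftrightarrow> (\<Sum>j=1..n. \<nu> j) = (\<Sum>j=1..n. \<eta> j) \<and> (\<forall>p\<le>n. \<forall>k. hgt n \<nu> p k \<le> hgt n \<eta> p k)"

lemma comp_le_refl [simp]: "comp_le n \<eta> \<eta>"
  by (simp add: comp_le_def)

lemma comp_le_trans: "comp_le n \<kappa> \<nu> \<Longrightarrow> comp_le n \<nu> \<eta> \<Longrightarrow> comp_le n \<kappa> \<eta>"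
  unfolding comp_le_def by (metis order_trans)

lemma hgt_cong: "(\<And>j. j \<in> {1..n} \<Longrightarrow> \<eta> j = \<eta>' j) \<Longrightarrow> hgt n \<eta> p k = hgt n \<eta>' p k"
  unfolding hgt_def by (rule sum.cong) auto

lemma comp_le_cong:
  assumes "\<And>j. j \<in> {1..n} \<Longrightarrow> \<nu> j = \<nu>' j" "\<And>j. j \<in> {1..n} \<Longrightarrow> \<eta> j = \<eta>' j"
  shows "comp_le n \<nu> \<eta> \<longleftrightarrow> comp_le n \<nu>' \<eta>'"
proof -
  have "hgt n \<nu> p k = hgt n \<nu>' p k" "hgt n \<eta> p k = hgt n \<eta>' p k" for p k
    by (rule hgt_cong, rule assms, assumption)+
  moreover have "(\<Sum>j=1..n. \<nu> j) = (\<Sum>j=1..n. \<nu>' j)" "(\<Sum>j=1..n. \<eta> j) = (\<Sum>j=1..n. \<eta>' j)"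
    by (rule sum.cong[OF refl], rule assms, assumption)+
  ultimately show ?thesis by (simp add: comp_le_def)
qed

text \<open>One step of the window tests whether \<eta>_{p+1} reaches k, so the heights for all p
  and k determine \<eta>.\<close>

lemma hgt_Suc:
  assumes "p < n"
  shows "hgt n \<eta> (Suc p) k = hgt n \<eta> p k + (if k \<le> \<eta> (Suc p) then 1 else 0)"
proof -
  have "Suc p \<in> {1..n}" using assms by auto
  moreover have "(\<Sum>j\<in>{1..n} - {Suc p}. (if j \<le> Suc p then \<eta> j + 1 else \<eta> j) - k)
      = (\<Sum>j\<in>{1..n} - {Suc p}. (if j \<le> p then \<eta> j + 1 else \<eta> j) - k)"
    by (rule sum.cong) auto
  ultimately show ?thesis
    unfolding hgt_def sum.remove[OF finite_atLeastAtMost \<open>Suc p \<in> {1..n}\<close>] by (simp add: Suc_diff_le)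
qed

lemma sum_two_positions:
  fixes g :: "nat \<Rightarrow> 'a::comm_monoid_add"
  assumes "1 \<le> i" "i < n"
  shows "(\<Sum>j=1..n. g j) = (\<Sum>j\<in>{1..n} - {i, Suc i}. g j) + (g i + g (Suc i))"
proof -
  define B where "B = {1..n} - {i, Suc i}"
  have "{1..n} = insert i (insert (Suc i) B)" using assms by (auto simp: B_def)
  then have "(\<Sum>j=1..n. g j) = (\<Sum>j\<in>insert i (insert (Suc i) B). g j)" by (rule arg_cong)
  also have "\<dots> = (\<Sum>j\<in>B. g j) + (g i + g (Suc i))"
    by (simp add: B_def add_ac)
  finally show ?thesis by (simp only: B_def)
qed

lemma sum_swp:
  assumes "1 \<le> i" "i < n"
  shows "(\<Sum>j=1..n. swp i \<eta> j) = (\<Sum>j=1..n. \<eta> j :: nat)"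
proof -
  have "(\<Sum>j\<in>{1..n} - {i, Suc i}. swp i \<eta> j) = (\<Sum>j\<in>{1..n} - {i, Suc i}. \<eta> j)"
    by (rule sum.cong) auto
  then show ?thesis by (simp add: sum_two_positions[OF assms])
qed

text \<open>A range that contains the exponents of T_i z^\<nu>: two entries keep their sum and do
  not move further apart.\<close>

definition between :: "nat \<Rightarrow> (nat \<Rightarrow> nat) \<Rightarrow> (nat \<Rightarrow> nat) \<Rightarrow> bool" where
  "between i \<kappa> \<nu> \<longleftrightarrow> (\<forall>j. j \<noteq> i \<and> j \<noteq> Suc i \<longrightarrow> \<kappa> j = \<nu> j) \<and>
     \<kappa> i + \<kappa> (Suc i) = \<nu> i + \<nu> (Suc i) \<and>
     min (\<nu> i) (\<nu> (Suc i)) \<le> \<kappa> i \<and> \<kappa> i \<le> max (\<nu> i) (\<nu> (Suc i))"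

lemma between_refl: "between i \<nu> \<nu>"
  by (auto simp: between_def)

text \<open>Truncated subtraction of k is convex, so bringing two entries closer cannot increase the
  sum, provided both are raised or neither is. This fails for p = i, where the edge of the window
  separates them.\<close>

lemma hgt_between:
  assumes "1 \<le> i" "i < n" "p \<noteq> i" and b: "between i \<kappa> \<nu>"
  shows "hgt n \<kappa> p k \<le> hgt n \<nu> p k"
proof -
  have "(\<Sum>j\<in>{1..n} - {i, Suc i}. (if j \<le> p then \<kappa> j + 1 else \<kappa> j) - k)
      = (\<Sum>j\<in>{1..n} - {i, Suc i}. (if j \<le> p then \<nu> j + 1 else \<nu> j) - k)"
    by (rule sum.cong) (use b in \<open>auto simp: between_def\<close>)
  moreover have "(\<kappa> i + c - k) + (\<kappa> (Suc i) + c - k) \<le> (\<nu> i + c - k) + (\<nu> (Suc i) + c - k)" for c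
    using b unfolding between_def min_def max_def by (auto split: if_splits)
  from this[of "if i \<le> p then 1 else 0"]
  have "((if i \<le> p then \<kappa> i + 1 else \<kappa> i) - k) + ((if Suc i \<le> p then \<kappa> (Suc i) + 1 else \<kappa> (Suc i)) - k)
      \<le> ((if i \<le> p then \<nu> i + 1 else \<nu> i) - k) + ((if Suc i \<le> p then \<nu> (Suc i) + 1 else \<nu> (Suc i)) - k)"
    using assms(3) by (auto split: if_splits)
  ultimately show ?thesis
    unfolding hgt_def sum_two_positions[OF assms(1,2)] by simp
qed

lemma hgt_swp:
  assumes "1 \<le> i" "i < n" "p \<noteq> i"
  shows "hgt n (swp i \<eta>) p k = hgt n \<eta> p k"
proof (rule antisym)
  have 1: "between i (swp i \<eta>) \<eta>" and 2: "between i \<eta> (swp i \<eta>)"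
    by (auto simp: between_def)
  show "hgt n (swp i \<eta>) p k \<le> hgt n \<eta> p k" "hgt n \<eta> p k \<le> hgt n (swp i \<eta>) p k"
    using hgt_between[OF assms] 1 2 by blast+
qed

lemma comp_le_swp:
  assumes i: "1 \<le> i" "i < n" and le: "comp_le n \<nu> \<eta>" and lt: "\<eta> i < \<eta> (Suc i)" and b: "between i \<kappa> \<nu>"
  shows "comp_le n \<kappa> (swp i \<eta>)"
proof -
  have "(\<Sum>j\<in>{1..n} - {i, Suc i}. \<kappa> j) = (\<Sum>j\<in>{1..n} - {i, Suc i}. \<nu> j)"
    by (rule sum.cong) (use b in \<open>auto simp: between_def\<close>)
  then have "(\<Sum>j=1..n. \<kappa> j) = (\<Sum>j=1..n. \<nu> j)"
    using b by (simp add: sum_two_positions[OF i] between_def)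
  then have sum: "(\<Sum>j=1..n. \<kappa> j) = (\<Sum>j=1..n. swp i \<eta> j)"
    using le sum_swp[OF i, of \<eta>] by (simp add: comp_le_def)
  have ne: "hgt n \<kappa> p k \<le> hgt n (swp i \<eta>) p k" if "p \<noteq> i" "p \<le> n" for p k
    using hgt_between[OF i that(1) b] hgt_swp[OF i that(1), of \<eta>] le that
    unfolding comp_le_def by (metis order_trans)
  \<comment> \<open>The window p = i separates the two entries. It is reached from p = i - 1 when
    the larger entry, now in front, makes a jump at k, and from p = i + 1 otherwise.\<close>
  have "hgt n \<kappa> i k \<le> hgt n (swp i \<eta>) i k" for k
  proof (cases "k \<le> \<eta> (Suc i)")
    case True
    obtain j where j: "i = Suc j" using i by (cases i) auto
    have "hgt n \<kappa> i k \<le> hgt n \<kappa> j k + 1"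
      using hgt_Suc[of j n \<kappa> k] i j by simp
    also have "\<dots> \<le> hgt n (swp i \<eta>) j k + 1"
      using ne[of j k] i j by simp
    also have "\<dots> = hgt n (swp i \<eta>) i k"
      using hgt_Suc[of j n "swp i \<eta>" k] i j True by simp
    finally show ?thesis .
  next
    case False
    have "hgt n \<kappa> i k \<le> hgt n \<kappa> (Suc i) k"
      using hgt_Suc[of i n \<kappa> k] i by simp
    also have "\<dots> \<le> hgt n (swp i \<eta>) (Suc i) k"
      using ne[of "Suc i" k] i by simp
    also have "\<dots> = hgt n (swp i \<eta>) i k"
      using hgt_Suc[of i n "swp i \<eta>" k] i False lt by simp
    finally show ?thesis .
  qed
  then show ?thesis
    using sum ne unfolding comp_le_def by metis
qed

text \<open>Ensures that the leading coefficient of T_i E comes from the leading monomial alone. The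
  window p = i excludes \<mu>_i \<ge> \<mu>_{i+1}, after which p = 0 bounds the larger
  entry.\<close>

lemma comp_le_extreme:
  assumes i: "1 \<le> i" "i < n" and le: "comp_le n \<mu> \<kappa>" and lt: "\<kappa> i < \<kappa> (Suc i)"
    and b: "between i (swp i \<kappa>) \<mu>"
  shows "\<mu> i = \<kappa> i \<and> \<mu> (Suc i) = \<kappa> (Suc i)"
proof -
  have sum: "\<mu> i + \<mu> (Suc i) = \<kappa> i + \<kappa> (Suc i)" and max: "\<kappa> (Suc i) \<le> max (\<mu> i) (\<mu> (Suc i))"
    and off: "\<And>j. j \<noteq> i \<Longrightarrow> j \<noteq> Suc i \<Longrightarrow> \<kappa> j = \<mu> j"
    using b by (auto simp: between_def)
  have cmp: "((if i \<le> p then \<mu> i + 1 else \<mu> i) - k) + ((if Suc i \<le> p then \<mu> (Suc i) + 1 else \<mu> (Suc i)) - k)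
      \<le> ((if i \<le> p then \<kappa> i + 1 else \<kappa> i) - k) + ((if Suc i \<le> p then \<kappa> (Suc i) + 1 else \<kappa> (Suc i)) - k)"
    if "p \<le> n" for p k
  proof -
    have "(\<Sum>j\<in>{1..n} - {i, Suc i}. (if j \<le> p then \<mu> j + 1 else \<mu> j) - k)
      = (\<Sum>j\<in>{1..n} - {i, Suc i}. (if j \<le> p then \<kappa> j + 1 else \<kappa> j) - k)"
      by (rule sum.cong) (use off in auto)
    moreover have "hgt n \<mu> p k \<le> hgt n \<kappa> p k"
      using le that by (simp add: comp_le_def)
    ultimately show ?thesis
      unfolding hgt_def sum_two_positions[OF i] by simp
  qed
  have "\<mu> i < \<mu> (Suc i)"
  proof (rule ccontr)
    assume "\<not> \<mu> i < \<mu> (Suc i)"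
    then show False using cmp[of i "\<mu> i"] sum max lt i by auto
  qed
  then show ?thesis
    using cmp[of 0 "\<kappa> (Suc i)"] sum max lt i by auto
qed

lemma hgt_phi:
  assumes "p < n"
  shows "hgt n (phi n \<eta>) p k = hgt n \<eta> (Suc p) k"
proof -
  have "hgt n (phi n \<eta>) p k = (\<Sum>j=1..<n. (if j \<le> p then \<eta> (j + 1) + 1 else \<eta> (j + 1)) - k) + (\<eta> 1 + 1 - k)"
  proof -
    have "{1..n} = insert n {1..<n}" using assms by auto
    moreover have "(\<Sum>j=1..<n. (if j \<le> p then phi n \<eta> j + 1 else phi n \<eta> j) - k)
        = (\<Sum>j=1..<n. (if j \<le> p then \<eta> (j + 1) + 1 else \<eta> (j + 1)) - k)"
      by (rule sum.cong) (auto simp: phi_def)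
    ultimately show ?thesis
      using assms unfolding hgt_def by (simp add: phi_def add.commute)
  qed
  also have "(\<Sum>j=1..<n. (if j \<le> p then \<eta> (j + 1) + 1 else \<eta> (j + 1)) - k)
      = (\<Sum>j=2..n. (if j \<le> Suc p then \<eta> j + 1 else \<eta> j) - k)"
    by (rule sum.reindex_bij_witness[of _ "\<lambda>j. j - 1" "\<lambda>j. j + 1"]) auto
  also have "\<dots> + (\<eta> 1 + 1 - k) = hgt n \<eta> (Suc p) k"
  proof -
    have "{1..n} = insert 1 {2..n}" using assms by auto
    then show ?thesis
      using assms unfolding hgt_def by (simp add: add.commute)
  qed
  finally show ?thesis .
qed

lemma sum_phi:
  assumes "1 \<le> n"
  shows "(\<Sum>j=1..n. phi n \<eta> j) = Suc (\<Sum>j=1..n. \<eta> j)"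
proof -
  have "(\<Sum>j=1..n. phi n \<eta> j) = (\<Sum>j=1..<n. \<eta> (j + 1)) + (\<eta> 1 + 1)"
  proof -
    have "{1..n} = insert n {1..<n}" using assms by auto
    then show ?thesis by (simp add: phi_def add.commute)
  qed
  also have "(\<Sum>j=1..<n. \<eta> (j + 1)) = (\<Sum>j=2..n. \<eta> j)"
    by (rule sum.reindex_bij_witness[of _ "\<lambda>j. j - 1" "\<lambda>j. j + 1"]) auto
  also have "\<dots> + (\<eta> 1 + 1) = Suc (\<Sum>j=1..n. \<eta> j)"
  proof -
    have "{1..n} = insert 1 {2..n}" using assms by auto
    then show ?thesis by simp
  qed
  finally show ?thesis .
qed

lemma comp_le_phi:
  assumes "1 \<le> n" and le: "comp_le n \<nu> \<eta>"
  shows "comp_le n (phi n \<nu>) (phi n \<eta>)"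
proof -
  have lt: "hgt n (phi n \<nu>) p k \<le> hgt n (phi n \<eta>) p k" if "p < n" for p k
    using le that by (simp add: hgt_phi comp_le_def)
  have last: "hgt n (phi n \<eta>) n k = hgt n \<eta> n k + (if k \<le> \<eta> 1 + 1 then 1 else 0)" for \<eta> k
  proof -
    have "hgt n (phi n \<eta>) (Suc (n - 1)) k
        = hgt n (phi n \<eta>) (n - 1) k + (if k \<le> phi n \<eta> (Suc (n - 1)) then 1 else 0)"
      using assms by (intro hgt_Suc) simp
    then show ?thesis using assms by (simp add: hgt_phi) (simp add: phi_def)
  qed
  \<comment> \<open>At p = n every row is one cell longer than at p = 0, so the threshold k = l + 1
    there amounts to the threshold l at p = 0. This closes the cycle of windows.\<close>
  have "hgt n (phi n \<nu>) n k \<le> hgt n (phi n \<eta>) n k" for k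
  proof (cases k)
    case 0
    then show ?thesis using le by (simp add: last comp_le_def)
  next
    case (Suc l)
    have "hgt n (phi n \<eta>) n k = hgt n \<eta> 1 l" for \<eta>
    proof -
      have "hgt n \<eta> n k = hgt n \<eta> 0 l"
        unfolding hgt_def Suc by (rule sum.cong) auto
      then show ?thesis
        using hgt_Suc[of 0 n \<eta> l] assms by (simp add: last Suc One_nat_def)
    qed
    then show ?thesis using le assms by (simp add: comp_le_def)
  qed
  moreover have "(\<Sum>j=1..n. phi n \<nu> j) = (\<Sum>j=1..n. phi n \<eta> j)"
    using le assms by (simp add: sum_phi comp_le_def)
  ultimately show ?thesis
    using lt unfolding comp_le_def by (metis le_neq_implies_less)
qed

text \<open>A numerical measure for \<open>comp_le\<close>, strictly monotone once d bounds the
  degree, since thresholds up to d then determine the parts.\<close>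

definition comp_rank :: "nat \<Rightarrow> nat \<Rightarrow> (nat \<Rightarrow> nat) \<Rightarrow> nat" where
  "comp_rank n d \<eta> = (\<Sum>p\<le>n. \<Sum>k\<le>d. hgt n \<eta> p k)"

text \<open>The hypothesis on the ranks forces every single height to agree, and the jumps between
  consecutive windows recover the parts. It is antisymmetry of \<open>comp_le\<close> in a form that
  also drives inductions.\<close>

lemma comp_le_rank:
  assumes le: "comp_le n \<nu> \<eta>" and d: "(\<Sum>j=1..n. \<eta> j) \<le> d" and rank: "comp_rank n d \<eta> \<le> comp_rank n d \<nu>"
    and j: "j \<in> {1..n}"
  shows "\<nu> j = \<eta> j"
proof -
  have sub: "(\<Sum>k\<le>d. hgt n \<nu> p k) \<le> (\<Sum>k\<le>d. hgt n \<eta> p k)" if "p \<le> n" for p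
    using le that by (intro sum_mono) (simp add: comp_le_def)
  have eq: "hgt n \<nu> p k = hgt n \<eta> p k" if "p \<le> n" "k \<le> d" for p k
  proof (rule ccontr)
    assume "hgt n \<nu> p k \<noteq> hgt n \<eta> p k"
    then have "(\<Sum>k\<le>d. hgt n \<nu> p k) < (\<Sum>k\<le>d. hgt n \<eta> p k)"
      using le that by (intro sum_strict_mono_ex1 ballI bexI[of _ k]) (auto simp: comp_le_def le_neq_implies_less)
    then have "comp_rank n d \<nu> < comp_rank n d \<eta>"
      unfolding comp_rank_def using sub that by - (rule sum_strict_mono_ex1, auto)
    then show False using rank by simp
  qed
  obtain p where p: "j = Suc p" "p < n" using j by (cases j) auto
  have iff: "k \<le> \<nu> j \<longleftrightarrow> k \<le> \<eta> j" if "k \<le> d" for k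
    using eq[of p k] eq[of j k] that p hgt_Suc[of p n \<nu> k] hgt_Suc[of p n \<eta> k] by (auto split: if_splits)
  have "\<nu> j \<le> d" "\<eta> j \<le> d"
    using member_le_sum[of j "{1..n}" \<nu>] member_le_sum[of j "{1..n}" \<eta>] le d j
    by (auto simp: comp_le_def)
  then show ?thesis
    using iff[of "\<nu> j"] iff[of "\<eta> j"] by auto
qed

section \<open>Action of the operators on monomials\<close>

definition expo :: "nat \<Rightarrow> (nat \<Rightarrow> nat) \<Rightarrow> nat \<Rightarrow>\<^sub>0 nat" where
  "expo n \<eta> = (\<Sum>i=1..n. Poly_Mapping.single i (\<eta> i))"

lemma lookup_expo: "lookup (expo n \<eta>) j = (if j \<in> {1..n} then \<eta> j else 0)"
  by (simp add: expo_def lookup_sum lookup_single when_def)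

lemma keys_expo: "keys (expo n \<eta>) \<subseteq> {1..n}"
  by (auto simp: in_keys_iff lookup_expo split: if_splits)

lemma expo_eqI: "keys m \<subseteq> {1..n} \<Longrightarrow> (\<And>j. j \<in> {1..n} \<Longrightarrow> lookup m j = \<eta> j) \<Longrightarrow> m = expo n \<eta>"
  by (rule poly_mapping_eqI) (auto simp: lookup_expo in_keys_iff)

lemma expo_lookup: "keys m \<subseteq> {1..n} \<Longrightarrow> expo n (lookup m) = m"
  by (rule expo_eqI[symmetric]) auto

lemma expo_cong: "(\<And>j. j \<in> {1..n} \<Longrightarrow> \<eta> j = \<eta>' j) \<Longrightarrow> expo n \<eta> = expo n \<eta>'"
  unfolding expo_def by (rule sum.cong) auto

lemma zpow_eq_mon: "zpow n \<eta> = mon (expo n \<eta>)"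
  by (simp add: zpow_def expo_def mon_sum mon_single)

lemma omega_zpow:
  assumes "1 \<le> n"
  shows "Phi n (zpow n \<eta>) = Const (qvar ^ \<eta> 1) * zpow n (phi n \<eta>)"
proof -
  have split: "{1..n} = insert 1 {2..n}" using assms by auto
  have "omega n (zpow n \<eta>) = (Const qvar * Z n) ^ \<eta> 1 * (\<Prod>j=2..n. Z (j - 1) ^ \<eta> j)"
    unfolding zpow_def split ring_hom_prod[OF alg_hom_ring_hom[OF alg_hom_omega]]
    using assms by (simp add: omega_Z omega_simps)
  also have "(\<Prod>j=2..n. Z (j - 1) ^ \<eta> j) = (\<Prod>j=1..<n. Z j ^ \<eta> (j + 1))"
    by (rule prod.reindex_bij_witness[of _ "\<lambda>j. j + 1" "\<lambda>j. j - 1"]) auto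
  finally have 1: "Phi n (zpow n \<eta>)
      = Const (qvar ^ \<eta> 1) * (Z n ^ (\<eta> 1 + 1) * (\<Prod>j=1..<n. Z j ^ \<eta> (j + 1)))"
    by (simp add: Phi_def power_mult_distrib Const_simps mult_ac power_add)
  have "zpow n (phi n \<eta>) = Z n ^ (\<eta> 1 + 1) * (\<Prod>j=1..<n. Z j ^ phi n \<eta> j)"
  proof -
    have "{1..n} = insert n {1..<n}" using assms by auto
    then show ?thesis by (simp add: zpow_def phi_def)
  qed
  also have "(\<Prod>j=1..<n. Z j ^ phi n \<eta> j) = (\<Prod>j=1..<n. Z j ^ \<eta> (j + 1))"
    by (rule prod.cong) (auto simp: phi_def)
  finally show ?thesis by (simp only: 1)
qed

lemma s_op_mon:
  assumes "lookup m i = lookup m (Suc i)"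
  shows "s_op i (mon m) = mon m"
proof -
  define \<tau> where "\<tau> j = (if j = i then Suc i else if j = Suc i then i else j)" for j
  define A where "A = keys m \<union> {i, Suc i}"
  have "s_op i (mon m) = (\<Prod>j\<in>A. Z (\<tau> j) ^ lookup m j)"
  proof -
    have "mon m = (\<Prod>j\<in>A. Z j ^ lookup m j)" by (rule mon_eq_prod) (auto simp: A_def)
    then have "s_op i (mon m) = (\<Prod>j\<in>A. s_op i (Z j ^ lookup m j))"
      by (simp only: ring_hom_prod[OF alg_hom_ring_hom[OF alg_hom_s_op]])
    also have "\<dots> = (\<Prod>j\<in>A. Z (\<tau> j) ^ lookup m j)"
      by (rule prod.cong) (auto simp: s_op_simps s_op_Z \<tau>_def simp flip: Suc_eq_plus1)
    finally show ?thesis .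
  qed
  also have "\<dots> = (\<Prod>j\<in>A. Z j ^ lookup m j)"
    by (rule prod.reindex_bij_witness[of _ \<tau> \<tau>]) (use assms in \<open>auto simp: A_def \<tau>_def in_keys_iff\<close>)
  also have "\<dots> = mon m"
    by (rule mon_eq_prod[symmetric]) (auto simp: A_def)
  finally show ?thesis .
qed

lemma T_op_Z_Suc_power:
  "T_op i (Z (Suc i) ^ d) = Const tvar * Z i ^ d
     + (\<Sum>k<d. Const (tvar - 1) * (Z i ^ k * Z (Suc i) ^ (d - k)))"
proof (induction d)
  case 0
  have "T_op i 1 = Const tvar"
    by (rule T_op_unique) (simp add: s_op_simps algebra_simps)
  then show ?case by simp
next
  case (Suc d)
  have "T_op i (Z (Suc i) ^ Suc d)
      = Z i * T_op i (Z (Suc i) ^ d) + (Const tvar - 1) * Z (Suc i) * Z (Suc i) ^ d"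
    using T_op_Z_Suc[of i "Z (Suc i) ^ d"] by (simp only: Suc_eq_plus1[symmetric] power_Suc)
  also have "\<dots> = Const tvar * Z i ^ Suc d
     + (\<Sum>k<d. Const (tvar - 1) * (Z i ^ Suc k * Z (Suc i) ^ (Suc d - Suc k)))
     + Const (tvar - 1) * Z (Suc i) ^ Suc d"
    unfolding Suc by (simp add: distrib_left sum_distrib_left Const_simps mult_ac)
  also have "\<dots> = Const tvar * Z i ^ Suc d
     + (\<Sum>k<Suc d. Const (tvar - 1) * (Z i ^ k * Z (Suc i) ^ (Suc d - k)))"
    by (simp add: sum.lessThan_Suc_shift del: sum.lessThan_Suc)
  finally show ?case .
qed

lemma T_op_Z_power:
  "T_op i (Z i ^ d) = Const tvar * Z (Suc i) ^ d
     + (\<Sum>k<d. Const (1 - tvar) * (Z i ^ k * Z (Suc i) ^ (d - k)))"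
proof (induction d)
  case 0
  then show ?case using T_op_Z_Suc_power[of i 0] by simp
next
  case (Suc d)
  have "T_op i (Z i ^ Suc d) = Z (Suc i) * (T_op i (Z i ^ d) - (Const tvar - 1) * Z i ^ d)"
    using T_op_Z[of i "Z i ^ d"] by (simp only: Suc_eq_plus1[symmetric] power_Suc)
  also have "\<dots> = Const tvar * Z (Suc i) ^ Suc d
     + (\<Sum>k<d. Const (1 - tvar) * (Z i ^ k * (Z (Suc i) * Z (Suc i) ^ (d - k))))
     + Const (1 - tvar) * (Z i ^ d * Z (Suc i))"
    unfolding Suc by (simp add: distrib_left sum_distrib_left Const_simps algebra_simps)
  also have "(\<Sum>k<d. Const (1 - tvar) * (Z i ^ k * (Z (Suc i) * Z (Suc i) ^ (d - k))))
      = (\<Sum>k<d. Const (1 - tvar) * (Z i ^ k * Z (Suc i) ^ (Suc d - k)))"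
    by (rule sum.cong) (simp_all add: Suc_diff_le)
  finally show ?case by (simp add: add_ac)
qed

text \<open>The monomial r is invariant under s_i, so T_i is linear over it, and what remains of m
  is a power of a single variable.\<close>

lemma T_op_mon:
  assumes a_def: "a = lookup m i" and b_def: "b = lookup m (Suc i)"
  obtains r where "lookup r i = min a b" "lookup r (Suc i) = min a b"
    and "\<And>j. j \<noteq> i \<Longrightarrow> j \<noteq> Suc i \<Longrightarrow> lookup r j = lookup m j"
    and "a \<le> b \<Longrightarrow> T_op i (mon m) = Const tvar * mon (r + Poly_Mapping.single i (b - a))
       + (\<Sum>k<b - a. Const (tvar - 1) *
           mon (r + (Poly_Mapping.single i k + Poly_Mapping.single (Suc i) (b - a - k))))"
    and "b < a \<Longrightarrow> T_op i (mon m) = Const tvar * mon (r + Poly_Mapping.single (Suc i) (a - b))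
       + (\<Sum>k<a - b. Const (1 - tvar) *
           mon (r + (Poly_Mapping.single i k + Poly_Mapping.single (Suc i) (a - b - k))))"
proof -
  define r where "r = Poly_Mapping.update i (min a b) (Poly_Mapping.update (Suc i) (min a b) m)"
  have r: "lookup r j = (if j = i \<or> j = Suc i then min a b else lookup m j)" for j
    by (auto simp: r_def lookup_update)
  have inv: "s_op i (mon r) = mon r"
    by (rule s_op_mon) (simp add: r)
  show thesis
  proof (rule that[of r])
    assume "a \<le> b"
    then have "m = r + Poly_Mapping.single (Suc i) (b - a)"
      by (intro poly_mapping_eqI) (auto simp: r lookup_add lookup_single when_def a_def b_def)
    then have "mon m = mon r * Z (Suc i) ^ (b - a)"
      by (simp add: mon_add mon_single)
    then show "T_op i (mon m) = Const tvar * mon (r + Poly_Mapping.single i (b - a))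
       + (\<Sum>k<b - a. Const (tvar - 1) *
           mon (r + (Poly_Mapping.single i k + Poly_Mapping.single (Suc i) (b - a - k))))"
      by (simp only: T_op_mult[OF inv] T_op_Z_Suc_power mon_add mon_single distrib_left sum_distrib_left
          mult.left_commute)
  next
    assume "b < a"
    then have "m = r + Poly_Mapping.single i (a - b)"
      by (intro poly_mapping_eqI) (auto simp: r lookup_add lookup_single when_def a_def b_def)
    then have "mon m = mon r * Z i ^ (a - b)"
      by (simp add: mon_add mon_single)
    then show "T_op i (mon m) = Const tvar * mon (r + Poly_Mapping.single (Suc i) (a - b))
       + (\<Sum>k<a - b. Const (1 - tvar) *
           mon (r + (Poly_Mapping.single i k + Poly_Mapping.single (Suc i) (a - b - k))))"
      by (simp only: T_op_mult[OF inv] T_op_Z_power mon_add mon_single distrib_left sum_distrib_left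
          mult.left_commute)
  qed (auto simp: r)
qed

lemma keys_T_op_mon:
  assumes "k \<in> keys (T_op i (mon m))"
  shows "between i (lookup k) (lookup m)"
proof -
  define a b where "a = lookup m i" and "b = lookup m (Suc i)"
  obtain r where r: "lookup r i = min a b" "lookup r (Suc i) = min a b"
      "\<And>j. j \<noteq> i \<Longrightarrow> j \<noteq> Suc i \<Longrightarrow> lookup r j = lookup m j"
    and 1: "a \<le> b \<Longrightarrow> T_op i (mon m) = Const tvar * mon (r + Poly_Mapping.single i (b - a))
       + (\<Sum>k<b - a. Const (tvar - 1) *
           mon (r + (Poly_Mapping.single i k + Poly_Mapping.single (Suc i) (b - a - k))))"
    and 2: "b < a \<Longrightarrow> T_op i (mon m) = Const tvar * mon (r + Poly_Mapping.single (Suc i) (a - b))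
       + (\<Sum>k<a - b. Const (1 - tvar) *
           mon (r + (Poly_Mapping.single i k + Poly_Mapping.single (Suc i) (a - b - k))))"
    by (rule T_op_mon[OF a_def b_def]) blast
  have lk: "k = k0 \<or> (\<exists>l<d. k = f l)"
    if "T_op i (mon m) = Const c * mon k0 + (\<Sum>l<d. Const c' * mon (f l))" for c c' k0 d f
  proof (rule ccontr)
    assume n: "\<not> ?thesis"
    then have "lookup (\<Sum>l<d. Const c' * mon (f l)) k = 0"
      unfolding lookup_sum by (intro sum.neutral) (auto simp: lookup_mon)
    then show False using assms n by (simp add: that in_keys_iff lookup_add lookup_mon)
  qed
  have bet: "between i (lookup (r + (Poly_Mapping.single i u + Poly_Mapping.single (Suc i) v))) (lookup m)"
    if "u + v = max a b - min a b" for u v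
    using r that by (auto simp: between_def lookup_add lookup_single a_def[symmetric] b_def[symmetric] min_def max_def
        split: if_splits)
  show ?thesis
  proof (cases "a \<le> b")
    case True
    then show ?thesis
      using lk[OF 1[OF True]] bet[of "b - a" 0] bet by (auto simp: min_def max_def)
  next
    case False
    then show ?thesis
      using lk[OF 2] bet[of 0 "a - b"] bet by (auto simp: min_def max_def)
  qed
qed

lemma lookup_T_op_mon_swp:
  assumes "lookup m i < lookup m (Suc i)" "lookup k = swp i (lookup m)"
  shows "lookup (T_op i (mon m)) k = tvar"
proof -
  define a b where "a = lookup m i" and "b = lookup m (Suc i)"
  obtain r where r: "lookup r i = min a b" "lookup r (Suc i) = min a b"
      "\<And>j. j \<noteq> i \<Longrightarrow> j \<noteq> Suc i \<Longrightarrow> lookup r j = lookup m j"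
    and 1: "a \<le> b \<Longrightarrow> T_op i (mon m) = Const tvar * mon (r + Poly_Mapping.single i (b - a))
       + (\<Sum>k<b - a. Const (tvar - 1) *
           mon (r + (Poly_Mapping.single i k + Poly_Mapping.single (Suc i) (b - a - k))))"
    by (rule T_op_mon[OF a_def b_def]) blast
  have ab: "a < b" using assms by (simp add: a_def b_def)
  have "lookup k j = lookup (r + Poly_Mapping.single i (b - a)) j" for j
    using r assms ab by (cases "j = i"; cases "j = Suc i") (auto simp: lookup_add lookup_single when_def a_def b_def)
  then have k: "k = r + Poly_Mapping.single i (b - a)"
    by (rule poly_mapping_eqI)
  have ne: "r + (Poly_Mapping.single i l + Poly_Mapping.single (Suc i) (b - a - l)) \<noteq> k" if "l < b - a" for l
  proof
    assume "r + (Poly_Mapping.single i l + Poly_Mapping.single (Suc i) (b - a - l)) = k"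
    then have "lookup (r + (Poly_Mapping.single i l + Poly_Mapping.single (Suc i) (b - a - l))) i = lookup k i"
      by simp
    then show False using that by (simp add: k lookup_add lookup_single)
  qed
  have "lookup (\<Sum>k<b - a. Const (tvar - 1) *
           mon (r + (Poly_Mapping.single i k + Poly_Mapping.single (Suc i) (b - a - k)))) k = 0"
    unfolding lookup_sum by (intro sum.neutral) (use ne in \<open>auto simp: lookup_mon\<close>)
  then show ?thesis
    using 1 ab by (simp add: lookup_add lookup_mon k)
qed

lemma keys_op_subset:
  assumes "\<And>f g. F (f + g) = F f + F g" and "\<And>c f. F (Const c * f) = Const c * F f"
    and "k \<in> keys (F f)"
  obtains m where "m \<in> keys f" "k \<in> keys (F (mon m))"
proof -
  have sum: "F (sum g A) = (\<Sum>x\<in>A. F (g x))" if "finite A" for g and A :: "(nat \<Rightarrow>\<^sub>0 nat) set"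
    using that assms(1) assms(2)[of 0] by (induction A) (simp_all add: Const_simps)
  have "F f = (\<Sum>m\<in>keys f. Const (lookup f m) * F (mon m))"
    by (subst zpoly_sum_mons[of "keys f" f]) (simp_all add: sum assms(2))
  then have "(\<Sum>m\<in>keys f. lookup f m * lookup (F (mon m)) k) \<noteq> 0"
    using assms(3) by (simp add: in_keys_iff lookup_sum)
  then obtain m where "m \<in> keys f" "lookup f m * lookup (F (mon m)) k \<noteq> 0"
    by (meson sum.neutral)
  then show thesis using that by (auto simp: in_keys_iff)
qed

lemma lookup_op:
  assumes "\<And>f g. F (f + g) = F f + F g" and "\<And>c f. F (Const c * f) = Const c * F f"
    and "\<And>k. k \<in> keys f \<Longrightarrow> k \<noteq> m \<Longrightarrow> l \<notin> keys (F (mon k))"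
  shows "lookup (F f) l = lookup f m * lookup (F (mon m)) l"
proof -
  have sum: "F (sum g A) = (\<Sum>x\<in>A. F (g x))" if "finite A" for g and A :: "(nat \<Rightarrow>\<^sub>0 nat) set"
    using that assms(1) assms(2)[of 0] by (induction A) (simp_all add: Const_simps)
  have "F f = (\<Sum>k\<in>insert m (keys f). Const (lookup f k) * F (mon k))"
    by (subst zpoly_sum_mons[of "insert m (keys f)" f]) (auto simp: sum assms(2))
  then have "lookup (F f) l = (\<Sum>k\<in>insert m (keys f). lookup f k * lookup (F (mon k)) l)"
    by (simp only: lookup_sum lookup_Const_mult)
  also have "\<dots> = (\<Sum>k\<in>{m}. lookup f k * lookup (F (mon k)) l)"
    by (rule sum.mono_neutral_right) (use assms(3) in \<open>auto simp: in_keys_iff\<close>)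
  finally show ?thesis by simp
qed

section \<open>Existence of nonsymmetric Macdonald polynomials\<close>

text \<open>The defining properties of E_\<eta> with \<prec> replaced by \<open>comp_le\<close>,
  under which both generating steps are closed. The two characterizations are shown to agree
  later.\<close>

definition is_macd :: "nat \<Rightarrow> (nat \<Rightarrow> nat) \<Rightarrow> zpoly \<Rightarrow> bool" where
  "is_macd n \<eta> E \<longleftrightarrow>
     (\<forall>m\<in>keys E. keys m \<subseteq> {1..n} \<and> comp_le n (lookup m) \<eta>) \<and> lookup E (expo n \<eta>) = 1 \<and>
     (\<forall>i\<in>{1..n}. Y_op n i E = Const (eta_bar n \<eta> i) * E)"

lemma is_macd_cong:
  assumes "\<And>j. j \<in> {1..n} \<Longrightarrow> \<eta> j = \<eta>' j"
  shows "is_macd n \<eta> E \<longleftrightarrow> is_macd n \<eta>' E"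
proof -
  have "comp_le n \<mu> \<eta> \<longleftrightarrow> comp_le n \<mu> \<eta>'" for \<mu>
    by (rule comp_le_cong) (use assms in auto)
  moreover have "expo n \<eta> = expo n \<eta>'"
    by (rule expo_cong) (use assms in auto)
  moreover have "\<forall>i\<in>{1..n}. eta_bar n \<eta> i = eta_bar n \<eta>' i"
    using eta_bar_cong[of n \<eta> \<eta>'] assms by blast
  ultimately show ?thesis
    unfolding is_macd_def by (metis (no_types, lifting))
qed

lemma is_macd_zero:
  assumes "1 \<le> n"
  shows "is_macd n (\<lambda>_. 0) 1"
proof -
  have T1: "T_op i 1 = Const tvar" for i
    using T_op_Z_Suc_power[of i 0] by simp
  have Ti: "T_inv i 1 = Const (inverse tvar)" for i
    using T_inv_T_op[of i 1] T_inv_Const[of i tvar 1] Const_inverse_cancel[of tvar "T_inv i 1"]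
    by (simp add: T1)
  have "foldr T_op xs 1 = Const (tvar ^ length xs)" for xs
  proof (induction xs)
    case (Cons x xs)
    then show ?case using T_op_Const[of x "tvar ^ length xs" 1] by (simp add: T1 Const_simps mult_ac)
  qed (simp add: Const_simps)
  moreover have "foldr T_inv xs 1 = Const (inverse tvar ^ length xs)" for xs
  proof (induction xs)
    case (Cons x xs)
    then show ?case
      using T_inv_Const[of x "inverse tvar ^ length xs" 1] by (simp add: Ti Const_simps mult_ac)
  qed (simp add: Const_simps)
  ultimately have Y: "Y_op n i 1 = Const (tvar powi (int i - int n) * tvar ^ (n - i) * inverse tvar ^ (i - 1))" for i
    using foldr_T_op_Const[of "[i..<n]" "inverse tvar ^ (i - 1)" 1]
    by (simp add: Y_op_eq omega_simps Const_simps mult_ac)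
  have "Y_op n i 1 = Const (eta_bar n (\<lambda>_. 0) i)" if i: "i \<in> {1..n}" for i
  proof -
    have "{j \<in> {1..n}. ranks_before (\<lambda>_. 0) j i} = {1..<i}"
      using i by (auto simp: ranks_before_def)
    then have "leg' n (\<lambda>_. 0) i = i - 1" by (simp add: leg'_eq_card)
    moreover have "tvar powi (int i - int n) * tvar ^ (n - i) = 1"
      using i power_int_add[of tvar "int i - int n" "int (n - i)"] power_int_of_nat[of tvar "n - i"]
      by (simp add: of_nat_diff)
    moreover have "inverse tvar ^ (i - 1) = tvar powi (- int (i - 1))"
      by (simp add: power_int_minus power_inverse)
    ultimately show ?thesis by (simp add: Y eta_bar_def)
  qed
  moreover have "expo n (\<lambda>_. 0) = 0"
    by (simp add: expo_def)
  moreover have "keys (1 :: zpoly) = {0}"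
    by simp
  ultimately show ?thesis
    unfolding is_macd_def by (auto simp: lookup_zero[abs_def] Const_simps)
qed

text \<open>The constant undoes the power of q that \<omega> takes out of the leading monomial. By
  \<open>Y_Phi\<close> and \<open>Y_n_Phi\<close> the eigenvalues rotate exactly as the spectral
  vector does under \<open>phi\<close>.\<close>

lemma is_macd_phi:
  assumes n: "1 \<le> n" and E: "is_macd n \<eta> E"
  shows "is_macd n (phi n \<eta>) (Const (inverse (qvar ^ \<eta> 1)) * Phi n E)"
proof -
  have add: "Phi n (f + g) = Phi n f + Phi n g" for f g
    by (simp add: Phi_def omega_simps distrib_left)
  have Phi_mon: "Phi n (mon m) = Const (qvar ^ lookup m 1) * mon (expo n (phi n (lookup m)))"
    if "keys m \<subseteq> {1..n}" for m
    using omega_zpow[OF n, of "lookup m"] expo_lookup[OF that] by (simp add: zpow_eq_mon)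
  have keysE: "keys m \<subseteq> {1..n}" "comp_le n (lookup m) \<eta>" if "m \<in> keys E" for m
    using E that by (auto simp: is_macd_def)
  have "keys k \<subseteq> {1..n} \<and> comp_le n (lookup k) (phi n \<eta>)"
    if "k \<in> keys (Const (inverse (qvar ^ \<eta> 1)) * Phi n E)" for k
  proof -
    have "k \<in> keys (Phi n E)" using that keys_Const_mult by blast
    then obtain m where m: "m \<in> keys E" "k \<in> keys (Phi n (mon m))"
      by (rule keys_op_subset[OF add Phi_Const])
    then have k: "k = expo n (phi n (lookup m))"
      using keysE by (auto simp: Phi_mon in_keys_iff lookup_mon split: if_splits)
    have "comp_le n (lookup k) (phi n \<eta>) = comp_le n (phi n (lookup m)) (phi n \<eta>)"
      by (rule comp_le_cong) (auto simp: k lookup_expo)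
    then show ?thesis
      using comp_le_phi[OF n keysE(2)[OF m(1)]] keys_expo[of n] by (simp add: k)
  qed
  moreover have "lookup (Const (inverse (qvar ^ \<eta> 1)) * Phi n E) (expo n (phi n \<eta>)) = 1"
  proof -
    have "lookup (Phi n E) (expo n (phi n \<eta>))
        = lookup E (expo n \<eta>) * lookup (Phi n (mon (expo n \<eta>))) (expo n (phi n \<eta>))"
    proof (rule lookup_op[OF add Phi_Const])
      fix k assume k: "k \<in> keys E" "k \<noteq> expo n \<eta>"
      show "expo n (phi n \<eta>) \<notin> keys (Phi n (mon k))"
      proof
        assume "expo n (phi n \<eta>) \<in> keys (Phi n (mon k))"
        then have eq: "expo n (phi n \<eta>) = expo n (phi n (lookup k))"
          using k keysE by (auto simp: Phi_mon in_keys_iff lookup_mon split: if_splits)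
        have "lookup k j = \<eta> j" if "j \<in> {1..n}" for j
        proof -
          let ?l = "if j = 1 then n else j - 1"
          have "lookup (expo n (phi n \<eta>)) ?l = lookup (expo n (phi n (lookup k))) ?l"
            by (simp only: eq)
          then show ?thesis
            using that n by (auto simp: lookup_expo phi_def split: if_splits)
        qed
        then have "k = expo n \<eta>" by (intro expo_eqI keysE k) auto
        with k show False by simp
      qed
    qed
    moreover have "expo n (phi n (lookup (expo n \<eta>))) = expo n (phi n \<eta>)"
      by (rule expo_cong) (use n in \<open>auto simp: phi_def lookup_expo\<close>)
    moreover have "lookup E (expo n \<eta>) = 1"
      using E by (simp add: is_macd_def)
    ultimately show ?thesis
      using n by (simp add: Phi_mon keys_expo lookup_mon lookup_expo)
  qed
  moreover have "Y_op n i (Const (inverse (qvar ^ \<eta> 1)) * Phi n E)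
      = Const (eta_bar n (phi n \<eta>) i) * (Const (inverse (qvar ^ \<eta> 1)) * Phi n E)" if i: "i \<in> {1..n}" for i
  proof -
    have Y: "Y_op n j E = Const (eta_bar n \<eta> j) * E" if "j \<in> {1..n}" for j
      using E that by (auto simp: is_macd_def)
    have "Y_op n i (Phi n E) = Const (eta_bar n (phi n \<eta>) i) * Phi n E"
    proof (cases "i = n")
      case True
      then show ?thesis
        using Y_n_Phi[OF n, of E] Y[of 1] n eta_bar_phi[OF i] by (simp add: Phi_Const Const_simps mult.assoc)
    next
      case False
      then show ?thesis
        using Y_Phi[of i n E] Y[of "Suc i"] i eta_bar_phi[OF i] by (simp add: Phi_Const flip: Suc_eq_plus1)
    qed
    then show ?thesis by (simp add: Y_op_Const mult.left_commute)
  qed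
  ultimately show ?thesis by (simp add: is_macd_def)
qed

text \<open>The constant is the solution a of a(y_i - y_{i+1}) = (t - 1) y_i. It cancels the
  multiple of f that Y_i and Y_{i+1} produce from T_i f besides a multiple of T_i f.\<close>

lemma intertwiner_eigen:
  assumes i: "1 \<le> i" "i < n"
    and Y: "\<And>j. j \<in> {1..n} \<Longrightarrow> Y_op n j f = Const (y j) * f"
    and y: "y i \<noteq> y (Suc i)" and j: "j \<in> {1..n}"
  defines "g \<equiv> T_op i f - Const (a_hat (y i) (y (Suc i))) * f"
  shows "Y_op n j g = Const (swp i y j) * g"
proof -
  define a where "a = a_hat (y i) (y (Suc i))"
  have a: "a * (y i - y (Suc i)) = (tvar - 1) * y i"
    using y by (simp add: a_def a_hat_def)
  have g: "g = T_op i f - Const a * f" by (simp add: g_def a_def)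
  have t0: "Const tvar \<noteq> 0" by simp
  have TYf: "Y_op n (Suc i) (T_op i h) = Const tvar * T_inv i (Y_op n i h)" for h
    using arg_cong[OF T_Y_T[OF i, of h], of "T_inv i"] by (simp add: T_inv_Const)
  have tT: "Const tvar * T_inv i h = T_op i h - (Const tvar - 1) * h" for h
    using Const_tvar_inverse by (simp add: T_inv_def flip: mult.assoc)
  show ?thesis
  proof (cases "j = i \<or> j = Suc i")
    case False
    then have "T_op i (Y_op n j f) = Y_op n j (T_op i f)"
      using T_Y_commute[of j n i f] i j by auto
    then show ?thesis
      using False Y[OF j] by (simp add: g Y_op_diff Y_op_Const T_op_Const right_diff_distrib mult.left_commute)
  next
    case True
    then show ?thesis
    proof
      assume ji: "j = Suc i"
      have "Y_op n (Suc i) (T_op i f) = Const (y i) * (T_op i f - (Const tvar - 1) * f)"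
        using Y[of i] i by (simp add: TYf T_inv_Const tT[symmetric] mult.left_commute)
      then have "Y_op n j g = Const (y i) * T_op i f - Const (y i * (tvar - 1) + a * y (Suc i)) * f"
        using Y[of "Suc i"] i
        by (simp add: ji g Y_op_diff Y_op_Const Const_simps right_diff_distrib left_diff_distrib distrib_right mult.assoc)
      also have "y i * (tvar - 1) + a * y (Suc i) = y i * a"
        using a by (simp add: algebra_simps)
      finally show ?thesis
        by (simp add: ji g Const_simps algebra_simps)
    next
      assume ji: "j = i"
      \<comment> \<open>Y_i T_i f is accessible through T_i Y_{i+1} T_i = t Y_i applied to T_i f;
        the square of T_i that appears is removed by the quadratic relation.\<close>
      have "Const tvar * Y_op n i (T_op i f) = T_op i (Y_op n (Suc i) (T_op i (T_op i f)))"
        using T_Y_T[OF i, of "T_op i f"] by simp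
      also have "T_op i (T_op i f) = Const (tvar - 1) * T_op i f + Const tvar * f"
        by (simp add: T_op_quadratic Const_simps)
      also have "T_op i (Y_op n (Suc i) (Const (tvar - 1) * T_op i f + Const tvar * f))
          = Const tvar * (Const (tvar - 1) * Y_op n i f + T_op i (Y_op n (Suc i) f))"
        using T_Y_T[OF i, of f]
        by (simp add: Y_op_add Y_op_Const T_op_add T_op_Const distrib_left mult.left_commute)
      finally have "Y_op n i (T_op i f) = Const (tvar - 1) * Y_op n i f + T_op i (Y_op n (Suc i) f)"
        using t0 mult_left_cancel by blast
      then have "Y_op n j g = Const (y (Suc i)) * T_op i f + Const ((tvar - 1) * y i - a * y i) * f"
        using Y[of "Suc i"] Y[of i] i
        by (simp add: ji g Y_op_diff Y_op_Const T_op_Const Const_simps right_diff_distrib left_diff_distrib mult.assoc)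
      also have "(tvar - 1) * y i - a * y i = - (a * y (Suc i))"
        using a by (simp add: algebra_simps)
      finally show ?thesis
        by (simp add: ji g Const_simps algebra_simps)
    qed
  qed
qed

text \<open>The swapped exponent does not occur in E, and in T_i E it arises from the leading
  monomial only, with coefficient t. This explains the normalization.\<close>

lemma is_macd_swp:
  assumes i: "1 \<le> i" "i < n" and lt: "\<eta> i < \<eta> (Suc i)" and E: "is_macd n \<eta> E"
  shows "is_macd n (swp i \<eta>)
    (Const (inverse tvar) * (T_op i E - Const (a_hat (eta_bar n \<eta> i) (eta_bar n \<eta> (Suc i))) * E))"
    (is "is_macd n _ (Const _ * (_ - Const ?a * E))")
proof -
  have keysE: "keys m \<subseteq> {1..n}" "comp_le n (lookup m) \<eta>" if "m \<in> keys E" for m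
    using E that by (auto simp: is_macd_def)
  have bet: "between i (lookup k) (lookup m)" "keys k \<subseteq> {1..n}"
    if "m \<in> keys E" "k \<in> keys (T_op i (mon m))" for m k
  proof -
    show b: "between i (lookup k) (lookup m)" using keys_T_op_mon[OF that(2)] .
    have "lookup m j = 0" if "j \<notin> {1..n}" for j
      using keysE(1)[OF \<open>m \<in> keys E\<close>] that by (auto simp: in_keys_iff)
    then show "keys k \<subseteq> {1..n}"
      using b i unfolding between_def by (auto simp: in_keys_iff) (metis Suc_leI le_SucI less_or_eq_imp_le nat_less_le order_trans)+
  qed
  have "keys k \<subseteq> {1..n} \<and> comp_le n (lookup k) (swp i \<eta>)"
    if "k \<in> keys (Const (inverse tvar) * (T_op i E - Const ?a * E))" for k
  proof -
    have "k \<in> keys (T_op i E) \<or> k \<in> keys E"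
      using that by (auto simp: in_keys_iff lookup_minus)
    then show ?thesis
    proof
      assume "k \<in> keys (T_op i E)"
      then obtain m where "m \<in> keys E" "k \<in> keys (T_op i (mon m))"
        by (rule keys_op_subset[OF T_op_add T_op_Const])
      then show ?thesis
        using comp_le_swp[OF i keysE(2) lt] bet by blast
    next
      assume "k \<in> keys E"
      then show ?thesis
        using comp_le_swp[OF i keysE(2) lt between_refl] keysE by blast
    qed
  qed
  moreover have "lookup (Const (inverse tvar) * (T_op i E - Const ?a * E)) (expo n (swp i \<eta>)) = 1"
  proof -
    have ex: "m = expo n \<eta>" if m: "m \<in> keys E" and b: "between i (lookup (expo n (swp i \<eta>))) (lookup m)" for m
    proof -
      have "comp_le n (lookup m) (lookup (expo n \<eta>)) = comp_le n (lookup m) \<eta>"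
        by (rule comp_le_cong) (auto simp: lookup_expo)
      moreover have "lookup (expo n (swp i \<eta>)) = swp i (lookup (expo n \<eta>))"
        using i by (auto simp: fun_eq_iff lookup_expo swp_def)
      ultimately have "lookup m i = lookup (expo n \<eta>) i \<and> lookup m (Suc i) = lookup (expo n \<eta>) (Suc i)"
        using comp_le_extreme[OF i, of "lookup m" "lookup (expo n \<eta>)"] keysE(2)[OF m] b lt i
        by (simp add: lookup_expo)
      moreover have "lookup m j = lookup (expo n \<eta>) j" if "j \<noteq> i" "j \<noteq> Suc i" for j
        using b that by (auto simp: between_def lookup_expo)
      ultimately show ?thesis by (intro poly_mapping_eqI) metis
    qed
    have sw: "lookup (expo n (swp i \<eta>)) = swp i (lookup (expo n \<eta>))"
      using i by (auto simp: fun_eq_iff lookup_expo swp_def)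
    have "lookup (T_op i E) (expo n (swp i \<eta>))
        = lookup E (expo n \<eta>) * lookup (T_op i (mon (expo n \<eta>))) (expo n (swp i \<eta>))"
      by (rule lookup_op[OF T_op_add T_op_Const]) (use ex keys_T_op_mon in blast)
    also have "lookup (T_op i (mon (expo n \<eta>))) (expo n (swp i \<eta>)) = tvar"
      by (rule lookup_T_op_mon_swp) (use i lt sw in \<open>auto simp: lookup_expo\<close>)
    finally have 1: "lookup (T_op i E) (expo n (swp i \<eta>)) = tvar"
      using E by (simp add: is_macd_def)
    have "expo n (swp i \<eta>) \<notin> keys E"
    proof
      assume "expo n (swp i \<eta>) \<in> keys E"
      then have "expo n (swp i \<eta>) = expo n \<eta>" using ex between_refl by blast
      then have "lookup (expo n (swp i \<eta>)) i = lookup (expo n \<eta>) i" by simp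
      then show False using i lt by (simp add: lookup_expo)
    qed
    then show ?thesis using 1 by (simp add: lookup_minus in_keys_iff)
  qed
  moreover have "Y_op n j (Const (inverse tvar) * (T_op i E - Const ?a * E))
      = Const (eta_bar n (swp i \<eta>) j) * (Const (inverse tvar) * (T_op i E - Const ?a * E))" if j: "j \<in> {1..n}" for j
  proof -
    have "Y_op n j (T_op i E - Const ?a * E) = Const (swp i (eta_bar n \<eta>) j) * (T_op i E - Const ?a * E)"
      by (rule intertwiner_eigen[OF i]) (use E j i eta_bar_inj[of i n "Suc i" \<eta>] in \<open>auto simp: is_macd_def\<close>)
    then show ?thesis
      using eta_bar_swp[OF i, of \<eta> j] lt j by (simp add: Y_op_Const mult.left_commute)
  qed
  ultimately show ?thesis by (simp add: is_macd_def)
qed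

text \<open>A positive last part is undone by \<open>phi\<close>, a descent by \<open>swp\<close>;
  with neither, the parts increase weakly up to a last part 0 and all vanish. Undoing
  \<open>phi\<close> lowers the degree, while undoing a descent keeps it and lowers the weighted
  sum.\<close>

lemma is_macd_exists:
  assumes n: "1 \<le> n"
  shows "\<exists>E. is_macd n \<eta> E"
proof (induction \<eta> rule: wf_induct_rule[OF wf_measures[of "[\<lambda>\<eta>. \<Sum>j=1..n. \<eta> j, \<lambda>\<eta>. \<Sum>j=1..n. (n - j) * \<eta> j]"]])
  case (1 \<eta>)
  consider (zero) "\<forall>j\<in>{1..n}. \<eta> j = 0" | (phi) "\<eta> n > 0"
    | (swp) i where "1 \<le> i" "i < n" "\<eta> (Suc i) < \<eta> i"
  proof (cases "\<forall>j\<in>{1..n}. \<eta> j = 0")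
    case True
    then show ?thesis by (rule zero)
  next
    case False
    then obtain j where j: "j \<in> {1..n}" "\<eta> j > 0" by auto
    show ?thesis
    proof (rule ccontr)
      assume no: "\<not> thesis"
      have "\<eta> k > 0" if "j \<le> k" "k \<le> n" for k
        using that
      proof (induction k rule: dec_induct)
        case base
        then show ?case using j by simp
      next
        case (step k)
        have "\<not> \<eta> (Suc k) < \<eta> k"
          using no swp[of k] step j by auto
        then show ?case using step by simp
      qed
      then show False using no phi j by auto
    qed
  qed
  then show ?case
  proof cases
    case zero
    then show ?thesis
      using is_macd_zero[OF n] is_macd_cong[of n \<eta> "\<lambda>_. 0"] by auto
  next
    case phi
    define \<kappa> where "\<kappa> j = (if j = 1 then \<eta> n - 1 else \<eta> (j - 1))" for j
    have eq: "phi n \<kappa> j = \<eta> j" if "j \<in> {1..n}" for j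
      using that phi n by (auto simp: phi_def \<kappa>_def)
    have "(\<Sum>j=1..n. \<eta> j) = (\<Sum>j=1..n. phi n \<kappa> j)"
      by (rule sum.cong) (simp_all add: eq)
    then have "(\<Sum>j=1..n. \<kappa> j) < (\<Sum>j=1..n. \<eta> j)"
      using sum_phi[OF n, of \<kappa>] by simp
    then obtain E where "is_macd n \<kappa> E" using 1[of \<kappa>] by auto
    from is_macd_phi[OF n this] show ?thesis
      using is_macd_cong[of n "phi n \<kappa>" \<eta>] eq by blast
  next
    case (swp i)
    define \<kappa> where "\<kappa> = swp i \<eta>"
    have i: "1 \<le> i" "i < n" using swp by auto
    have "(\<Sum>j\<in>{1..n} - {i, Suc i}. (n - j) * \<kappa> j) = (\<Sum>j\<in>{1..n} - {i, Suc i}. (n - j) * \<eta> j)"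
      by (rule sum.cong) (auto simp: \<kappa>_def)
    moreover have "(n - i) * \<eta> (Suc i) + (n - Suc i) * \<eta> i < (n - i) * \<eta> i + (n - Suc i) * \<eta> (Suc i)"
    proof -
      have "n - i = Suc (n - Suc i)" using i by simp
      then show ?thesis using swp by simp
    qed
    ultimately have "(\<Sum>j=1..n. (n - j) * \<kappa> j) < (\<Sum>j=1..n. (n - j) * \<eta> j)"
      unfolding sum_two_positions[OF i] by (simp add: \<kappa>_def)
    moreover have "(\<Sum>j=1..n. \<kappa> j) = (\<Sum>j=1..n. \<eta> j)"
      unfolding \<kappa>_def by (rule sum_swp[OF i])
    ultimately obtain E where "is_macd n \<kappa> E" using 1[of \<kappa>] by auto
    from is_macd_swp[OF i _ this] swp show ?thesis
      by (auto simp: \<kappa>_def)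
  qed
qed

section \<open>Uniqueness\<close>

text \<open>Triangularity is inferred from existence: z^m is E_m minus terms of smaller rank, Y_i
  multiplies E_m by a scalar, and the smaller terms are covered by induction.\<close>

lemma Y_op_mon_triangular:
  assumes n: "1 \<le> n" and i: "i \<in> {1..n}" and m: "keys m \<subseteq> {1..n}"
  shows "(\<forall>k\<in>keys (Y_op n i (mon m)). keys k \<subseteq> {1..n} \<and> comp_le n (lookup k) (lookup m)) \<and>
    lookup (Y_op n i (mon m)) m = eta_bar n (lookup m) i"
  using m
proof (induction "comp_rank n (\<Sum>j=1..n. lookup m j) (lookup m)" arbitrary: m rule: less_induct)
  case less
  obtain E where E: "is_macd n (lookup m) E" using is_macd_exists[OF n] by blast
  have keysE: "keys k \<subseteq> {1..n}" "comp_le n (lookup k) (lookup m)" if "k \<in> keys E" for k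
    using E that by (auto simp: is_macd_def)
  have Em: "lookup E m = 1"
    using E expo_lookup[OF less.prems] by (simp add: is_macd_def)
  have antisym: "k = m" if "k \<in> keys E" "comp_le n (lookup m) (lookup k)" for k
  proof -
    have "lookup m j = lookup k j" if "j \<in> {1..n}" for j
    proof (rule comp_le_rank[OF \<open>comp_le n (lookup m) (lookup k)\<close> _ _ that])
      show "(\<Sum>j=1..n. lookup k j) \<le> (\<Sum>j=1..n. lookup m j)"
        using keysE(2)[OF \<open>k \<in> keys E\<close>] by (simp add: comp_le_def)
      show "comp_rank n (\<Sum>j=1..n. lookup m j) (lookup k) \<le> comp_rank n (\<Sum>j=1..n. lookup m j) (lookup m)"
        unfolding comp_rank_def
        by (intro sum_mono) (use keysE(2)[OF \<open>k \<in> keys E\<close>] in \<open>auto simp: comp_le_def\<close>)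
    qed
    then show ?thesis
      using expo_eqI[OF keysE(1)[OF that(1)], of "lookup m"] expo_lookup[OF less.prems] by simp
  qed
  have IH: "keys l \<subseteq> {1..n} \<and> comp_le n (lookup l) (lookup k)"
    if "k \<in> keys E" "k \<noteq> m" "l \<in> keys (Y_op n i (mon k))" for k l
  proof -
    have sum: "(\<Sum>j=1..n. lookup k j) = (\<Sum>j=1..n. lookup m j)"
      using keysE[OF that(1)] by (simp add: comp_le_def)
    have "comp_rank n (\<Sum>j=1..n. lookup k j) (lookup k) < comp_rank n (\<Sum>j=1..n. lookup m j) (lookup m)"
    proof (rule ccontr)
      assume "\<not> ?thesis"
      then have "lookup k j = lookup m j" if "j \<in> {1..n}" for j
        using comp_le_rank[OF keysE(2)[OF \<open>k \<in> keys E\<close>] order_refl _ that] sum by simp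
      then have "k = m"
        using expo_eqI[OF keysE(1)[OF that(1)], of "lookup m"] expo_lookup[OF less.prems] by simp
      with that show False by simp
    qed
    then show ?thesis using less.hyps[of k] keysE(1)[OF that(1)] that by blast
  qed
  define R where "R = E - mon m"
  have R: "lookup R k = (if k = m then 0 else lookup E k)" for k
    using Em by (simp add: R_def lookup_minus lookup_mon)
  have YE: "Y_op n i (mon m) = Const (eta_bar n (lookup m) i) * E - Y_op n i R"
    using E i Y_op_diff[of n i E R] by (simp add: R_def is_macd_def)
  have keysR: "keys k \<subseteq> {1..n} \<and> comp_le n (lookup k) (lookup m) \<and> k \<noteq> m" if "k \<in> keys (Y_op n i R)" for k
  proof -
    from that obtain l where l: "l \<in> keys R" "k \<in> keys (Y_op n i (mon l))"
      by (rule keys_op_subset[OF Y_op_add Y_op_Const])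
    have lE: "l \<in> keys E" "l \<noteq> m"
      using l(1) by (auto simp: in_keys_iff R split: if_splits)
    have k: "keys k \<subseteq> {1..n}" "comp_le n (lookup k) (lookup l)"
      using IH[OF lE l(2)] by auto
    moreover have "k \<noteq> m" using antisym[OF lE(1)] k lE by blast
    ultimately show ?thesis
      using comp_le_trans keysE(2)[OF lE(1)] by blast
  qed
  have "keys k \<subseteq> {1..n} \<and> comp_le n (lookup k) (lookup m)" if "k \<in> keys (Y_op n i (mon m))" for k
  proof -
    have "k \<in> keys E \<or> k \<in> keys (Y_op n i R)"
      using that by (auto simp: YE in_keys_iff lookup_minus)
    then show ?thesis using keysE keysR by blast
  qed
  moreover have "m \<notin> keys (Y_op n i R)" using keysR by blast
  ultimately show ?case
    using Em by (auto simp: YE lookup_minus in_keys_iff)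
qed

text \<open>At a monomial of f of maximal rank no other monomial of f contributes to Y_i f, so the
  diagonal entry of Y_i there is the eigenvalue. The choice of the monomial does not depend on
  i.\<close>

lemma eigenvalue_in_spectrum:
  assumes n: "1 \<le> n" and keys: "\<And>m. m \<in> keys f \<Longrightarrow> keys m \<subseteq> {1..n}"
    and Y: "\<And>i. i \<in> {1..n} \<Longrightarrow> Y_op n i f = Const (y i) * f" and "f \<noteq> 0"
  obtains m where "m \<in> keys f" "\<And>i. i \<in> {1..n} \<Longrightarrow> y i = eta_bar n (lookup m) i"
proof -
  define d where "d = (\<Sum>m\<in>keys f. \<Sum>j=1..n. lookup m j)"
  have d: "(\<Sum>j=1..n. lookup m j) \<le> d" if "m \<in> keys f" for m
    unfolding d_def using that by (intro member_le_sum) auto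
  have "keys f \<noteq> {}" using \<open>f \<noteq> 0\<close> by (metis keys_eq_empty)
  then have "Max ((\<lambda>m. comp_rank n d (lookup m)) ` keys f) \<in> (\<lambda>m. comp_rank n d (lookup m)) ` keys f"
    by (intro Max_in) auto
  then obtain m where m: "m \<in> keys f"
    and "comp_rank n d (lookup m) = Max ((\<lambda>m. comp_rank n d (lookup m)) ` keys f)"
    by auto
  then have max: "comp_rank n d (lookup k) \<le> comp_rank n d (lookup m)" if "k \<in> keys f" for k
    using that by simp
  have "y i = eta_bar n (lookup m) i" if i: "i \<in> {1..n}" for i
  proof -
    have "lookup (Y_op n i f) m = lookup f m * lookup (Y_op n i (mon m)) m"
    proof (rule lookup_op[OF Y_op_add Y_op_Const])
      fix k assume k: "k \<in> keys f" "k \<noteq> m"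
      show "m \<notin> keys (Y_op n i (mon k))"
      proof
        assume "m \<in> keys (Y_op n i (mon k))"
        then have le: "comp_le n (lookup m) (lookup k)"
          using Y_op_mon_triangular[OF n i keys[OF k(1)]] by blast
        have "lookup m j = lookup k j" if "j \<in> {1..n}" for j
          using comp_le_rank[OF le d[OF k(1)] max[OF k(1)] that] .
        then have "k = m"
          using expo_eqI[OF keys[OF k(1)], of "lookup m"] expo_lookup[OF keys[OF m]] by simp
        with k show False by simp
      qed
    qed
    then have "y i * lookup f m = lookup f m * eta_bar n (lookup m) i"
      using Y_op_mon_triangular[OF n i keys[OF m]] Y[OF i] by simp
    then show ?thesis using m by (simp add: in_keys_iff)
  qed
  with m show thesis by (rule that)
qed

lemma eta_bar_determines:
  assumes "\<And>i. i \<in> {1..n} \<Longrightarrow> eta_bar n \<eta> i = eta_bar n \<nu> i" "i \<in> {1..n}"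
  shows "\<eta> i = \<nu> i"
  using assms(1)[OF assms(2)] by (simp add: eta_bar_eq_iff)

text \<open>Subtracting the right multiple of E removes z^\<eta>. A nonzero remainder would have to
  contain z^\<eta> again, because a spectral vector determines its composition.\<close>

lemma eigenfunction_unique:
  assumes n: "1 \<le> n" and E: "is_macd n \<eta> E" and keys: "\<And>m. m \<in> keys f \<Longrightarrow> keys m \<subseteq> {1..n}"
    and Y: "\<And>i. i \<in> {1..n} \<Longrightarrow> Y_op n i f = Const (eta_bar n \<eta> i) * f"
  shows "f = Const (lookup f (expo n \<eta>)) * E"
proof (rule ccontr)
  assume ne: "f \<noteq> Const (lookup f (expo n \<eta>)) * E"
  define g where "g = f - Const (lookup f (expo n \<eta>)) * E"
  have keysg: "keys m \<subseteq> {1..n}" if "m \<in> keys g" for m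
  proof -
    have "m \<in> keys f \<or> m \<in> keys E"
      using that by (auto simp: g_def in_keys_iff lookup_minus)
    then show ?thesis using keys E by (auto simp: is_macd_def)
  qed
  moreover have "Y_op n i g = Const (eta_bar n \<eta> i) * g" if "i \<in> {1..n}" for i
    using Y[OF that] E that
    by (simp add: g_def Y_op_diff Y_op_Const is_macd_def right_diff_distrib mult.left_commute)
  ultimately obtain m where m: "m \<in> keys g" "\<And>i. i \<in> {1..n} \<Longrightarrow> eta_bar n \<eta> i = eta_bar n (lookup m) i"
    by (rule eigenvalue_in_spectrum[OF n]) (use ne in \<open>auto simp: g_def\<close>)
  then have "lookup m i = \<eta> i" if "i \<in> {1..n}" for i
    using eta_bar_determines[of n \<eta> "lookup m" i] that by simp
  then have "m = expo n \<eta>" using keysg[OF m(1)] by (intro expo_eqI) auto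
  moreover have "lookup g (expo n \<eta>) = 0"
    using E by (simp add: g_def is_macd_def lookup_minus)
  ultimately show False using m(1) by (simp add: in_keys_iff)
qed

section \<open>From \<open>comp_le\<close> to the order of the definition\<close>

lemma sorted_comp_antimono:
  assumes "1 \<le> i" "i \<le> j" "j \<le> n"
  shows "sorted_comp n \<eta> j \<le> sorted_comp n \<eta> i"
proof -
  let ?xs = "sort (map \<eta> [1..<n+1])"
  have "rev ?xs ! (j - 1) \<le> rev ?xs ! (i - 1)"
    using assms by (simp add: rev_nth) (rule sorted_nth_mono, auto)
  then show ?thesis by (simp add: sorted_comp_def)
qed

lemma sum_sorted_comp:
  fixes g :: "nat \<Rightarrow> nat"
  shows "(\<Sum>i=1..n. g (sorted_comp n \<eta> i)) = (\<Sum>i=1..n. g (\<eta> i))"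
proof -
  let ?xs = "rev (sort (map \<eta> [1..<n+1]))"
  have "(\<Sum>i=1..n. g (sorted_comp n \<eta> i)) = (\<Sum>i<n. g (?xs ! i))"
    unfolding sorted_comp_def
    by (rule sum.reindex_bij_witness[of _ "\<lambda>i. i + 1" "\<lambda>i. i - 1"]) auto
  also have "\<dots> = sum_list (map g ?xs)"
    by (simp add: sum_list_sum_nth atLeast0LessThan)
  also have "\<dots> = sum_mset (image_mset g (mset ?xs))"
    by (metis mset_map sum_mset_sum_list)
  also have "mset ?xs = mset (map \<eta> [1..<n+1])"
    by simp
  also have "sum_mset (image_mset g (mset (map \<eta> [1..<n+1]))) = sum_list (map (\<lambda>i. g (\<eta> i)) [1..<n+1])"
    by (metis (no_types, lifting) list.map_comp comp_def map_eq_conv mset_map sum_mset_sum_list)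
  also have "\<dots> = (\<Sum>i=1..n. g (\<eta> i))"
    by (simp only: interv_sum_list_conv_sum_set_nat set_upt atLeastLessThanSuc_atLeastAtMost Suc_eq_plus1[symmetric])
  finally show ?thesis .
qed

text \<open>The sum of the p largest parts is at most pm plus the total excess of all parts over m,
  with equality if m is the p-th largest part. Taking this m for \<eta> turns a comparison of
  heights into dominance.\<close>

lemma sorted_comp_prefix_le:
  assumes "\<And>k. hgt n \<nu> 0 k \<le> hgt n \<eta> 0 k" and p: "1 \<le> p" "p \<le> n"
  shows "(\<Sum>i=1..p. sorted_comp n \<nu> i) \<le> (\<Sum>i=1..p. sorted_comp n \<eta> i)"
proof -
  define m where "m = sorted_comp n \<eta> p"
  have h: "hgt n \<eta> 0 m = (\<Sum>i=1..n. sorted_comp n \<eta> i - m)" for \<eta>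
    using sum_sorted_comp[of "\<lambda>x. x - m" n \<eta>] by (simp add: hgt_def)
  have split: "(\<Sum>i=1..n. g i) = (\<Sum>i=1..p. g i) + (\<Sum>i=p+1..n. g i)" for g :: "nat \<Rightarrow> nat"
    using p sum.ub_add_nat[of 1 p g "n - p"] by simp
  have "(\<Sum>i=1..p. sorted_comp n \<nu> i) \<le> (\<Sum>i=1..p. m + (sorted_comp n \<nu> i - m))"
    by (rule sum_mono) simp
  also have "\<dots> \<le> p * m + hgt n \<nu> 0 m"
    unfolding h split by (simp add: sum.distrib)
  also have "\<dots> \<le> p * m + hgt n \<eta> 0 m"
    using assms(1) by simp
  also have "\<dots> = (\<Sum>i=1..p. m + (sorted_comp n \<eta> i - m))"
  proof -
    have "(\<Sum>i=p+1..n. sorted_comp n \<eta> i - m) = 0"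
      using p sorted_comp_antimono[of p _ n \<eta>] by (intro sum.neutral) (auto simp: m_def)
    then show ?thesis unfolding h split by (simp add: sum.distrib)
  qed
  also have "\<dots> = (\<Sum>i=1..p. sorted_comp n \<eta> i)"
    using p sorted_comp_antimono[of _ p n \<eta>] by (intro sum.cong) (auto simp: m_def)
  finally show ?thesis .
qed

lemma hgt_eq_sum: "p \<le> n \<Longrightarrow> hgt n \<eta> p k = hgt n \<eta> 0 k + (\<Sum>j=1..p. if k \<le> \<eta> j then 1 else 0)"
proof (induction p)
  case (Suc p)
  then show ?case using hgt_Suc[of p n \<eta> k] by simp
qed simp

text \<open>The heights at p and at 0 differ by the number of parts among the first p that reach k;
  summation over k = 1, ..., d restores these parts.\<close>

lemma prefix_sum_le:
  assumes le: "\<And>k. hgt n \<nu> p k \<le> hgt n \<eta> p k" and eq: "\<And>k. hgt n \<nu> 0 k = hgt n \<eta> 0 k" and p: "p \<le> n"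
  shows "(\<Sum>j=1..p. \<nu> j) \<le> (\<Sum>j=1..p. \<eta> j)"
proof -
  define d where "d = (\<Sum>j=1..p. \<nu> j) + (\<Sum>j=1..p. \<eta> j)"
  have layers: "(\<Sum>j=1..p. \<eta> j) = (\<Sum>k=1..d. \<Sum>j=1..p. if k \<le> \<eta> j then 1 else 0)"
    if "\<And>j. j \<in> {1..p} \<Longrightarrow> \<eta> j \<le> d" for \<eta> :: "nat \<Rightarrow> nat"
  proof -
    have "\<eta> j = (\<Sum>k=1..d. if k \<le> \<eta> j then 1 else 0)" if "j \<in> {1..p}" for j
    proof -
      have "{k\<in>{1..d}. k \<le> \<eta> j} = {1..\<eta> j}"
        using \<open>\<And>j. j \<in> {1..p} \<Longrightarrow> \<eta> j \<le> d\<close>[OF that] by auto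
      then show ?thesis by (simp flip: sum.inter_filter)
    qed
    then have "(\<Sum>j=1..p. \<eta> j) = (\<Sum>j=1..p. \<Sum>k=1..d. if k \<le> \<eta> j then 1 else 0)"
      by (rule sum.cong[OF refl])
    then show ?thesis by (simp only: sum.swap[of _ "{1..p}"])
  qed
  have "\<nu> j \<le> d" "\<eta> j \<le> d" if "j \<in> {1..p}" for j
    using member_le_sum[of j "{1..p}" \<nu>] member_le_sum[of j "{1..p}" \<eta>] that by (auto simp: d_def)
  then show ?thesis
    using hgt_eq_sum[OF p] eq le by (simp only: layers) (rule sum_mono, metis add_le_cancel_left)
qed

lemma comp_le_imp_prec:
  assumes le: "comp_le n \<nu> \<eta>" and ne: "\<not> comp_eq n \<nu> \<eta>"
  shows "comp_prec n \<nu> \<eta>"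
proof (cases "comp_eq n (sorted_comp n \<nu>) (sorted_comp n \<eta>)")
  case False
  have "(\<Sum>i=1..p. sorted_comp n \<nu> i) \<le> (\<Sum>i=1..p. sorted_comp n \<eta> i)" if "p \<in> {1..n}" for p
    by (rule sorted_comp_prefix_le) (use le that in \<open>auto simp: comp_le_def\<close>)
  then have "(\<Sum>i=1..p. int (sorted_comp n \<eta> i) - int (sorted_comp n \<nu> i)) \<ge> 0" if "p \<in> {1..n}" for p
    using that by (simp add: sum_subtractf flip: of_nat_sum)
  then show ?thesis
    using le False by (auto simp: comp_prec_def dom_less_def comp_le_def)
next
  case True
  have h: "hgt n \<eta> 0 k = (\<Sum>i=1..n. sorted_comp n \<eta> i - k)" for \<eta> k
    using sum_sorted_comp[of "\<lambda>x. x - k" n \<eta>] by (simp add: hgt_def)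
  \<comment> \<open>Heights at p = 0 depend only on the multiset of parts.\<close>
  have "hgt n \<nu> 0 k = hgt n \<eta> 0 k" for k
    unfolding h by (rule sum.cong) (use True in \<open>auto simp: comp_eq_def\<close>)
  then have "(\<Sum>j=1..p. \<nu> j) \<le> (\<Sum>j=1..p. \<eta> j)" if "p \<in> {1..n}" for p
    by (intro prefix_sum_le[of n]) (use le that in \<open>auto simp: comp_le_def\<close>)
  then have "(\<Sum>i=1..p. int (\<eta> i) - int (\<nu> i)) \<ge> 0" if "p \<in> {1..n}" for p
    using that by (simp add: sum_subtractf flip: of_nat_sum)
  then show ?thesis
    using le True ne by (auto simp: comp_prec_def dom_less_def comp_le_def)
qed

lemma comp_prec_irrefl:
  assumes "\<And>j. j \<in> {1..n} \<Longrightarrow> \<nu> j = \<eta> j"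
  shows "\<not> comp_prec n \<nu> \<eta>"
proof -
  have "map \<nu> [1..<n+1] = map \<eta> [1..<n+1]" using assms by auto
  then have "sorted_comp n \<nu> = sorted_comp n \<eta>" by (simp only: sorted_comp_def[abs_def])
  then show ?thesis using assms by (simp add: comp_prec_def dom_less_def comp_eq_def)
qed

lemma is_macd_imp_nonsym:
  assumes E: "is_macd n \<eta> E"
  shows "is_nonsym_macdonald n \<eta> E"
proof -
  have "keys m \<subseteq> {1..n} \<and> comp_prec n (lookup m) \<eta>" if "m \<in> keys (E - zpow n \<eta>)" for m
  proof -
    have ne: "m \<noteq> expo n \<eta>" and mE: "m \<in> keys E"
      using that E by (auto simp: is_macd_def zpow_eq_mon in_keys_iff lookup_minus lookup_mon split: if_splits)
    then have m: "keys m \<subseteq> {1..n}" "comp_le n (lookup m) \<eta>"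
      using E by (auto simp: is_macd_def)
    have "\<not> comp_eq n (lookup m) \<eta>"
    proof
      assume "comp_eq n (lookup m) \<eta>"
      then have "m = expo n \<eta>" by (intro expo_eqI m) (simp add: comp_eq_def)
      with ne show False by simp
    qed
    then show ?thesis using m comp_le_imp_prec by blast
  qed
  then show ?thesis
    using E by (auto simp: is_nonsym_macdonald_def is_macd_def)
qed

text \<open>Irreflexivity of \<prec> makes the coefficient of z^\<eta> in F equal to 1; uniqueness
  of joint eigenfunctions does the rest.\<close>

lemma nonsym_eq_macd:
  assumes n: "1 \<le> n" and E: "is_macd n \<eta> E" and F: "is_nonsym_macdonald n \<eta> F"
  shows "F = E"
proof -
  have keys: "keys m \<subseteq> {1..n}" if "m \<in> keys F" for m
  proof (cases "m \<in> keys (F - zpow n \<eta>)")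
    case True
    then show ?thesis using F by (auto simp: is_nonsym_macdonald_def)
  next
    case False
    then have "m = expo n \<eta>"
      using that by (auto simp: zpow_eq_mon in_keys_iff lookup_minus lookup_mon split: if_splits)
    then show ?thesis using keys_expo by simp
  qed
  have "\<not> comp_prec n (lookup (expo n \<eta>)) \<eta>"
    by (rule comp_prec_irrefl) (simp add: lookup_expo)
  then have "expo n \<eta> \<notin> keys (F - zpow n \<eta>)"
    using F by (auto simp: is_nonsym_macdonald_def)
  then have "lookup F (expo n \<eta>) = 1"
    by (simp add: zpow_eq_mon in_keys_iff lookup_minus lookup_mon)
  then show ?thesis
    using eigenfunction_unique[OF n E, of F] keys F
    by (simp add: is_nonsym_macdonald_def Const_simps)
qed

lemma is_macd_nonsym_macdonald:
  assumes "1 \<le> n"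
  shows "is_macd n \<eta> (nonsym_macdonald n \<eta>)"
proof -
  obtain E where E: "is_macd n \<eta> E" using is_macd_exists[OF assms] by blast
  have "nonsym_macdonald n \<eta> = E"
    unfolding nonsym_macdonald_def
    using is_macd_imp_nonsym[OF E] nonsym_eq_macd[OF assms E] by (rule the_equality)
  with E show ?thesis by simp
qed

lemma nonsym_macdonald_eqI: "1 \<le> n \<Longrightarrow> is_macd n \<eta> E \<Longrightarrow> nonsym_macdonald n \<eta> = E"
  using nonsym_eq_macd is_macd_imp_nonsym is_macd_nonsym_macdonald by blast

lemma nonsym_macdonald_cong:
  assumes "1 \<le> n" "\<And>j. j \<in> {1..n} \<Longrightarrow> \<eta> j = \<eta>' j"
  shows "nonsym_macdonald n \<eta> = nonsym_macdonald n \<eta>'"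
  using nonsym_macdonald_eqI[OF assms(1)] is_macd_nonsym_macdonald[OF assms(1)]
    is_macd_cong[of n \<eta> \<eta>', OF assms(2)] by metis

section \<open>Action of the operators on nonsymmetric Macdonald polynomials\<close>

lemma T_op_macdonald_less:
  assumes i: "1 \<le> i" "i < n" and lt: "\<eta> i < \<eta> (Suc i)"
  shows "T_op i (nonsym_macdonald n \<eta>) =
    Const (a_hat (eta_bar n \<eta> i) (eta_bar n \<eta> (Suc i))) * nonsym_macdonald n \<eta> +
    Const tvar * nonsym_macdonald n (swp i \<eta>)"
proof -
  have n: "1 \<le> n" using i by simp
  show ?thesis
    using nonsym_macdonald_eqI[OF n is_macd_swp[OF i lt is_macd_nonsym_macdonald[OF n]]]
    by (simp add: Const_tvar_inverse flip: mult.assoc)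
qed

text \<open>The spectral vector with entries i and i+1 exchanged would belong to a composition that
  again has equal parts there, so both the ratio of the two entries and its inverse would be t.
  Hence the intertwiner annihilates E_\<eta>.\<close>

lemma T_op_macdonald_eq:
  assumes i: "1 \<le> i" "i < n" and eq: "\<eta> i = \<eta> (Suc i)"
  shows "T_op i (nonsym_macdonald n \<eta>) =
    Const (a_hat (eta_bar n \<eta> i) (eta_bar n \<eta> (Suc i))) * nonsym_macdonald n \<eta>"
proof -
  have n: "1 \<le> n" using i by simp
  define E where "E = nonsym_macdonald n \<eta>"
  have E: "is_macd n \<eta> E" using is_macd_nonsym_macdonald[OF n] by (simp add: E_def)
  define g where "g = T_op i E - Const (a_hat (eta_bar n \<eta> i) (eta_bar n \<eta> (Suc i))) * E"
  have "g = 0"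
  proof (rule ccontr)
    assume "g \<noteq> 0"
    have keys: "keys k \<subseteq> {1..n}" if "k \<in> keys g" for k
    proof -
      have "k \<in> keys (T_op i E) \<or> k \<in> keys E"
        using that by (auto simp: g_def in_keys_iff lookup_minus)
      then show ?thesis
      proof
        assume "k \<in> keys (T_op i E)"
        then obtain m where m: "m \<in> keys E" "k \<in> keys (T_op i (mon m))"
          by (rule keys_op_subset[OF T_op_add T_op_Const])
        have "between i (lookup k) (lookup m)" by (rule keys_T_op_mon[OF m(2)])
        moreover have "keys m \<subseteq> {1..n}" using E m by (auto simp: is_macd_def)
        then have "lookup m j = 0" if "j \<notin> {1..n}" for j
          using that by (auto simp: in_keys_iff)
        ultimately have "lookup k j = 0" if "j \<notin> {1..n}" for j
          using that i by (auto simp: between_def)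
        then show ?thesis by (metis in_keys_iff subsetI)
      qed (use E in \<open>auto simp: is_macd_def\<close>)
    qed
    have Yg: "Y_op n j g = Const (swp i (eta_bar n \<eta>) j) * g" if "j \<in> {1..n}" for j
      unfolding g_def
      by (rule intertwiner_eigen[OF i]) (use E that i eta_bar_inj[of i n "Suc i" \<eta>] in \<open>auto simp: is_macd_def\<close>)
    obtain m where m: "\<And>j. j \<in> {1..n} \<Longrightarrow> swp i (eta_bar n \<eta>) j = eta_bar n (lookup m) j"
      using eigenvalue_in_spectrum[OF n keys Yg \<open>g \<noteq> 0\<close>] by metis
    have "lookup m i = \<eta> (Suc i)" "lookup m (Suc i) = \<eta> i"
      using m[of i] m[of "Suc i"] i by (auto simp: eta_bar_eq_iff)
    then have "eta_bar n (lookup m) i = tvar * eta_bar n (lookup m) (Suc i)"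
      using eta_bar_equal_parts[OF i, of "lookup m"] eq by simp
    then have "eta_bar n \<eta> (Suc i) = tvar * (tvar * eta_bar n \<eta> (Suc i))"
      using m[of i] m[of "Suc i"] i eta_bar_equal_parts[OF i eq] by simp
    then have "tvar ^ 2 = 1" by (simp add: power2_eq_square flip: mult.assoc)
    then show False using qvar_tvar_power_eq_iff[of 0 2 0 0] by simp
  qed
  then show ?thesis by (simp add: g_def E_def)
qed

lemma a_hat_sum: "x \<noteq> y \<Longrightarrow> a_hat x y + a_hat y x = tvar - 1"
proof -
  assume "x \<noteq> y"
  then have "a_hat x y + a_hat y x = ((tvar - 1) * x - (tvar - 1) * y) / (x - y)"
    by (simp add: a_hat_def divide_simps) (simp add: algebra_simps)
  also have "\<dots> = (tvar - 1) * (x - y) / (x - y)" by (simp add: algebra_simps)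
  finally show ?thesis using \<open>x \<noteq> y\<close> by simp
qed

text \<open>The scalar by which two successive intertwiners act, factored; it supplies the
  coefficient of the swapped polynomial in the descending case.\<close>

lemma a_hat_b_hat: "x \<noteq> y \<Longrightarrow> a_hat x y * a_hat y x + tvar = b_hat x y * b_hat y x"
proof -
  assume ne: "x \<noteq> y"
  define D where "D = x - y"
  have D: "D \<noteq> 0" "y - x = - D" "x = y + D" using ne by (simp_all add: D_def)
  have "a_hat x y * a_hat y x + tvar = (tvar * D^2 - (tvar - 1)^2 * x * y) / D^2"
    using D(1) by (simp add: a_hat_def D(2) D_def[symmetric] power2_eq_square diff_divide_distrib)
  also have "tvar * D^2 - (tvar - 1)^2 * x * y = - ((x - tvar * y) * (y - tvar * x))"
    unfolding D_def by algebra
  also have "- ((x - tvar * y) * (y - tvar * x)) / D^2 = b_hat x y * b_hat y x"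
    using D(1) by (simp add: b_hat_def D(2) D_def[symmetric] power2_eq_square)
  finally show ?thesis .
qed

text \<open>Apply T_i to the ascending formula for the swapped composition and eliminate the square
  of T_i.\<close>

lemma T_op_macdonald_greater:
  assumes i: "1 \<le> i" "i < n" and gt: "\<eta> (Suc i) < \<eta> i"
  shows "T_op i (nonsym_macdonald n \<eta>) =
    Const (a_hat (eta_bar n \<eta> i) (eta_bar n \<eta> (Suc i))) * nonsym_macdonald n \<eta> +
    Const (inverse tvar * (b_hat (eta_bar n \<eta> i) (eta_bar n \<eta> (Suc i)) * b_hat (eta_bar n \<eta> (Suc i)) (eta_bar n \<eta> i))) *
      nonsym_macdonald n (swp i \<eta>)"
proof -
  have n: "1 \<le> n" using i by simp
  define x y where "x = eta_bar n \<eta> i" and "y = eta_bar n \<eta> (Suc i)"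
  define E F where "E = nonsym_macdonald n \<eta>" and "F = nonsym_macdonald n (swp i \<eta>)"
  have xy: "x \<noteq> y" unfolding x_def y_def by (rule eta_bar_inj) (use i in auto)
  have "T_op i F = Const (a_hat y x) * F + Const tvar * E"
    using T_op_macdonald_less[OF i, of "swp i \<eta>"] gt eta_bar_swp[OF i, of \<eta> i] eta_bar_swp[OF i, of \<eta> "Suc i"] i
    by (simp add: E_def F_def x_def y_def)
  then have tE: "Const tvar * E = T_op i F - Const (a_hat y x) * F" by simp
  have "Const tvar * T_op i E = T_op i (T_op i F) - Const (a_hat y x) * T_op i F"
    by (simp only: tE T_op_diff T_op_Const flip: T_op_Const[of i tvar])
  also have "\<dots> = Const (a_hat x y) * T_op i F + Const tvar * F"
  proof -
    have "Const (a_hat x y) = Const tvar - 1 - Const (a_hat y x)"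
    proof -
      have "a_hat x y = tvar - 1 - a_hat y x" using a_hat_sum[OF xy] by (simp add: eq_diff_eq)
      then show ?thesis by (simp add: Const_simps)
    qed
    then show ?thesis by (simp only: T_op_quadratic) (simp add: algebra_simps)
  qed
  also have "\<dots> = Const (a_hat x y) * (Const (a_hat y x) * F + Const tvar * E) + Const tvar * F"
    using tE by simp
  also have "\<dots> = Const (b_hat x y * b_hat y x) * F + Const tvar * (Const (a_hat x y) * E)"
    unfolding a_hat_b_hat[OF xy, symmetric] by (simp add: Const_simps algebra_simps)
  finally have "Const (inverse tvar) * (Const tvar * T_op i E) = Const (inverse tvar) *
    (Const (b_hat x y * b_hat y x) * F + Const tvar * (Const (a_hat x y) * E))" by simp
  then have "T_op i E = Const (inverse tvar) * (Const (b_hat x y * b_hat y x) * F) + Const (a_hat x y) * E"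
    by (simp add: distrib_left Const_inverse_cancel)
  then show ?thesis
    by (simp add: E_def F_def x_def y_def Const_simps add.commute mult.assoc)
qed

lemma Phi_macdonald:
  assumes "1 \<le> n"
  shows "Phi n (nonsym_macdonald n \<eta>) = Const (qvar ^ \<eta> 1) * nonsym_macdonald n (phi n \<eta>)"
  using nonsym_macdonald_eqI[OF assms is_macd_phi[OF assms is_macd_nonsym_macdonald[OF assms]]]
    Const_inverse_cancel[of "inverse (qvar ^ \<eta> 1)"] by simp

lemma leg'_add_const: "leg' n (\<lambda>i. \<eta> i + c) i = leg' n \<eta> i"
  by (simp add: leg'_eq_card ranks_before_def)

text \<open>Adding 1 to all parts preserves ranks and multiplies every eigenvalue by q, which is
  also the effect of moving e_n past Y_i.\<close>

lemma e_top_macdonald: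
  assumes n: "1 \<le> n"
  shows "e_top n * nonsym_macdonald n \<eta> = nonsym_macdonald n (\<lambda>i. \<eta> i + 1)"
proof -
  define E where "E = nonsym_macdonald n \<eta>"
  have E: "is_macd n \<eta> E" using is_macd_nonsym_macdonald[OF n] by (simp add: E_def)
  have top: "e_top n = mon (expo n (\<lambda>_. 1))"
    unfolding zpow_eq_mon[symmetric] by (simp add: e_top_def zpow_def)
  have mult: "e_top n * mon m = mon (expo n (\<lambda>i. lookup m i + 1))" if "keys m \<subseteq> {1..n}" for m
    unfolding top mon_add[symmetric]
    by (rule arg_cong[of _ _ mon], rule expo_eqI)
      (use that keys_add[of "expo n (\<lambda>_. 1)" m] keys_expo[of n "\<lambda>_. 1"] in \<open>auto simp: lookup_add lookup_expo\<close>)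
  have "e_top n * E = Const (lookup (e_top n * E) (expo n (\<lambda>i. \<eta> i + 1))) * nonsym_macdonald n (\<lambda>i. \<eta> i + 1)"
  proof (rule eigenfunction_unique[OF n is_macd_nonsym_macdonald[OF n]])
    fix m assume "m \<in> keys (e_top n * E)"
    then have "m \<in> {a + b |a b. a \<in> keys (e_top n) \<and> b \<in> keys E}"
      using keys_mult by blast
    then obtain a b where m: "m = a + b" "a \<in> keys (e_top n)" "b \<in> keys E" by blast
    then have "keys a \<subseteq> {1..n}" "keys b \<subseteq> {1..n}"
      using E keys_expo[of n] by (auto simp: top in_keys_iff lookup_mon is_macd_def split: if_splits)
    then show "keys m \<subseteq> {1..n}" using m keys_add[of a b] by blast
  next
    fix i assume i: "i \<in> {1..n}"
    have "eta_bar n (\<lambda>i. \<eta> i + 1) i = qvar * eta_bar n \<eta> i"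
      by (simp only: eta_bar_def leg'_add_const power_add power_one_right) (simp only: mult_ac)
    then show "Y_op n i (e_top n * E) = Const (eta_bar n (\<lambda>i. \<eta> i + 1) i) * (e_top n * E)"
      using Y_e_top[of i n E] E i by (simp add: is_macd_def Const_simps mult_ac)
  qed
  moreover have "lookup (e_top n * E) (expo n (\<lambda>i. \<eta> i + 1)) = 1"
  proof -
    have "lookup (e_top n * E) (expo n (\<lambda>i. \<eta> i + 1))
        = lookup E (expo n \<eta>) * lookup (e_top n * mon (expo n \<eta>)) (expo n (\<lambda>i. \<eta> i + 1))"
    proof (rule lookup_op)
      fix k assume k: "k \<in> keys E" "k \<noteq> expo n \<eta>"
      have kn: "keys k \<subseteq> {1..n}" using E k by (auto simp: is_macd_def)
      show "expo n (\<lambda>i. \<eta> i + 1) \<notin> keys (e_top n * mon k)"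
      proof
        assume "expo n (\<lambda>i. \<eta> i + 1) \<in> keys (e_top n * mon k)"
        then have eq: "expo n (\<lambda>i. \<eta> i + 1) = expo n (\<lambda>i. lookup k i + 1)"
          by (auto simp: mult[OF kn] in_keys_iff lookup_mon split: if_splits)
        have "lookup k j = \<eta> j" if "j \<in> {1..n}" for j
          using arg_cong[OF eq, of "\<lambda>m. lookup m j"] that by (simp add: lookup_expo)
        then show False using k expo_eqI[OF kn] by blast
      qed
    qed (simp_all add: distrib_left mult.left_commute)
    moreover have "expo n (\<lambda>i. lookup (expo n \<eta>) i + 1) = expo n (\<lambda>i. \<eta> i + 1)"
      by (rule expo_cong) (simp add: lookup_expo)
    ultimately show ?thesis
      using E by (simp add: mult keys_expo lookup_mon is_macd_def)
  qed
  ultimately show ?thesis by (simp add: E_def Const_simps)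
qed

section \<open>The normalizing constants\<close>

text \<open>The constant before inversion of the parameters; \<open>qt_inverted_d'\<close> relates
  it to the one in the statement.\<close>

definition d' :: "nat \<Rightarrow> (nat \<Rightarrow> nat) \<Rightarrow> qt" where
  "d' n \<nu> = (\<Prod>i=1..n. \<Prod>j=1..\<nu> i. 1 - qvar ^ (arm \<nu> i j + 1) * tvar ^ leg n \<nu> i j)"

text \<open>The contribution of a single row k to a leg. Legs thus become sums that can be split at
  two positions or rotated.\<close>

definition in_leg :: "(nat \<Rightarrow> nat) \<Rightarrow> nat \<Rightarrow> nat \<Rightarrow> nat \<Rightarrow> bool" where
  "in_leg \<nu> i j k \<longleftrightarrow> i < k \<and> j \<le> \<nu> k \<and> \<nu> k \<le> \<nu> i \<or> k < i \<and> j \<le> \<nu> k + 1 \<and> \<nu> k + 1 \<le> \<nu> i"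

lemma card_eq_sum_of_bool: "finite A \<Longrightarrow> card {k\<in>A. P k} = (\<Sum>k\<in>A. of_bool (P k))"
  by (simp add: of_bool_def flip: sum.inter_filter)

lemma leg_eq_sum: "leg n \<nu> i j = (\<Sum>k=1..n. of_bool (in_leg \<nu> i j k))"
proof -
  have "leg n \<nu> i j = card ({k\<in>{1..n}. k > i \<and> j \<le> \<nu> k \<and> \<nu> k \<le> \<nu> i}
      \<union> {k\<in>{1..n}. k < i \<and> j \<le> \<nu> k + 1 \<and> \<nu> k + 1 \<le> \<nu> i})"
    unfolding leg_def by (rule card_Un_disjoint[symmetric]) auto
  also have "{k\<in>{1..n}. k > i \<and> j \<le> \<nu> k \<and> \<nu> k \<le> \<nu> i}
      \<union> {k\<in>{1..n}. k < i \<and> j \<le> \<nu> k + 1 \<and> \<nu> k + 1 \<le> \<nu> i} = {k\<in>{1..n}. in_leg \<nu> i j k}"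
    by (auto simp: in_leg_def)
  finally show ?thesis by (simp only: card_eq_sum_of_bool[OF finite_atLeastAtMost])
qed

lemma leg'_eq_sum: "leg' n \<nu> i = (\<Sum>k=1..n. of_bool (ranks_before \<nu> k i))"
  unfolding leg'_eq_card by (rule card_eq_sum_of_bool) simp

lemma qvar_tvar_power_ne_1: "k > 0 \<Longrightarrow> qvar ^ k * tvar ^ l \<noteq> 1"
  using qvar_tvar_power_eq_iff[of k l 0 0] by simp

lemma d'_nz [simp]: "d' n \<nu> \<noteq> 0"
proof -
  have "1 - qvar ^ (a + 1) * tvar ^ l \<noteq> 0" for a l
    using qvar_tvar_power_ne_1[of "a + 1" l] by simp
  then show ?thesis unfolding d'_def by simp
qed

lemma qt_inverted_d': "qt_inverted (d' n \<nu>) = d'_inverted n \<nu>"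
proof -
  note h = ring_hom_qt_inverted
  have "qt_inverted (1 - qvar ^ (a + 1) * tvar ^ l) = 1 - qvar powi (- int a - 1) * tvar powi (- int l)" for a l
  proof -
    have "qvar powi (- int a - 1) = inverse qvar ^ (a + 1)"
    proof -
      have "- int a - 1 = - int (a + 1)" by simp
      then show ?thesis by (simp only: power_int_minus power_int_of_nat power_inverse)
    qed
    moreover have "tvar powi (- int l) = inverse tvar ^ l"
      by (simp only: power_int_minus power_int_of_nat power_inverse)
    ultimately show ?thesis
      by (simp only: ring_hom_simps[OF h] qt_inverted_qvar qt_inverted_tvar)
  qed
  then show ?thesis
    by (simp only: d'_def d'_inverted_def ring_hom_prod[OF h])
qed

text \<open>Exchanging the two rows keeps all arms, and all legs but one: when the longer row comes
  in front, its cell in column \<nu>_k + 1 loses the shorter row from its leg. Up to t, the quotient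
  of the old and new factors is b_hat at two spectral entries.\<close>

lemma d'_swp:
  assumes k: "1 \<le> k" "k < n" and lt: "\<nu> k < \<nu> (Suc k)"
  shows "d' n (swp k \<nu>) * tvar = d' n \<nu> * b_hat (eta_bar n \<nu> (Suc k)) (eta_bar n \<nu> k)"
proof -
  define \<eta> where "\<eta> = swp k \<nu>"
  define a b where "a = \<nu> k" and "b = \<nu> (Suc k)"
  define R where "R \<nu> i = (\<Prod>j=1..\<nu> i. 1 - qvar ^ (arm \<nu> i j + 1) * tvar ^ leg n \<nu> i j)" for \<nu> i
  define B where "B = {1..n} - {k, Suc k}"
  have ab: "a < b" using lt by (simp add: a_def b_def)
  have \<eta>: "\<eta> k = b" "\<eta> (Suc k) = a" "\<And>j. j \<noteq> k \<Longrightarrow> j \<noteq> Suc k \<Longrightarrow> \<eta> j = \<nu> j"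
    by (simp_all add: \<eta>_def a_def b_def)
  have prod: "(\<Prod>i=1..n. g i) = (\<Prod>i\<in>B. g i) * (g k * g (Suc k))" for g :: "nat \<Rightarrow> qt"
  proof -
    have "{1..n} = insert k (insert (Suc k) B)" using k by (auto simp: B_def)
    then have "(\<Prod>i=1..n. g i) = (\<Prod>i\<in>insert k (insert (Suc k) B). g i)" by (rule arg_cong)
    also have "\<dots> = (\<Prod>i\<in>B. g i) * (g k * g (Suc k))"
      by (simp add: B_def mult_ac)
    finally show ?thesis .
  qed
  note sum2 = sum_two_positions[OF k, folded B_def]
  have other: "R \<eta> i = R \<nu> i" if "i \<in> B" for i
  proof -
    have i: "i \<noteq> k" "i \<noteq> Suc k" using that by (auto simp: B_def)
    have "leg n \<eta> i j = leg n \<nu> i j" for j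
    proof -
      have "(\<Sum>l\<in>B. of_bool (in_leg \<eta> i j l)) = (\<Sum>l\<in>B. of_bool (in_leg \<nu> i j l) :: nat)"
        by (rule sum.cong) (auto simp: in_leg_def \<eta> i B_def)
      moreover have "in_leg \<eta> i j k = in_leg \<nu> i j (Suc k)" "in_leg \<eta> i j (Suc k) = in_leg \<nu> i j k"
        using i by (auto simp: in_leg_def \<eta> a_def b_def)
      ultimately show ?thesis unfolding leg_eq_sum sum2 by simp
    qed
    then show ?thesis using i by (simp add: R_def arm_def \<eta>)
  qed
  have short: "R \<eta> (Suc k) = R \<nu> k"
  proof -
    have "leg n \<eta> (Suc k) j = leg n \<nu> k j" for j
    proof -
      have "(\<Sum>l\<in>B. of_bool (in_leg \<eta> (Suc k) j l)) = (\<Sum>l\<in>B. of_bool (in_leg \<nu> k j l) :: nat)"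
        by (rule sum.cong) (auto simp: in_leg_def \<eta> B_def a_def)
      moreover have "\<not> in_leg \<eta> (Suc k) j k" "\<not> in_leg \<eta> (Suc k) j (Suc k)"
          "\<not> in_leg \<nu> k j k" "\<not> in_leg \<nu> k j (Suc k)"
        using ab by (auto simp: in_leg_def \<eta> a_def b_def)
      ultimately show ?thesis unfolding leg_eq_sum sum2 by simp
    qed
    then show ?thesis by (simp add: R_def arm_def \<eta> a_def)
  qed
  define L where "L = leg n \<nu> (Suc k) (Suc a)"
  have long: "leg n \<nu> (Suc k) j = leg n \<eta> k j + of_bool (j = Suc a)" if "j \<le> b" for j
  proof -
    have "(\<Sum>l\<in>B. of_bool (in_leg \<eta> k j l)) = (\<Sum>l\<in>B. of_bool (in_leg \<nu> (Suc k) j l) :: nat)"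
      by (rule sum.cong) (auto simp: in_leg_def \<eta> B_def b_def)
    moreover have "\<not> in_leg \<eta> k j k" "\<not> in_leg \<nu> (Suc k) j (Suc k)"
      by (auto simp: in_leg_def)
    moreover have "in_leg \<eta> k j (Suc k) \<longleftrightarrow> j \<le> a" "in_leg \<nu> (Suc k) j k \<longleftrightarrow> j \<le> Suc a"
      using ab by (auto simp: in_leg_def \<eta> a_def b_def)
    ultimately show ?thesis unfolding leg_eq_sum sum2 by (auto simp: le_Suc_eq)
  qed
  have L: "L = Suc (leg n \<eta> k (Suc a))"
    using long[of "Suc a"] ab by (simp add: L_def)
  define P where "P = (\<Prod>j\<in>{1..b} - {Suc a}. 1 - qvar ^ (b - j + 1) * tvar ^ leg n \<eta> k j)"
  have "Suc a \<in> {1..b}" using ab by simp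
  then have rem: "(\<Prod>j=1..b. g j) = g (Suc a) * (\<Prod>j\<in>{1..b} - {Suc a}. g j)" for g :: "nat \<Rightarrow> qt"
    by (intro prod.remove) simp
  have ba: "b - Suc a + 1 = b - a" using ab by simp
  have R\<eta>: "R \<eta> k = (1 - qvar ^ (b - a) * tvar ^ (L - 1)) * P"
    unfolding R_def \<eta>(1) arm_def P_def rem ba by (simp add: L)
  have "(\<Prod>j\<in>{1..b} - {Suc a}. 1 - qvar ^ (b - j + 1) * tvar ^ leg n \<nu> (Suc k) j) = P"
    unfolding P_def by (rule prod.cong) (auto simp: long)
  then have R\<nu>: "R \<nu> (Suc k) = (1 - qvar ^ (b - a) * tvar ^ L) * P"
    unfolding R_def arm_def b_def[symmetric] rem ba by (simp add: L_def)
  \<comment> \<open>The leg of the exceptional cell is the difference of the two ranks, which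
    identifies its factor with a ratio of spectral entries.\<close>
  have "leg' n \<nu> k = leg' n \<nu> (Suc k) + L"
  proof -
    have "(\<Sum>l\<in>B. of_bool (ranks_before \<nu> l k) :: nat)
        = (\<Sum>l\<in>B. of_bool (ranks_before \<nu> l (Suc k)) + of_bool (in_leg \<nu> (Suc k) (Suc a) l))"
      by (rule sum.cong) (use ab in \<open>auto simp: in_leg_def ranks_before_def B_def a_def b_def\<close>)
    moreover have "\<not> ranks_before \<nu> k k" "ranks_before \<nu> (Suc k) k" "\<not> ranks_before \<nu> k (Suc k)"
        "\<not> ranks_before \<nu> (Suc k) (Suc k)" "in_leg \<nu> (Suc k) (Suc a) k" "\<not> in_leg \<nu> (Suc k) (Suc a) (Suc k)"
      using ab by (auto simp: in_leg_def ranks_before_def a_def b_def)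
    ultimately show ?thesis
      unfolding leg'_eq_sum L_def leg_eq_sum sum2 by (simp add: sum.distrib)
  qed
  then have y: "eta_bar n \<nu> (Suc k) = (qvar ^ (b - a) * tvar ^ L) * eta_bar n \<nu> k"
  proof -
    assume l: "leg' n \<nu> k = leg' n \<nu> (Suc k) + L"
    have "qvar ^ b = qvar ^ (b - a) * qvar ^ a"
      using ab by (simp flip: power_add)
    moreover have "tvar powi (- int (leg' n \<nu> (Suc k))) = tvar ^ L * tvar powi (- int (leg' n \<nu> k))"
      using power_int_add[of tvar "int L" "- int (leg' n \<nu> k)"] by (simp add: l)
    ultimately show ?thesis
      by (simp add: eta_bar_def a_def[symmetric] b_def[symmetric])
  qed
  define r where "r = qvar ^ (b - a) * tvar ^ L"
  have r1: "r \<noteq> 1" unfolding r_def using ab by (intro qvar_tvar_power_ne_1) simp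
  have "b_hat (eta_bar n \<nu> (Suc k)) (eta_bar n \<nu> k) = ((r - tvar) * eta_bar n \<nu> k) / ((r - 1) * eta_bar n \<nu> k)"
    unfolding b_hat_def y r_def by (simp add: algebra_simps)
  then have "b_hat (eta_bar n \<nu> (Suc k)) (eta_bar n \<nu> k) = (r - tvar) / (r - 1)" by simp
  then have b: "(1 - r) * b_hat (eta_bar n \<nu> (Suc k)) (eta_bar n \<nu> k) = tvar - r"
    using r1 by (simp add: field_simps)
  have rt: "(1 - qvar ^ (b - a) * tvar ^ (L - 1)) * tvar = tvar - r"
    by (simp add: r_def L algebra_simps)
  have "d' n \<eta> * tvar = (\<Prod>i\<in>B. R \<nu> i) * P * R \<nu> k * ((1 - qvar ^ (b - a) * tvar ^ (L - 1)) * tvar)"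
    unfolding d'_def R_def[symmetric] prod short R\<eta> using other by (simp add: mult_ac)
  also have "\<dots> = (\<Prod>i\<in>B. R \<nu> i) * P * R \<nu> k * ((1 - r) * b_hat (eta_bar n \<nu> (Suc k)) (eta_bar n \<nu> k))"
    by (simp only: rt b)
  also have "\<dots> = d' n \<nu> * b_hat (eta_bar n \<nu> (Suc k)) (eta_bar n \<nu> k)"
    unfolding d'_def R_def[symmetric] prod R\<nu> r_def by (simp add: mult_ac)
  finally show ?thesis by (simp add: \<eta>_def)
qed

lemma sum_rotate:
  fixes g h :: "nat \<Rightarrow> 'a::comm_monoid_add"
  assumes "\<And>l. l \<in> {1..n} \<Longrightarrow> g l = (if l = n then h 1 else h (l + 1))"
  shows "(\<Sum>l=1..n. g l) = (\<Sum>l=1..n. h l)"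
  by (rule sum.reindex_bij_witness[of _ "\<lambda>l. if l = 1 then n else l - 1" "\<lambda>l. if l = n then 1 else l + 1"])
    (use assms in auto)

lemma prod_rotate:
  fixes g h :: "nat \<Rightarrow> 'a::comm_monoid_mult"
  assumes "\<And>l. l \<in> {1..n} \<Longrightarrow> g l = (if l = n then h 1 else h (l + 1))"
  shows "(\<Prod>l=1..n. g l) = (\<Prod>l=1..n. h l)"
  by (rule prod.reindex_bij_witness[of _ "\<lambda>l. if l = 1 then n else l - 1" "\<lambda>l. if l = n then 1 else l + 1"])
    (use assms in auto)

text \<open>Rotation carries rows along with their legs. The row that grows gains a cell in column
  1, with arm \<nu>_1; its leg is n - 1 minus the rank of position 1, since every other row is
  counted by exactly one of leg and rank.\<close>

lemma d'_phi:
  assumes n: "1 \<le> n"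
  shows "d' n (phi n \<nu>) = d' n \<nu> * (1 - qvar * tvar ^ (n - 1) * eta_bar n \<nu> 1)"
proof -
  define R where "R \<nu> i = (\<Prod>j=1..\<nu> i. 1 - qvar ^ (arm \<nu> i j + 1) * tvar ^ leg n \<nu> i j)" for \<nu> i
  define c where "c = 1 - qvar * tvar ^ (n - 1) * eta_bar n \<nu> 1"
  have other: "R (phi n \<nu>) i = R \<nu> (i + 1)" if i: "i \<in> {1..n}" "i \<noteq> n" for i
  proof -
    have "leg n (phi n \<nu>) i j = leg n \<nu> (i + 1) j" for j
      unfolding leg_eq_sum by (rule sum_rotate) (use i in \<open>auto simp: in_leg_def phi_def\<close>)
    then show ?thesis using i by (simp add: R_def arm_def phi_def)
  qed
  have last: "R (phi n \<nu>) n = c * R \<nu> 1"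
  proof -
    have leg: "leg n (phi n \<nu>) n (Suc j) = leg n \<nu> 1 j" for j
      unfolding leg_eq_sum by (rule sum_rotate) (auto simp: in_leg_def phi_def)
    have leg_pred: "leg n (phi n \<nu>) n j = leg n \<nu> 1 (j - 1)" if "2 \<le> j" for j
      using leg[of "j - 1"] that by simp
    have "leg n (phi n \<nu>) n 1 + leg' n \<nu> 1 = n - 1"
    proof -
      have "leg n (phi n \<nu>) n 1 = (\<Sum>l=1..n. of_bool (l \<noteq> 1 \<and> \<nu> l \<le> \<nu> 1))"
        unfolding leg_eq_sum by (rule sum_rotate) (auto simp: in_leg_def phi_def)
      moreover have "leg' n \<nu> 1 = (\<Sum>l=1..n. of_bool (l \<noteq> 1 \<and> \<not> \<nu> l \<le> \<nu> 1))"
        unfolding leg'_eq_sum by (rule sum.cong) (auto simp: ranks_before_def)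
      ultimately have "leg n (phi n \<nu>) n 1 + leg' n \<nu> 1 = (\<Sum>l=1..n. of_bool (l \<noteq> 1))"
        by (simp only: sum.distrib[symmetric]) (rule sum.cong, auto)
      also have "\<dots> = card ({1..n} - {1})"
        by (subst card_eq_sum_of_bool[symmetric]) (auto intro: arg_cong[of _ _ card])
      also have "\<dots> = n - 1" using n by simp
      finally show ?thesis .
    qed
    then have "tvar ^ (n - 1) * tvar powi (- int (leg' n \<nu> 1)) = tvar ^ leg n (phi n \<nu>) n 1"
    proof -
      assume "leg n (phi n \<nu>) n 1 + leg' n \<nu> 1 = n - 1"
      then have "tvar ^ (n - 1) = tvar ^ leg n (phi n \<nu>) n 1 * tvar ^ leg' n \<nu> 1"
        by (simp flip: power_add)
      then show ?thesis by (simp add: power_int_minus)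
    qed
    then have c: "c = 1 - qvar ^ (\<nu> 1 + 1) * tvar ^ leg n (phi n \<nu>) n 1"
      by (simp add: c_def eta_bar_def power_add mult_ac)
    have "R (phi n \<nu>) n = (\<Prod>j=1..\<nu> 1 + 1. 1 - qvar ^ (\<nu> 1 + 1 - j + 1) * tvar ^ leg n (phi n \<nu>) n j)"
      by (simp add: R_def arm_def phi_def)
    also have "\<dots> = c * (\<Prod>j=2..\<nu> 1 + 1. 1 - qvar ^ (\<nu> 1 + 1 - j + 1) * tvar ^ leg n (phi n \<nu>) n j)"
    proof -
      have "{1..\<nu> 1 + 1} = insert 1 {2..\<nu> 1 + 1}" by auto
      then show ?thesis by (simp add: c)
    qed
    also have "(\<Prod>j=2..\<nu> 1 + 1. 1 - qvar ^ (\<nu> 1 + 1 - j + 1) * tvar ^ leg n (phi n \<nu>) n j)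
        = (\<Prod>j=1..\<nu> 1. 1 - qvar ^ (\<nu> 1 - j + 1) * tvar ^ leg n \<nu> 1 j)"
      by (rule prod.reindex_bij_witness[of _ Suc "\<lambda>j. j - 1"]) (auto simp: leg_pred Suc_diff_le)
    finally show ?thesis by (simp add: R_def arm_def)
  qed
  have "d' n (phi n \<nu>) = (\<Prod>i=1..n. if i = n then c * R \<nu> 1 else R \<nu> (i + 1))"
    unfolding d'_def R_def[symmetric] by (rule prod.cong) (auto simp: other last)
  also have "\<dots> = (\<Prod>i=1..n. if i = 1 then c * R \<nu> 1 else R \<nu> i)"
    by (rule prod_rotate) auto
  also have "\<dots> = (\<Prod>i=1..n. (if i = 1 then c else 1) * R \<nu> i)"
    by (rule prod.cong) auto
  also have "\<dots> = c * (\<Prod>i=1..n. R \<nu> i)"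
    using n by (simp add: prod.distrib prod.delta)
  finally show ?thesis by (simp add: d'_def R_def c_def mult.commute)
qed

section \<open>The reversed basis\<close>

text \<open>
  Up to normalization, \<open>revE n M \<nu>\<close> is \<open>E\<^bsub>(M,\<dots>,M) - \<nu>\<^sup>R\<^esub>\<close>. Reversal identifies the action of \<open>T\<^bsub>n-k\<^esub>\<close> on this
  basis with the action of \<open>T\<^sub>k\<close> on the \<open>E\<^sub>\<nu>\<close>, and turns multiplication by \<open>e\<^bsub>n-1\<^esub>\<close> into multiplication by
  \<open>e\<^sub>1\<close>.
\<close>

definition revE :: "nat \<Rightarrow> nat \<Rightarrow> (nat \<Rightarrow> nat) \<Rightarrow> zpoly" where
  "revE n M \<nu> = Const (inverse (d' n \<nu>)) * nonsym_macdonald n (compl_rev n M \<nu>)"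

lemma compl_rev_apply: "compl_rev n M \<nu> i = M - \<nu> (n + 1 - i)"
  by (simp add: compl_rev_def rev_comp_def)

definition parts_le :: "nat \<Rightarrow> nat \<Rightarrow> (nat \<Rightarrow> nat) \<Rightarrow> bool" where
  "parts_le n M \<nu> \<longleftrightarrow> (\<forall>j\<in>{1..n}. \<nu> j \<le> M)"

lemma parts_leD: "parts_le n M \<nu> \<Longrightarrow> j \<in> {1..n} \<Longrightarrow> \<nu> j \<le> M"
  by (simp add: parts_le_def)

text \<open>Complementing the parts and reversing the positions reverses the ranking, so
  corresponding ranks add up to n - 1. The spectral vector is thereby inverted up to a constant
  common to all entries.\<close>

lemma eta_bar_compl_rev:
  assumes bound: "parts_le n M \<nu>" and j: "j \<in> {1..n}"
  shows "eta_bar n (compl_rev n M \<nu>) (n + 1 - j) = qvar ^ M * tvar powi (1 - int n) / eta_bar n \<nu> j"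
proof -
  let ?\<eta> = "compl_rev n M \<nu>"
  have "leg' n ?\<eta> (n + 1 - j) = (\<Sum>l=1..n. of_bool (ranks_before ?\<eta> (n + 1 - l) (n + 1 - j)))"
    unfolding leg'_eq_sum
    by (rule sum.reindex_bij_witness[of _ "\<lambda>l. n + 1 - l" "\<lambda>l. n + 1 - l"]) auto
  also have "\<dots> = (\<Sum>l=1..n. of_bool (l \<noteq> j \<and> \<not> ranks_before \<nu> l j))"
  proof (rule sum.cong[OF refl])
    fix l assume l: "l \<in> {1..n}"
    have "ranks_before ?\<eta> (n + 1 - l) (n + 1 - j) \<longleftrightarrow> l \<noteq> j \<and> \<not> ranks_before \<nu> l j"
      using parts_leD[OF bound l] parts_leD[OF bound j] l j by (auto simp: ranks_before_def compl_rev_apply)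
    then show "of_bool (ranks_before ?\<eta> (n + 1 - l) (n + 1 - j)) = of_bool (l \<noteq> j \<and> \<not> ranks_before \<nu> l j)"
      by simp
  qed
  finally have "leg' n ?\<eta> (n + 1 - j) + leg' n \<nu> j = (\<Sum>l=1..n. of_bool (l \<noteq> j))"
    unfolding leg'_eq_sum by (simp only: sum.distrib[symmetric]) (rule sum.cong, auto simp: ranks_before_def)
  also have "\<dots> = card ({1..n} - {j})"
    by (subst card_eq_sum_of_bool[symmetric]) (auto intro: arg_cong[of _ _ card])
  also have "\<dots> = n - 1" using j by simp
  finally have "- int (leg' n ?\<eta> (n + 1 - j)) = (1 - int n) - (- int (leg' n \<nu> j))"
    using j by auto
  then have t: "tvar powi (- int (leg' n ?\<eta> (n + 1 - j)))
      = tvar powi (1 - int n) / tvar powi (- int (leg' n \<nu> j))"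
    by (simp only: power_int_diff tvar_nz simp_thms disj_not1 not_False_eq_True)
  have "?\<eta> (n + 1 - j) = M - \<nu> j"
    using j by (simp add: compl_rev_apply)
  moreover have "qvar ^ (M - \<nu> j) = qvar ^ M / qvar ^ \<nu> j"
    using parts_leD[OF bound j] by (simp add: power_diff)
  ultimately show ?thesis
    unfolding eta_bar_def t by simp
qed

text \<open>The inversion of the spectral entries and the reversal of their positions cancel each
  other, so the formulas for \<nu> itself can be used.\<close>

lemma a_hat_reciprocal:
  assumes "c \<noteq> 0" "x \<noteq> 0" "y \<noteq> 0" "x \<noteq> y"
  shows "a_hat (c / y) (c / x) = a_hat x y"
proof -
  have "c / y - c / x = c * (x - y) / (x * y)" using assms by (simp add: field_simps)
  then show ?thesis using assms by (simp add: a_hat_def)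
qed

lemma b_hat_reciprocal:
  assumes "c \<noteq> 0" "x \<noteq> 0" "y \<noteq> 0" "x \<noteq> y"
  shows "b_hat (c / y) (c / x) = b_hat x y"
proof -
  have "c / y - c / x = c * (x - y) / (x * y)" "c / y - tvar * (c / x) = c * (x - tvar * y) / (x * y)"
    using assms by (simp_all add: field_simps)
  then show ?thesis using assms by (simp add: b_hat_def)
qed

text \<open>Division by d' removes the asymmetry between ascents and descents: the coefficients t
  and t^-1 times two b_hat both turn into one b_hat. For equal parts this b_hat does not vanish,
  hence the explicit case.\<close>

lemma T_op_revE:
  assumes bound: "parts_le n M \<nu>" and k: "1 \<le> k" "k < n"
  shows "T_op (n - k) (revE n M \<nu>) =
    Const (a_hat (eta_bar n \<nu> k) (eta_bar n \<nu> (Suc k))) * revE n M \<nu> +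
    (if \<nu> k = \<nu> (Suc k) then 0
     else Const (b_hat (eta_bar n \<nu> (Suc k)) (eta_bar n \<nu> k)) * revE n M (swp k \<nu>))"
proof -
  define x y where "x = eta_bar n \<nu> k" and "y = eta_bar n \<nu> (Suc k)"
  define \<eta> where "\<eta> = compl_rev n M \<nu>"
  define i where "i = n - k"
  define C where "C = qvar ^ M * tvar powi (1 - int n)"
  have i: "1 \<le> i" "i < n" using k by (auto simp: i_def)
  have n: "1 \<le> n" using k by simp
  have xy: "x \<noteq> y" unfolding x_def y_def by (rule eta_bar_inj) (use k in auto)
  have xy0: "x \<noteq> 0" "y \<noteq> 0" "C \<noteq> 0" by (simp_all add: x_def y_def C_def)
  have \<eta>i: "eta_bar n \<eta> i = C / y" "eta_bar n \<eta> (Suc i) = C / x"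
  proof -
    have "n + 1 - Suc k = i" "n + 1 - k = Suc i" using k by (simp_all add: i_def)
    then show "eta_bar n \<eta> i = C / y" "eta_bar n \<eta> (Suc i) = C / x"
      using eta_bar_compl_rev[OF bound, of "Suc k"] eta_bar_compl_rev[OF bound, of k] k
      by (simp_all add: \<eta>_def C_def x_def y_def)
  qed
  have ah: "a_hat (eta_bar n \<eta> i) (eta_bar n \<eta> (Suc i)) = a_hat x y"
    unfolding \<eta>i by (rule a_hat_reciprocal[OF xy0(3,1,2) xy])
  have bh: "b_hat (eta_bar n \<eta> i) (eta_bar n \<eta> (Suc i)) = b_hat x y"
      "b_hat (eta_bar n \<eta> (Suc i)) (eta_bar n \<eta> i) = b_hat y x"
    unfolding \<eta>i using b_hat_reciprocal[OF xy0(3,1,2) xy] b_hat_reciprocal[OF xy0(3,2,1) xy[symmetric]] by auto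
  have val: "\<eta> i = M - \<nu> (Suc k)" "\<eta> (Suc i) = M - \<nu> k"
  proof -
    have "n + 1 - i = Suc k" "n + 1 - Suc i = k" using k by (simp_all add: i_def)
    then show "\<eta> i = M - \<nu> (Suc k)" "\<eta> (Suc i) = M - \<nu> k" by (simp_all add: \<eta>_def compl_rev_apply)
  qed
  have le: "\<nu> k \<le> M" "\<nu> (Suc k) \<le> M" using parts_leD[OF bound] k by auto
  have sw: "nonsym_macdonald n (swp i \<eta>) = nonsym_macdonald n (compl_rev n M (swp k \<nu>))"
  proof (rule nonsym_macdonald_cong[OF n])
    fix j assume j: "j \<in> {1..n}"
    consider "j = i" | "j = Suc i" | "j \<noteq> i" "j \<noteq> Suc i" by blast
    then show "swp i \<eta> j = compl_rev n M (swp k \<nu>) j"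
    proof cases
      case 1
      then have "n + 1 - j = Suc k" using k by (simp add: i_def)
      then show ?thesis using 1 by (simp add: val compl_rev_apply)
    next
      case 2
      then have "n + 1 - j = k" using k by (simp add: i_def)
      then show ?thesis using 2 by (simp add: val compl_rev_apply)
    next
      case 3
      then have "n + 1 - j \<noteq> k" "n + 1 - j \<noteq> Suc k" using j k by (auto simp: i_def)
      then show ?thesis using 3 by (simp add: \<eta>_def compl_rev_apply)
    qed
  qed
  define E E' where "E = nonsym_macdonald n \<eta>" and "E' = nonsym_macdonald n (compl_rev n M (swp k \<nu>))"
  have G: "revE n M \<nu> = Const (inverse (d' n \<nu>)) * E" "revE n M (swp k \<nu>) = Const (inverse (d' n (swp k \<nu>))) * E'"
    by (simp_all add: revE_def E_def E'_def \<eta>_def)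
  have fin: "T_op i (revE n M \<nu>) = Const (a_hat x y) * revE n M \<nu> + Const (b_hat y x) * revE n M (swp k \<nu>)"
    if "T_op i E = Const (a_hat x y) * E + Const c * E'" "c * d' n (swp k \<nu>) = d' n \<nu> * b_hat y x" for c
  proof -
    have "inverse (d' n \<nu>) * c = b_hat y x * inverse (d' n (swp k \<nu>))"
      using that(2) by (simp add: field_simps)
    then have "Const (inverse (d' n \<nu>)) * (Const c * E') = Const (b_hat y x) * (Const (inverse (d' n (swp k \<nu>))) * E')"
      by (simp add: mult.assoc[symmetric] flip: Const_simps(4))
    then show ?thesis
      by (simp add: G T_op_Const that(1) distrib_left mult.left_commute)
  qed
  consider (less) "\<nu> k < \<nu> (Suc k)" | (eq) "\<nu> k = \<nu> (Suc k)" | (greater) "\<nu> (Suc k) < \<nu> k" by linarith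
  then have "T_op i (revE n M \<nu>) = Const (a_hat x y) * revE n M \<nu> +
    (if \<nu> k = \<nu> (Suc k) then 0 else Const (b_hat y x) * revE n M (swp k \<nu>))"
  proof cases
    case less
    then have "T_op i E = Const (a_hat x y) * E + Const tvar * E'"
      using T_op_macdonald_less[OF i, of \<eta>] le by (simp add: val ah E_def E'_def sw)
    then show ?thesis
      using fin[of tvar] d'_swp[OF k less] less by (simp add: x_def y_def mult.commute)
  next
    case eq
    then have "T_op i E = Const (a_hat x y) * E"
      using T_op_macdonald_eq[OF i, of \<eta>] by (simp add: val ah E_def)
    then show ?thesis
      using eq by (simp add: G T_op_Const mult.left_commute)
  next
    case greater
    then have "T_op i E = Const (a_hat x y) * E + Const (inverse tvar * (b_hat x y * b_hat y x)) * E'"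
      using T_op_macdonald_greater[OF i, of \<eta>] le by (simp add: val ah bh E_def E'_def sw)
    moreover have "d' n \<nu> * tvar = d' n (swp k \<nu>) * b_hat x y"
      using d'_swp[OF k, of "swp k \<nu>"] greater eta_bar_swp[OF k, of \<nu> k] eta_bar_swp[OF k, of \<nu> "Suc k"] k
      by (simp add: x_def y_def)
    then have "inverse tvar * (b_hat x y * b_hat y x) * d' n (swp k \<nu>) = d' n \<nu> * b_hat y x"
      by (simp add: field_simps)
    ultimately have "T_op i (revE n M \<nu>) = Const (a_hat x y) * revE n M \<nu> + Const (b_hat y x) * revE n M (swp k \<nu>)"
      by (rule fin)
    then show ?thesis using greater by simp
  qed
  then show ?thesis by (simp add: x_def y_def i_def)
qed

lemma T_inv_revE:
  assumes bound: "parts_le n M \<nu>" and k: "1 \<le> k" "k < n"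
  shows "T_inv (n - k) (revE n M \<nu>) =
    Const (- inverse tvar * a_hat (eta_bar n \<nu> (Suc k)) (eta_bar n \<nu> k)) * revE n M \<nu> +
    (if \<nu> k = \<nu> (Suc k) then 0
     else Const (inverse tvar * b_hat (eta_bar n \<nu> (Suc k)) (eta_bar n \<nu> k)) * revE n M (swp k \<nu>))"
proof -
  have "eta_bar n \<nu> k \<noteq> eta_bar n \<nu> (Suc k)"
    by (rule eta_bar_inj) (use k in auto)
  then have a: "a_hat (eta_bar n \<nu> k) (eta_bar n \<nu> (Suc k)) - (tvar - 1)
      = - a_hat (eta_bar n \<nu> (Suc k)) (eta_bar n \<nu> k)"
    using a_hat_sum by (metis add_diff_cancel_left' minus_diff_eq)
  have "T_op (n - k) (revE n M \<nu>) - (Const tvar - 1) * revE n M \<nu> =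
    Const (- a_hat (eta_bar n \<nu> (Suc k)) (eta_bar n \<nu> k)) * revE n M \<nu> +
    (if \<nu> k = \<nu> (Suc k) then 0
     else Const (b_hat (eta_bar n \<nu> (Suc k)) (eta_bar n \<nu> k)) * revE n M (swp k \<nu>))"
    unfolding T_op_revE[OF bound k] a[symmetric]
    by (simp add: Const_simps algebra_simps)
  then show ?thesis
    unfolding T_inv_def by (simp add: Const_simps distrib_left right_diff_distrib mult.assoc)
qed

section \<open>Multiplication by the product of all variables but one\<close>

definition coprod_Z :: "nat \<Rightarrow> nat \<Rightarrow> zpoly" where
  "coprod_Z n i = (\<Prod>j\<in>{1..n} - {i}. Z j)"

lemma T_op_coprod_Z:
  assumes i: "1 \<le> i" "i < n"
  shows "T_op i (coprod_Z n (Suc i) * T_op i f) = Const tvar * (coprod_Z n i * f)"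
proof -
  define B where "B = {1..n} - {i, Suc i}"
  define R where "R = (\<Prod>j\<in>B. Z j)"
  have B: "{1..n} - {Suc i} = insert i B" "{1..n} - {i} = insert (Suc i) B" "finite B" "i \<notin> B" "Suc i \<notin> B"
    using i by (auto simp: B_def)
  have c: "coprod_Z n (Suc i) = R * Z i" "coprod_Z n i = R * Z (i + 1)"
    unfolding coprod_Z_def R_def B(1,2) using B(3-5) by (simp_all add: mult.commute)
  have "s_op i R = R"
    unfolding R_def by (rule s_op_prod) (use B(3-5) in \<open>simp_all flip: Suc_eq_plus1\<close>)
  then have "T_op i (R * (Z i * T_op i f)) = R * (Const tvar * (Z (i + 1) * f))"
    by (simp add: T_op_mult T_op_Z_inv)
  then show ?thesis unfolding c by (simp add: mult_ac)
qed

text \<open>The relation between neighbouring x_i, iterated from x_n downwards. Generators are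
  indexed as \<open>n - k\<close> because on the reversed basis these act on the entries k and k +
  1.\<close>

lemma foldr_T_op_coprod_Z:
  assumes "1 \<le> i" "i \<le> n"
  shows "foldr (\<lambda>k. T_op (n - k)) (rev [1..<i]) (coprod_Z n n * foldr (\<lambda>k. T_op (n - k)) [1..<i] f)
    = Const (tvar ^ (i - 1)) * (coprod_Z n (n + 1 - i) * f)"
  using assms
proof (induction i arbitrary: f rule: dec_induct)
  case base
  then show ?case by (simp add: Const_simps)
next
  case (step i)
  have "foldr (\<lambda>k. T_op (n - k)) (rev [1..<Suc i]) (coprod_Z n n * foldr (\<lambda>k. T_op (n - k)) [1..<Suc i] f)
      = T_op (n - i) (foldr (\<lambda>k. T_op (n - k)) (rev [1..<i])
          (coprod_Z n n * foldr (\<lambda>k. T_op (n - k)) [1..<i] (T_op (n - i) f)))"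
    using step.hyps by simp
  also have "\<dots> = Const (tvar ^ (i - 1)) * T_op (n - i) (coprod_Z n (Suc (n - i)) * T_op (n - i) f)"
    using step by (simp add: T_op_Const Suc_diff_le flip: Suc_eq_plus1)
  also have "\<dots> = Const (tvar ^ (i - 1)) * (Const tvar * (coprod_Z n (n - i) * f))"
    using step.hyps step.prems by (subst T_op_coprod_Z) auto
  also have "\<dots> = Const (tvar ^ (Suc i - 1)) * (coprod_Z n (n + 1 - Suc i) * f)"
  proof -
    obtain l where "i = Suc l" using step.hyps by (cases i) auto
    then show ?thesis by (simp add: Const_simps mult.assoc mult.left_commute)
  qed
  finally show ?case .
qed

text \<open>\<open>psi\<close> is chosen so that applying \<open>phi\<close> to it gives \<eta> with
  1 added everywhere. Both sides then carry a factor z_n, which is cancelled.\<close>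

lemma coprod_Z_macdonald:
  assumes n: "1 \<le> n"
  defines "psi \<equiv> \<lambda>\<eta> j. if j = 1 then \<eta> n else \<eta> (j - 1) + 1"
  shows "omega n (nonsym_macdonald n (psi \<eta>)) = Const (qvar ^ \<eta> n) * (coprod_Z n n * nonsym_macdonald n \<eta>)"
proof -
  have "nonsym_macdonald n (phi n (psi \<eta>)) = nonsym_macdonald n (\<lambda>i. \<eta> i + 1)"
    by (rule nonsym_macdonald_cong[OF n]) (auto simp: phi_def psi_def)
  then have "Phi n (nonsym_macdonald n (psi \<eta>)) = Const (qvar ^ \<eta> n) * (e_top n * nonsym_macdonald n \<eta>)"
    using Phi_macdonald[OF n, of "psi \<eta>"] e_top_macdonald[OF n, of \<eta>] by (simp add: psi_def)
  moreover have "e_top n = Z n * coprod_Z n n"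
    unfolding e_top_def coprod_Z_def by (rule prod.remove) (use n in auto)
  ultimately have "Z n * omega n (nonsym_macdonald n (psi \<eta>))
      = Z n * (Const (qvar ^ \<eta> n) * (coprod_Z n n * nonsym_macdonald n \<eta>))"
    by (simp add: Phi_def mult_ac)
  then show ?thesis by simp
qed

text \<open>The factor 1 - q t^{n-1} y_1 is the quotient of the normalizing constants of
  \<open>phi n \<nu>\<close> and \<nu>. The rest comes from the eigenvalue of Y_1 and from the power
  of q produced by \<omega>.\<close>

lemma coprod_Z_revE:
  assumes n: "1 \<le> n" and bound: "parts_le n M \<nu>"
  shows "coprod_Z n n * revE n M \<nu> =
    Const (qvar ^ \<nu> 1 * (1 - qvar * tvar ^ (n - 1) * eta_bar n \<nu> 1) / eta_bar n \<nu> 1) *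
    foldr (\<lambda>k. T_inv (n - k)) [1..<n] (revE n (M + 1) (phi n \<nu>))"
proof -
  define \<eta> where "\<eta> = compl_rev n M \<nu>"
  define \<psi> where "\<psi> = compl_rev n (M + 1) (phi n \<nu>)"
  define c where "c = 1 - qvar * tvar ^ (n - 1) * eta_bar n \<nu> 1"
  define y where "y = eta_bar n \<nu> 1"
  define W where "W = foldr (\<lambda>k. T_inv (n - k)) [1..<n] (nonsym_macdonald n \<psi>)"
  have bound': "parts_le n (M + 1) (phi n \<nu>)"
    unfolding parts_le_def
  proof
    fix j assume "j \<in> {1..n}"
    then show "phi n \<nu> j \<le> M + 1"
      using parts_leD[OF bound, of 1] parts_leD[OF bound, of "j + 1"] n by (auto simp: phi_def)
  qed
  have \<eta>n: "\<eta> n = M - \<nu> 1" by (simp add: \<eta>_def compl_rev_apply)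
  have "nonsym_macdonald n (\<lambda>j. if j = 1 then \<eta> n else \<eta> (j - 1) + 1) = nonsym_macdonald n \<psi>"
  proof (rule nonsym_macdonald_cong[OF n])
    fix j assume j: "j \<in> {1..n}"
    show "(if j = 1 then \<eta> n else \<eta> (j - 1) + 1) = \<psi> j"
    proof (cases "j = 1")
      case True
      then show ?thesis by (simp add: \<eta>n \<psi>_def compl_rev_apply phi_def)
    next
      case False
      then have "n + 1 - (j - 1) = n + 1 - j + 1" "n + 1 - j \<noteq> n" using j by auto
      moreover have "\<nu> (n + 1 - j + 1) \<le> M" by (rule parts_leD[OF bound]) (use False j in auto)
      ultimately show ?thesis
        using False by (simp add: \<eta>_def \<psi>_def compl_rev_apply phi_def)
    qed
  qed
  then have 1: "omega n (nonsym_macdonald n \<psi>) = Const (qvar ^ (M - \<nu> 1)) * (coprod_Z n n * nonsym_macdonald n \<eta>)"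
    using coprod_Z_macdonald[OF n, of \<eta>] by (simp add: \<eta>n)
  have "rev [1..<n] = map (\<lambda>k. n - k) [1..<n]"
    by (rule nth_equalityI) (auto simp: rev_nth)
  then have W: "W = foldr T_inv (rev [1..<n]) (nonsym_macdonald n \<psi>)"
    by (simp add: W_def foldr_map comp_def)
  have "eta_bar n \<psi> 1 = qvar ^ (M + 1) * tvar powi (1 - int n) / (qvar * y)"
    using eta_bar_compl_rev[OF bound', of n] n eta_bar_phi[of n n \<nu>] by (simp add: \<psi>_def y_def)
  also have "\<dots> = qvar ^ M * tvar powi (1 - int n) / y"
    by (simp add: power_add)
  finally have "Y_op n 1 (nonsym_macdonald n \<psi>) = Const (qvar ^ M * tvar powi (1 - int n) / y) * nonsym_macdonald n \<psi>"
    using is_macd_nonsym_macdonald[OF n, of \<psi>] n by (simp add: is_macd_def)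
  then have "omega n (nonsym_macdonald n \<psi>)
      = Const (tvar ^ (n - 1) * (qvar ^ M * tvar powi (1 - int n) / y)) * W"
    unfolding omega_eq_Y_1[OF n] W by (simp only: foldr_T_inv_Const Const_simps(4) mult.assoc)
  also have "tvar ^ (n - 1) * (qvar ^ M * tvar powi (1 - int n) / y) = qvar ^ M / y"
  proof -
    have "1 - int n = - int (n - 1)" using n by simp
    then show ?thesis by (simp only: power_int_minus power_int_of_nat) simp
  qed
  finally have 2: "Const (qvar ^ (M - \<nu> 1)) * (coprod_Z n n * nonsym_macdonald n \<eta>) = Const (qvar ^ M / y) * W"
    using 1 by simp
  have q: "inverse (qvar ^ (M - \<nu> 1)) * (qvar ^ M / y) = qvar ^ \<nu> 1 / y"
    using parts_leD[OF bound, of 1] n by (simp add: power_diff field_simps)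
  have "coprod_Z n n * nonsym_macdonald n \<eta> = Const (inverse (qvar ^ (M - \<nu> 1))) * (Const (qvar ^ M / y) * W)"
    using Const_inverse_cancel[of "qvar ^ (M - \<nu> 1)" "coprod_Z n n * nonsym_macdonald n \<eta>"] by (simp add: 2)
  also have "\<dots> = Const (qvar ^ \<nu> 1 / y) * W"
    by (simp only: q mult.assoc[symmetric] Const_simps(4)[symmetric])
  finally have 3: "coprod_Z n n * nonsym_macdonald n \<eta> = Const (qvar ^ \<nu> 1 / y) * W" .
  have fC: "foldr (\<lambda>k. T_inv (n - k)) xs (Const a * f) = Const a * foldr (\<lambda>k. T_inv (n - k)) xs f" for xs a f
    by (induction xs) (simp_all add: T_inv_Const)
  have "coprod_Z n n * revE n M \<nu> = Const (inverse (d' n \<nu>)) * (Const (qvar ^ \<nu> 1 / y) * W)"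
    by (simp add: revE_def mult.left_commute 3[unfolded \<eta>_def])
  also have "\<dots> = Const (qvar ^ \<nu> 1 * c / y) * (Const (inverse (d' n (phi n \<nu>))) * W)"
  proof -
    have "d' n (phi n \<nu>) = d' n \<nu> * c" unfolding c_def by (rule d'_phi[OF n])
    moreover from this have "c \<noteq> 0" using d'_nz by (metis mult_zero_right)
    ultimately have "inverse (d' n \<nu>) * (qvar ^ \<nu> 1 / y) = qvar ^ \<nu> 1 * c / y * inverse (d' n (phi n \<nu>))"
      by (simp add: field_simps)
    then show ?thesis by (simp only: mult.assoc[symmetric] Const_simps(4)[symmetric])
  qed
  finally show ?thesis
    by (simp add: revE_def fC W_def \<psi>_def c_def y_def)
qed

section \<open>Products of the operators on the reversed basis\<close>

text \<open>Meaningful only if S has an element beyond j; \<open>nextv\<close> supplies the cyclic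
  continuation.\<close>

definition nx :: "nat set \<Rightarrow> nat \<Rightarrow> nat" where
  "nx S j = Min {k\<in>S. j < k}"

text \<open>
  The product \<open>U\<^bsub>lo\<^esub> \<cdots> U\<^bsub>hi-1\<^esub>\<close> carries the entry at position \<open>hi\<close> to the left. At each position the carried
  entry either passes, or is dropped and replaced by the entry found there; \<open>S\<close> collects \<open>hi\<close> and
  the positions of the second kind, and \<open>config lo hi S v\<close> is the resulting arrangement of \<open>v\<close>.
\<close>

definition config :: "nat \<Rightarrow> nat \<Rightarrow> nat set \<Rightarrow> (nat \<Rightarrow> 'a) \<Rightarrow> nat \<Rightarrow> 'a" where
  "config lo hi S v j =
     (if j < lo \<or> hi < j then v j
      else if j = lo then v (Min S)
      else if j - 1 \<in> S then v (nx S (j - 1)) else v (j - 1))"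

text \<open>\<open>nx S j\<close> is the origin of the entry carried across j. Crossing an equal
  entry is excluded because the swapped term is absent from \<open>T_op_revE\<close> in that
  case.\<close>

definition admissible :: "nat \<Rightarrow> nat \<Rightarrow> (nat \<Rightarrow> nat) \<Rightarrow> nat set set" where
  "admissible lo hi \<nu> = {S. S \<subseteq> {lo..hi} \<and> hi \<in> S \<and> (\<forall>j\<in>{lo..<hi} - S. \<nu> j \<noteq> \<nu> (nx S j))}"

text \<open>\<alpha> is the weight of a drop and \<beta> scales a crossing, so that T_k and its
  inverse are treated alike. The original vector y suffices, since the positions to the left of the
  carried entry are still untouched.\<close>

definition path_weight ::
  "(qt \<Rightarrow> qt \<Rightarrow> qt) \<Rightarrow> qt \<Rightarrow> nat \<Rightarrow> nat \<Rightarrow> nat set \<Rightarrow> (nat \<Rightarrow> qt) \<Rightarrow> qt" where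
  "path_weight \<alpha> \<beta> lo hi S y =
     (\<Prod>j\<in>{lo..<hi}. if j \<in> S then \<alpha> (y j) (y (nx S j)) else \<beta> * b_hat (y (nx S j)) (y j))"

lemma nx_in:
  assumes "finite S" "k \<in> S" "j < k"
  shows "nx S j \<in> S" "j < nx S j" "nx S j \<le> k"
proof -
  have "Min {k\<in>S. j < k} \<in> {k\<in>S. j < k}" by (rule Min_in) (use assms in auto)
  then show "nx S j \<in> S" "j < nx S j" by (auto simp: nx_def)
  show "nx S j \<le> k" unfolding nx_def by (rule Min_le) (use assms in auto)
qed

lemma nx_eqI:
  assumes "finite S" "k \<in> S" "j < k" "\<And>l. l \<in> S \<Longrightarrow> j < l \<Longrightarrow> k \<le> l"
  shows "nx S j = k"
  unfolding nx_def by (rule Min_eqI) (use assms in auto)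

lemma nx_insert: "k \<le> j \<Longrightarrow> nx (insert k S) j = nx S j"
  unfolding nx_def by (rule arg_cong[of _ _ Min]) auto

lemma nx_below_Min: "\<forall>l\<in>S. j < l \<Longrightarrow> nx S j = Min S"
  unfolding nx_def by (rule arg_cong[of _ _ Min]) auto

lemma Min_insert_below:
  assumes "finite S" "\<forall>l\<in>S. k < l"
  shows "Min (insert k S) = (k :: nat)"
  by (rule Min_eqI) (use assms in auto)

lemma config_base: "config lo lo {lo} v = v"
  by (auto simp: config_def fun_eq_iff)

text \<open>Dropping the carried entry and taking up the one at k leaves the arrangement as it is
  and changes only the bookkeeping; in \<open>config_pass\<close> the entry moves by an actual
  swap.\<close>

lemma config_stay:
  assumes "k < hi" "S \<subseteq> {Suc k..hi}" "hi \<in> S"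
  shows "config k hi (insert k S) v = config (Suc k) hi S v"
proof
  fix j
  have fin: "finite S" using assms(2) by (rule finite_subset) simp
  have gt: "\<forall>l\<in>S. k < l" using assms(2) by auto
  consider "j < k \<or> hi < j" | "j = k" | "j = Suc k" | "Suc k < j" "j \<le> hi" by linarith
  then show "config k hi (insert k S) v j = config (Suc k) hi S v j"
  proof cases
    case 3
    then show ?thesis
      using assms gt by (simp add: config_def nx_insert nx_below_Min)
  next
    case 4
    then have "j - 1 \<noteq> k" "k \<le> j - 1" by auto
    then show ?thesis using 4 assms by (simp add: config_def nx_insert)
  qed (use assms in \<open>auto simp: config_def Min_insert_below[OF fin gt]\<close>)
qed

lemma config_pass:
  assumes "k < hi" "S \<subseteq> {Suc k..hi}" "hi \<in> S"
  shows "config k hi S v = swp k (config (Suc k) hi S v)"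
proof
  fix j
  have k: "k \<notin> S" using assms(2) by auto
  consider "j < k \<or> hi < j" | "j = k" | "j = Suc k" | "Suc k < j" "j \<le> hi" by linarith
  then show "config k hi S v j = swp k (config (Suc k) hi S v) j"
    by cases (use assms k in \<open>auto simp: config_def\<close>)
qed

lemma admissible_base: "admissible lo lo \<nu> = {{lo}}"
  by (auto simp: admissible_def)

lemma admissible_finite: "finite (admissible lo hi \<nu>)"
  by (rule finite_subset[of _ "Pow {lo..hi}"]) (auto simp: admissible_def)

lemma admissibleI:
  assumes "\<And>l. l \<in> S \<Longrightarrow> lo \<le> l \<and> l \<le> hi" "hi \<in> S"
    "\<And>j. lo \<le> j \<Longrightarrow> j < hi \<Longrightarrow> j \<notin> S \<Longrightarrow> \<nu> j \<noteq> \<nu> (nx S j)"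
  shows "S \<in> admissible lo hi \<nu>"
  using assms unfolding admissible_def by auto

lemma admissibleD:
  assumes "S \<in> admissible lo hi \<nu>"
  shows "l \<in> S \<Longrightarrow> lo \<le> l \<and> l \<le> hi" "hi \<in> S"
    "lo \<le> j \<Longrightarrow> j < hi \<Longrightarrow> j \<notin> S \<Longrightarrow> \<nu> j \<noteq> \<nu> (nx S j)"
proof -
  have S: "S \<subseteq> {lo..hi}" "hi \<in> S" "\<forall>j\<in>{lo..<hi} - S. \<nu> j \<noteq> \<nu> (nx S j)"
    using assms by (simp_all add: admissible_def)
  show "l \<in> S \<Longrightarrow> lo \<le> l \<and> l \<le> hi" using S(1) by auto
  show "hi \<in> S" by (rule S(2))
  show "lo \<le> j \<Longrightarrow> j < hi \<Longrightarrow> j \<notin> S \<Longrightarrow> \<nu> j \<noteq> \<nu> (nx S j)"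
    using S(3) by simp
qed

text \<open>The set is built from right to left by deciding about position k, where
  \<open>Min S\<close> is the origin of the entry being carried.\<close>

lemma admissible_step:
  assumes "k < hi"
  shows "admissible k hi \<nu> = insert k ` admissible (Suc k) hi \<nu> \<union>
    {S\<in>admissible (Suc k) hi \<nu>. \<nu> k \<noteq> \<nu> (Min S)}"
proof (intro set_eqI iffI)
  fix S assume S: "S \<in> admissible k hi \<nu>"
  show "S \<in> insert k ` admissible (Suc k) hi \<nu> \<union> {S\<in>admissible (Suc k) hi \<nu>. \<nu> k \<noteq> \<nu> (Min S)}"
  proof (cases "k \<in> S")
    case True
    define S' where "S' = S - {k}"
    have S': "S = insert k S'" using True by (auto simp: S'_def)
    have "S' \<in> admissible (Suc k) hi \<nu>"
    proof (rule admissibleI)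
      show "Suc k \<le> l \<and> l \<le> hi" if "l \<in> S'" for l
        using admissibleD(1)[OF S, of l] that by (auto simp: S'_def)
      show "hi \<in> S'" using admissibleD(2)[OF S] assms by (simp add: S'_def)
      fix j assume j: "Suc k \<le> j" "j < hi" "j \<notin> S'"
      have "nx S j = nx S' j"
        unfolding S' by (rule nx_insert) (use j in simp)
      then show "\<nu> j \<noteq> \<nu> (nx S' j)"
        using admissibleD(3)[OF S, of j] j by (simp add: S')
    qed
    then show ?thesis using S' by blast
  next
    case False
    have gt: "\<forall>l\<in>S. k < l"
    proof
      fix l assume "l \<in> S"
      then show "k < l" using admissibleD(1)[OF S, of l] False by (cases "l = k") auto
    qed
    have "\<nu> k \<noteq> \<nu> (Min S)"
      using admissibleD(3)[OF S, of k] False assms nx_below_Min[OF gt] by simp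
    moreover have "S \<in> admissible (Suc k) hi \<nu>"
    proof (rule admissibleI)
      show "Suc k \<le> l \<and> l \<le> hi" if "l \<in> S" for l
        using admissibleD(1)[OF S that] gt that by (simp add: Suc_le_eq)
    qed (use admissibleD[OF S] in auto)
    ultimately show ?thesis by simp
  qed
next
  fix S assume "S \<in> insert k ` admissible (Suc k) hi \<nu> \<union> {S\<in>admissible (Suc k) hi \<nu>. \<nu> k \<noteq> \<nu> (Min S)}"
  then consider (stay) S' where "S = insert k S'" "S' \<in> admissible (Suc k) hi \<nu>"
    | (pass) "S \<in> admissible (Suc k) hi \<nu>" "\<nu> k \<noteq> \<nu> (Min S)" by blast
  then show "S \<in> admissible k hi \<nu>"
  proof cases
    case stay
    note S' = admissibleD[OF stay(2)]
    show ?thesis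
    proof (rule admissibleI)
      show "k \<le> l \<and> l \<le> hi" if "l \<in> S" for l
        using S'(1)[of l] that assms by (auto simp: stay(1))
      show "hi \<in> S" using S'(2) by (simp add: stay(1))
      fix j assume j: "k \<le> j" "j < hi" "j \<notin> S"
      then show "\<nu> j \<noteq> \<nu> (nx S j)"
        using S'(3)[of j] nx_insert[of k j S'] by (auto simp: stay(1))
    qed
  next
    case pass
    note S' = admissibleD[OF pass(1)]
    have gt: "\<forall>l\<in>S. k < l" using S'(1) by (simp add: Suc_le_eq)
    show ?thesis
    proof (rule admissibleI)
      show "k \<le> l \<and> l \<le> hi" if "l \<in> S" for l
        using S'(1)[OF that] by simp
      show "hi \<in> S" by (rule S'(2))
      fix j assume j: "k \<le> j" "j < hi" "j \<notin> S"
      then show "\<nu> j \<noteq> \<nu> (nx S j)"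
        using S'(3)[of j] nx_below_Min[OF gt] pass(2) by (cases "j = k") auto
    qed
  qed
qed

lemma path_weight_stay:
  assumes "k < hi" "S \<subseteq> {Suc k..hi}" "hi \<in> S"
  shows "path_weight \<alpha> \<beta> k hi (insert k S) y = path_weight \<alpha> \<beta> (Suc k) hi S y * \<alpha> (y k) (y (Min S))"
proof -
  have gt: "\<forall>l\<in>S. k < l" using assms(2) by auto
  have split: "{k..<hi} = insert k {Suc k..<hi}" using assms(1) by auto
  have "(\<Prod>j\<in>{Suc k..<hi}. if j \<in> insert k S then \<alpha> (y j) (y (nx (insert k S) j))
         else \<beta> * b_hat (y (nx (insert k S) j)) (y j))
      = (\<Prod>j\<in>{Suc k..<hi}. if j \<in> S then \<alpha> (y j) (y (nx S j)) else \<beta> * b_hat (y (nx S j)) (y j))"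
    by (rule prod.cong) (auto simp: nx_insert)
  then show ?thesis
    unfolding path_weight_def split by (simp add: nx_insert nx_below_Min[OF gt] mult.commute)
qed

lemma path_weight_pass:
  assumes "k < hi" "S \<subseteq> {Suc k..hi}" "hi \<in> S"
  shows "path_weight \<alpha> \<beta> k hi S y = path_weight \<alpha> \<beta> (Suc k) hi S y * (\<beta> * b_hat (y (Min S)) (y k))"
proof -
  have gt: "\<forall>l\<in>S. k < l" and k: "k \<notin> S" using assms(2) by auto
  have split: "{k..<hi} = insert k {Suc k..<hi}" using assms(1) by auto
  show ?thesis
    unfolding path_weight_def split by (simp add: k nx_below_Min[OF gt] mult.commute)
qed

lemma parts_le_swp: "1 \<le> k \<Longrightarrow> k < n \<Longrightarrow> parts_le n M \<nu> \<Longrightarrow> parts_le n M (swp k \<nu>)"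
  by (auto simp: parts_le_def swp_def)

text \<open>Induction from \<open>hi\<close> downwards, adding one operator on the left. Swaps occur
  only between unequal parts, so the spectral vector of an arrangement is the same arrangement of
  the spectral vector; this evaluates the next coefficient.\<close>

lemma operator_path:
  assumes lo: "1 \<le> lo" "lo \<le> hi" "hi \<le> n" and bound: "parts_le n M \<nu>"
    and add: "\<And>k f g. U k (f + g) = U k f + U k g"
    and Const: "\<And>k c f. U k (Const c * f) = Const c * U k f"
    and U: "\<And>k \<kappa>. 1 \<le> k \<Longrightarrow> k < n \<Longrightarrow> parts_le n M \<kappa> \<Longrightarrow>
      U k (revE n M \<kappa>) = Const (\<alpha> (eta_bar n \<kappa> k) (eta_bar n \<kappa> (Suc k))) * revE n M \<kappa> +
        (if \<kappa> k = \<kappa> (Suc k) then 0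
         else Const (\<beta> * b_hat (eta_bar n \<kappa> (Suc k)) (eta_bar n \<kappa> k)) * revE n M (swp k \<kappa>))"
  shows "foldr U [lo..<hi] (revE n M \<nu>) =
      (\<Sum>S\<in>admissible lo hi \<nu>. Const (path_weight \<alpha> \<beta> lo hi S (eta_bar n \<nu>)) * revE n M (config lo hi S \<nu>))
    \<and> (\<forall>S\<in>admissible lo hi \<nu>. parts_le n M (config lo hi S \<nu>) \<and>
        (\<forall>j\<in>{1..n}. eta_bar n (config lo hi S \<nu>) j = config lo hi S (eta_bar n \<nu>) j))"
  using lo(2,1)
proof (induction lo rule: inc_induct)
  case base
  then show ?case
    by (simp add: admissible_base config_base path_weight_def Const_simps bound)
next
  case (step k)
  define y where "y = eta_bar n \<nu>"
  let ?A = "admissible (Suc k) hi \<nu>"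
  let ?w = "\<lambda>S. path_weight \<alpha> \<beta> (Suc k) hi S y"
  have k: "1 \<le> k" "k < hi" "k < n" using step lo by auto
  have IH: "foldr U [Suc k..<hi] (revE n M \<nu>) = (\<Sum>S\<in>?A. Const (?w S) * revE n M (config (Suc k) hi S \<nu>))"
    and IH': "\<And>S. S \<in> ?A \<Longrightarrow> parts_le n M (config (Suc k) hi S \<nu>)"
      "\<And>S j. S \<in> ?A \<Longrightarrow> j \<in> {1..n} \<Longrightarrow> eta_bar n (config (Suc k) hi S \<nu>) j = config (Suc k) hi S y j"
    using step by (auto simp: y_def)
  have S: "S \<subseteq> {Suc k..hi}" "hi \<in> S" if "S \<in> ?A" for S
    using that by (auto simp: admissible_def)
  have at: "config (Suc k) hi S v k = v k" "config (Suc k) hi S v (Suc k) = v (Min S)" for S and v :: "nat \<Rightarrow> 'b"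
    using k by (auto simp: config_def)
  have U0: "U k 0 = 0" using Const[of k 0 0] by (simp add: Const_simps)
  have sum: "U k (sum g A) = (\<Sum>x\<in>A. U k (g x))" if "finite A" for g and A :: "nat set set"
    using that by (induction A) (simp_all add: U0 add)
  have "foldr U [k..<hi] (revE n M \<nu>) = U k (\<Sum>S\<in>?A. Const (?w S) * revE n M (config (Suc k) hi S \<nu>))"
    using k by (simp add: upt_conv_Cons IH)
  also have "\<dots> = (\<Sum>S\<in>?A. Const (?w S) * U k (revE n M (config (Suc k) hi S \<nu>)))"
    by (simp add: sum admissible_finite Const)
  also have "\<dots> = (\<Sum>S\<in>?A.
      Const (path_weight \<alpha> \<beta> k hi (insert k S) y) * revE n M (config k hi (insert k S) \<nu>)
      + (if \<nu> k \<noteq> \<nu> (Min S) then Const (path_weight \<alpha> \<beta> k hi S y) * revE n M (config k hi S \<nu>) else 0))"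
  proof (rule sum.cong[OF refl])
    fix S assume SA: "S \<in> ?A"
    have "eta_bar n (config (Suc k) hi S \<nu>) k = y k" "eta_bar n (config (Suc k) hi S \<nu>) (Suc k) = y (Min S)"
      using IH'(2)[OF SA, of k] IH'(2)[OF SA, of "Suc k"] k at[of S y] by simp_all
    then have Uk: "U k (revE n M (config (Suc k) hi S \<nu>)) =
       Const (\<alpha> (y k) (y (Min S))) * revE n M (config k hi (insert k S) \<nu>) +
       (if \<nu> k = \<nu> (Min S) then 0 else Const (\<beta> * b_hat (y (Min S)) (y k)) * revE n M (config k hi S \<nu>))"
      using U[OF k(1,3) IH'(1)[OF SA]] by (simp add: at config_stay[OF k(2) S[OF SA]] config_pass[OF k(2) S[OF SA]])
    show "Const (?w S) * U k (revE n M (config (Suc k) hi S \<nu>)) =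
      Const (path_weight \<alpha> \<beta> k hi (insert k S) y) * revE n M (config k hi (insert k S) \<nu>)
      + (if \<nu> k \<noteq> \<nu> (Min S) then Const (path_weight \<alpha> \<beta> k hi S y) * revE n M (config k hi S \<nu>) else 0)"
      unfolding Uk path_weight_stay[OF k(2) S[OF SA]] path_weight_pass[OF k(2) S[OF SA]]
      by (simp add: distrib_left Const_simps mult.assoc)
  qed
  also have "\<dots> = (\<Sum>S\<in>insert k ` ?A. Const (path_weight \<alpha> \<beta> k hi S y) * revE n M (config k hi S \<nu>))
      + (\<Sum>S\<in>{S\<in>?A. \<nu> k \<noteq> \<nu> (Min S)}. Const (path_weight \<alpha> \<beta> k hi S y) * revE n M (config k hi S \<nu>))"
  proof -
    have "inj_on (insert k) ?A"
    proof (rule inj_onI)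
      fix S S' assume "S \<in> ?A" "S' \<in> ?A" "insert k S = insert k S'"
      moreover have "k \<notin> S" "k \<notin> S'"
        using S(1)[OF \<open>S \<in> ?A\<close>] S(1)[OF \<open>S' \<in> ?A\<close>] by auto
      ultimately show "S = S'" by (metis Diff_insert_absorb)
    qed
    then show ?thesis
      by (simp only: sum.distrib sum.reindex comp_def sum.inter_filter[OF admissible_finite])
  qed
  also have "\<dots> = (\<Sum>S\<in>admissible k hi \<nu>. Const (path_weight \<alpha> \<beta> k hi S y) * revE n M (config k hi S \<nu>))"
    unfolding admissible_step[OF k(2)]
    by (rule sum.union_disjoint[symmetric]) (use S(1) in \<open>fastforce simp: admissible_finite\<close>)+
  finally have 1: "foldr U [k..<hi] (revE n M \<nu>)
      = (\<Sum>S\<in>admissible k hi \<nu>. Const (path_weight \<alpha> \<beta> k hi S y) * revE n M (config k hi S \<nu>))" .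
  have "parts_le n M (config k hi S \<nu>) \<and> (\<forall>j\<in>{1..n}. eta_bar n (config k hi S \<nu>) j = config k hi S y j)"
    if "S \<in> admissible k hi \<nu>" for S
  proof -
    from that consider (stay) S' where "S = insert k S'" "S' \<in> ?A" | (pass) "S \<in> ?A" "\<nu> k \<noteq> \<nu> (Min S)"
      unfolding admissible_step[OF k(2)] by blast
    then show ?thesis
    proof cases
      case stay
      then show ?thesis
        using IH' by (simp add: config_stay[OF k(2) S[OF stay(2)]])
    next
      case pass
      have "eta_bar n (swp k (config (Suc k) hi S \<nu>)) j = swp k (config (Suc k) hi S y) j" if j: "j \<in> {1..n}" for j
        using eta_bar_swp[OF k(1,3) _ j, of "config (Suc k) hi S \<nu>"] IH'(2)[OF pass(1)] pass k j
        by (auto simp: at swp_def)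
      then show ?thesis
        using IH'(1)[OF pass(1)] k by (simp add: config_pass[OF k(2) S[OF pass(1)]] parts_le_swp)
    qed
  qed
  then show ?case using 1 by (simp add: y_def)
qed

section \<open>The Pieri formula on the reversed basis\<close>

text \<open>The entry of \<open>v\<close> at the element of \<open>I\<close> that follows \<open>j\<close>, where the least element of \<open>I\<close>, with \<open>f\<close> applied, follows the
  greatest one.\<close>

definition nextv :: "nat set \<Rightarrow> ('a \<Rightarrow> 'a) \<Rightarrow> (nat \<Rightarrow> 'a) \<Rightarrow> nat \<Rightarrow> 'a" where
  "nextv I f v j = (if \<exists>k\<in>I. j < k then v (nx I j) else f (v (Min I)))"

text \<open>The two conditions of maximality in one, with the incremented first entry following the
  last one; agreement is \<open>maximal_sets_eq\<close>.\<close>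

definition max_sets :: "nat \<Rightarrow> (nat \<Rightarrow> nat) \<Rightarrow> nat set set" where
  "max_sets n \<nu> = {I. I \<noteq> {} \<and> I \<subseteq> {1..n} \<and> (\<forall>j\<in>{1..n} - I. \<nu> j \<noteq> nextv I Suc \<nu> j)}"

definition c_move :: "nat set \<Rightarrow> ('a \<Rightarrow> 'a) \<Rightarrow> (nat \<Rightarrow> 'a) \<Rightarrow> nat \<Rightarrow> 'a" where
  "c_move I f v j = (if j \<in> I then nextv I f v j else v j)"

text \<open>The effect of \<open>phi\<close> on spectral vectors (for \<open>f\<close> multiplication by \<open>q\<close>) and on compositions.\<close>

definition shift :: "nat \<Rightarrow> ('a \<Rightarrow> 'a) \<Rightarrow> (nat \<Rightarrow> 'a) \<Rightarrow> nat \<Rightarrow> 'a" where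
  "shift n f v j = (if j = n then f (v 1) else v (Suc j))"

lemma phi_eq_shift: "phi n \<nu> = shift n Suc \<nu>"
  by (simp add: phi_def shift_def fun_eq_iff flip: Suc_eq_plus1)

text \<open>The raising step moves positions down by one, so the elements of S2 are shifted back.
  Position n, which S2 always contains, is left out: it holds the raised entry that came from the
  least element of S1.\<close>

definition joined :: "nat \<Rightarrow> nat set \<Rightarrow> nat set \<Rightarrow> nat set" where
  "joined n S1 S2 = S1 \<union> Suc ` (S2 - {n})"

locale joined_paths =
  fixes n i :: nat and S1 S2 I :: "nat set"
  assumes i: "1 \<le> i" "i \<le> n"
    and S1: "S1 \<subseteq> {1..i}" "i \<in> S1" and S2: "S2 \<subseteq> {i..n}" "n \<in> S2"
    and I: "I = joined n S1 S2"
begin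

lemma fin: "finite S1" "finite S2" "finite I"
  using finite_subset[OF S1(1)] finite_subset[OF S2(1)] by (simp_all add: I joined_def)

lemma mem_le: "j \<le> i \<Longrightarrow> j \<in> I \<longleftrightarrow> j \<in> S1"
  using S2(1) by (auto simp: I joined_def)

lemma mem_gt: "i \<le> j \<Longrightarrow> Suc j \<in> I \<longleftrightarrow> j \<in> S2 \<and> j \<noteq> n"
  using S1(1) by (auto simp: I joined_def)

lemma I_sub: "I \<subseteq> {1..n}"
proof
  fix j assume "j \<in> I"
  then consider "j \<in> S1" | k where "j = Suc k" "k \<in> S2" "k \<noteq> n"
    by (auto simp: I joined_def)
  then show "j \<in> {1..n}"
  proof cases
    case 1
    then show ?thesis using S1(1) i by auto
  next
    case 2
    then have "k \<in> {i..n}" using S2(1) by auto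
    then show ?thesis using 2 by auto
  qed
qed

lemma Min_I: "Min I = Min S1"
proof (rule Min_eqI[OF fin(3)])
  show "Min S1 \<in> I"
    using Min_in[OF fin(1)] S1(2) by (auto simp: I joined_def)
  fix j assume "j \<in> I"
  then consider "j \<in> S1" | k where "j = Suc k" "k \<in> S2"
    by (auto simp: I joined_def)
  then show "Min S1 \<le> j"
  proof cases
    case 2
    then have "i \<le> k" using S2(1) by auto
    moreover have "Min S1 \<le> i" using fin(1) S1(2) by simp
    ultimately show ?thesis using 2 by simp
  qed (use fin(1) in simp)
qed

lemma nx_low:
  assumes "j < i"
  shows "nx I j = nx S1 j" "nextv I f v j = v (nx S1 j)"
proof -
  have n1: "nx S1 j \<in> S1" "j < nx S1 j" "nx S1 j \<le> i"
    using nx_in[OF fin(1) S1(2) assms] by auto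
  show eq: "nx I j = nx S1 j"
  proof (rule nx_eqI[OF fin(3)])
    show "nx S1 j \<in> I" using n1 by (simp add: I joined_def)
    fix l assume l: "l \<in> I" "j < l"
    show "nx S1 j \<le> l"
    proof (cases "l \<le> i")
      case True
      then have "l \<in> S1" using l mem_le by simp
      then show ?thesis using nx_in(3)[OF fin(1) _ l(2)] by simp
    qed (use n1 in simp)
  qed (rule n1(2))
  have "i \<in> I" "j < i" using S1(2) assms by (simp_all add: I joined_def)
  then have "\<exists>k\<in>I. j < k" by blast
  then show "nextv I f v j = v (nx S1 j)" by (simp add: nextv_def eq)
qed

text \<open>w stands for the vector after the raising step. The carried entry either is the one
  wrapped around to position n or comes from a further element of I.\<close>

lemma nx_high:
  assumes j: "i \<le> j" "j < n" and w: "\<And>k. i \<le> k \<Longrightarrow> k < n \<Longrightarrow> w k = v (Suc k)" "w n = f (v (Min S1))"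
  shows "w (nx S2 j) = nextv I f v (Suc j)"
proof -
  have n2: "nx S2 j \<in> S2" "j < nx S2 j" "nx S2 j \<le> n"
    using nx_in[OF fin(2) S2(2) j(2)] by auto
  have next_le: "nx S2 j \<le> k" if "Suc k \<in> I" "j < k" for k
  proof -
    have "k \<in> S2" using that j mem_gt[of k] by simp
    then show ?thesis using nx_in(3)[OF fin(2) _ that(2)] by simp
  qed
  show ?thesis
  proof (cases "nx S2 j = n")
    case True
    have "\<not> (\<exists>k\<in>I. Suc j < k)"
    proof
      assume "\<exists>k\<in>I. Suc j < k"
      then obtain k where k: "Suc k \<in> I" "j < k" by (metis Suc_less_eq2)
      then have "k \<noteq> n" "k \<in> S2" using mem_gt[of k] j by auto
      moreover have "k \<le> n" using \<open>k \<in> S2\<close> S2(1) by auto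
      ultimately show False using next_le[OF k] True by simp
    qed
    then show ?thesis using w(2) True by (simp add: nextv_def Min_I)
  next
    case False
    then have mI: "Suc (nx S2 j) \<in> I" using n2 by (auto simp: I joined_def)
    have "nx I (Suc j) = Suc (nx S2 j)"
    proof (rule nx_eqI[OF fin(3) mI])
      fix l assume l: "l \<in> I" "Suc j < l"
      then obtain k where "l = Suc k" "j < k" by (metis Suc_less_eq2)
      then show "Suc (nx S2 j) \<le> l" using next_le[of k] l by simp
    qed (use n2 in simp)
    moreover have "\<exists>k\<in>I. Suc j < k" using mI n2(2) by (intro bexI[of _ "Suc (nx S2 j)"]) auto
    ultimately show ?thesis using w(1)[of "nx S2 j"] n2 j False by (simp add: nextv_def)
  qed
qed

lemma Min_high:
  assumes w: "\<And>k. i \<le> k \<Longrightarrow> k < n \<Longrightarrow> w k = v (Suc k)" "w n = f (v (Min S1))"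
  shows "w (Min S2) = nextv I f v i"
proof -
  have m: "Min S2 \<in> S2" by (rule Min_in[OF fin(2)]) (use S2(2) in blast)
  then have m': "Min S2 \<le> n" "i \<le> Min S2" using S2(1) by auto
  note m = m m'
  have next_le: "Min S2 \<le> k" if "Suc k \<in> I" "i \<le> k" for k
    using that mem_gt[of k] fin(2) by simp
  show ?thesis
  proof (cases "Min S2 = n")
    case True
    have "\<not> (\<exists>k\<in>I. i < k)"
    proof
      assume "\<exists>k\<in>I. i < k"
      then obtain k where k: "Suc k \<in> I" "i \<le> k" by (metis Suc_le_D Suc_leI Suc_le_mono)
      then have "k \<noteq> n" "k \<in> S2" using mem_gt[of k] by auto
      moreover have "k \<le> n" using \<open>k \<in> S2\<close> S2(1) by auto
      ultimately show False using next_le[OF k] True by simp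
    qed
    then show ?thesis using w(2) True by (simp add: nextv_def Min_I)
  next
    case False
    then have mI: "Suc (Min S2) \<in> I" using m by (auto simp: I joined_def)
    have "nx I i = Suc (Min S2)"
    proof (rule nx_eqI[OF fin(3) mI])
      fix l assume l: "l \<in> I" "i < l"
      then obtain k where "l = Suc k" "i \<le> k" by (metis Suc_le_D Suc_leI Suc_le_mono)
      then show "Suc (Min S2) \<le> l" using next_le[of k] l by simp
    qed (use m in simp)
    moreover have "\<exists>k\<in>I. i < k" using mI m(3) by (intro bexI[of _ "Suc (Min S2)"]) auto
    ultimately show ?thesis using w(1)[of "Min S2"] m False by (simp add: nextv_def)
  qed
qed

lemma shift_config:
  "i \<le> k \<Longrightarrow> k < n \<Longrightarrow> shift n f (config 1 i S1 v) k = v (Suc k)"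
  "shift n f (config 1 i S1 v) n = f (v (Min S1))"
  using i by (auto simp: shift_def config_def)

lemma config_joined:
  assumes j: "j \<in> {1..n}"
  shows "config i n S2 (shift n f (config 1 i S1 v)) j = c_move I f v j"
proof -
  let ?w = "shift n f (config 1 i S1 v)"
  consider "j < i" | "j = i" | k where "j = Suc k" "i \<le> k" "k < n"
    using j by (metis Suc_le_D Suc_le_eq Suc_le_mono atLeastAtMost_iff linorder_cases less_imp_Suc_add not_less_eq_eq le_add1 add_Suc_right less_Suc_eq_le)
  then show ?thesis
  proof cases
    case 1
    then show ?thesis
      using i j nx_low(2)[OF 1, of f v] mem_le[of j] by (auto simp: config_def shift_def c_move_def)
  next
    case 2
    have "i \<in> I" using mem_le[of i] S1(2) by simp
    then show ?thesis
      using Min_high[of ?w v f, OF shift_config] i by (simp add: 2 config_def c_move_def)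
  next
    case 3
    have "config i n S2 ?w j = (if k \<in> S2 then ?w (nx S2 k) else ?w k)"
      using 3 by (simp add: config_def)
    moreover have "?w (nx S2 k) = nextv I f v j"
      unfolding 3(1) by (rule nx_high[of k ?w v f, OF 3(2,3) shift_config])
    moreover have "?w k = v j" using shift_config(1)[OF 3(2,3)] 3(1) by simp
    moreover have "k \<in> S2 \<longleftrightarrow> j \<in> I" using mem_gt[of k] 3 by simp
    ultimately show ?thesis by (simp add: c_move_def)
  qed
qed

end

text \<open>The position i ends the first path, hence lies in I and cuts it into the parts seen by
  the two paths. Each position outside I is subject to the condition of exactly one of them.\<close>

lemma joined_bij:
  assumes i: "1 \<le> i" "i \<le> n"
  defines "split \<equiv> \<lambda>I. (I \<inter> {1..i}, insert n {j. Suc j \<in> I \<and> i \<le> j})"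
  shows "(\<Sum>(S1, S2)\<in>(SIGMA S1:admissible 1 i \<nu>. admissible i n (phi n (config 1 i S1 \<nu>))). g (joined n S1 S2))
    = (\<Sum>I\<in>{I\<in>max_sets n \<nu>. i \<in> I}. g I)"
proof -
  let ?X = "SIGMA S1:admissible 1 i \<nu>. admissible i n (phi n (config 1 i S1 \<nu>))"
  have adm: "(S1, S2) \<in> ?X \<longleftrightarrow> joined n S1 S2 \<in> max_sets n \<nu>"
    if S: "S1 \<subseteq> {1..i}" "i \<in> S1" "S2 \<subseteq> {i..n}" "n \<in> S2" for S1 S2
  proof -
    interpret joined_paths n i S1 S2 "joined n S1 S2"
      by unfold_locales (use i S in auto)
    let ?I = "joined n S1 S2" and ?w = "phi n (config 1 i S1 \<nu>)"
    have w: "\<And>k. i \<le> k \<Longrightarrow> k < n \<Longrightarrow> ?w k = \<nu> (Suc k)" "?w n = Suc (\<nu> (Min S1))"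
      unfolding phi_eq_shift by (fact shift_config)+
    have low: "(\<forall>j\<in>{1..<i} - S1. \<nu> j \<noteq> \<nu> (nx S1 j)) \<longleftrightarrow> (\<forall>j\<in>{1..<i} - ?I. \<nu> j \<noteq> nextv ?I Suc \<nu> j)"
      using nx_low(2)[of _ Suc \<nu>] mem_le by (auto simp: less_imp_le)
    have high: "(\<forall>j\<in>{i..<n} - S2. ?w j \<noteq> ?w (nx S2 j)) \<longleftrightarrow> (\<forall>j\<in>{Suc i..n} - ?I. \<nu> j \<noteq> nextv ?I Suc \<nu> j)"
    proof
      assume A: "\<forall>j\<in>{i..<n} - S2. ?w j \<noteq> ?w (nx S2 j)"
      show "\<forall>j\<in>{Suc i..n} - ?I. \<nu> j \<noteq> nextv ?I Suc \<nu> j"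
      proof
        fix j assume j: "j \<in> {Suc i..n} - ?I"
        then obtain k where k: "j = Suc k" by (cases j) auto
        then have "i \<le> k" "k < n" "k \<notin> S2" using j mem_gt[of k] by auto
        moreover from this have "?w k \<noteq> ?w (nx S2 k)" using A by simp
        ultimately show "\<nu> j \<noteq> nextv ?I Suc \<nu> j"
          using w(1)[of k] nx_high[of k ?w \<nu> Suc, OF _ _ w] k by simp
      qed
    next
      assume A: "\<forall>j\<in>{Suc i..n} - ?I. \<nu> j \<noteq> nextv ?I Suc \<nu> j"
      show "\<forall>j\<in>{i..<n} - S2. ?w j \<noteq> ?w (nx S2 j)"
      proof
        fix j assume j: "j \<in> {i..<n} - S2"
        then have "Suc j \<in> {Suc i..n} - ?I" using mem_gt[of j] by auto
        then have "\<nu> (Suc j) \<noteq> nextv ?I Suc \<nu> (Suc j)" using A by blast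
        then show "?w j \<noteq> ?w (nx S2 j)"
          using j w(1)[of j] nx_high[of j ?w \<nu> Suc, OF _ _ w] by auto
      qed
    qed
    have iI: "i \<in> ?I" using mem_le[of i] S(2) by simp
    have "{1..n} - ?I = ({1..<i} - ?I) \<union> ({Suc i..n} - ?I)"
    proof -
      have "{1..n} = {1..<i} \<union> {i} \<union> {Suc i..n}" using i by auto
      then show ?thesis using iI by auto
    qed
    then have "joined n S1 S2 \<in> max_sets n \<nu> \<longleftrightarrow>
        (\<forall>j\<in>{1..<i} - ?I. \<nu> j \<noteq> nextv ?I Suc \<nu> j) \<and> (\<forall>j\<in>{Suc i..n} - ?I. \<nu> j \<noteq> nextv ?I Suc \<nu> j)"
      using I_sub iI unfolding max_sets_def by (auto simp: ball_Un)
    then show ?thesis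
      using S unfolding admissible_def by (simp only: low high mem_Sigma_iff mem_Collect_eq simp_thms)
  qed
  have shape: "S1 \<subseteq> {1..i} \<and> i \<in> S1 \<and> S2 \<subseteq> {i..n} \<and> n \<in> S2" if "(S1, S2) \<in> ?X" for S1 S2
    using that by (auto simp: admissible_def)
  have inv: "joined n (fst (split I)) (snd (split I)) = I" if "I \<subseteq> {1..n}" for I
  proof (rule set_eqI)
    fix j
    show "j \<in> joined n (fst (split I)) (snd (split I)) \<longleftrightarrow> j \<in> I"
    proof (cases "j \<le> i")
      case True
      then show ?thesis using that by (auto simp: joined_def split_def)
    next
      case False
      then obtain k where k: "j = Suc k" "i \<le> k" by (cases j) auto
      then show ?thesis using that i by (auto simp: joined_def split_def)
    qed
  qed
  have inv': "split (joined n S1 S2) = (S1, S2)"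
    if S: "S1 \<subseteq> {1..i}" "i \<in> S1" "S2 \<subseteq> {i..n}" "n \<in> S2" for S1 S2
  proof -
    interpret joined_paths n i S1 S2 "joined n S1 S2"
      by unfold_locales (use i S in auto)
    have "joined n S1 S2 \<inter> {1..i} = S1" using mem_le S(1) by auto
    moreover have "insert n {j. Suc j \<in> joined n S1 S2 \<and> i \<le> j} = S2"
    proof (rule set_eqI)
      fix j show "j \<in> insert n {j. Suc j \<in> joined n S1 S2 \<and> i \<le> j} \<longleftrightarrow> j \<in> S2"
        using mem_gt[of j] S(3,4) by (cases "i \<le> j") auto
    qed
    ultimately show ?thesis by (simp add: split_def)
  qed
  have sub: "I \<subseteq> {1..n}" if "I \<in> max_sets n \<nu>" for I
    using that by (simp add: max_sets_def)
  have shape': "fst (split I) \<subseteq> {1..i} \<and> i \<in> fst (split I) \<and> snd (split I) \<subseteq> {i..n} \<and> n \<in> snd (split I)"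
    if "I \<subseteq> {1..n}" "i \<in> I" for I
  proof -
    have "j \<in> {i..n}" if "Suc j \<in> I" "i \<le> j" for j
      using that \<open>I \<subseteq> {1..n}\<close> by force
    then show ?thesis using that i by (auto simp: split_def)
  qed
  show ?thesis
  proof (rule sum.reindex_bij_witness[of _ split "\<lambda>(S1, S2). joined n S1 S2"])
    fix I assume "I \<in> {I \<in> max_sets n \<nu>. i \<in> I}"
    then have I: "I \<in> max_sets n \<nu>" "i \<in> I" "I \<subseteq> {1..n}" using sub by auto
    show "(case split I of (S1, S2) \<Rightarrow> joined n S1 S2) = I"
      using inv[OF I(3)] by (simp add: case_prod_beta)
    have "(fst (split I), snd (split I)) \<in> ?X \<longleftrightarrow> joined n (fst (split I)) (snd (split I)) \<in> max_sets n \<nu>"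
      by (rule adm) (use shape'[OF I(3,2)] in blast)+
    then have "(fst (split I), snd (split I)) \<in> ?X"
      by (simp only: inv[OF I(3)] I(1))
    then show "split I \<in> ?X" by simp
  next
    fix p assume p: "p \<in> ?X"
    obtain S1 S2 where p': "p = (S1, S2)" by fastforce
    have S: "S1 \<subseteq> {1..i}" "i \<in> S1" "S2 \<subseteq> {i..n}" "n \<in> S2" using shape[of S1 S2] p p' by auto
    show "split (case p of (S1, S2) \<Rightarrow> joined n S1 S2) = p"
      using inv'[OF S] by (simp add: p')
    have "i \<in> joined n S1 S2" using S(2) by (simp add: joined_def)
    then show "(case p of (S1, S2) \<Rightarrow> joined n S1 S2) \<in> {I \<in> max_sets n \<nu>. i \<in> I}"
      using adm[OF S] p by (simp add: p')
    show "g (case p of (S1, S2) \<Rightarrow> joined n S1 S2) = (case p of (S1, S2) \<Rightarrow> g (joined n S1 S2))"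
      by (simp add: p')
  qed
qed

section \<open>Reindexing along the cyclic order of I\<close>

lemma nx_bij_betw:
  assumes fin: "finite I" and i: "i \<in> I"
  shows "bij_betw (nx I) {j\<in>I. i \<le> j \<and> j < Max I} {j\<in>I. i < j}"
proof (rule bij_betw_imageI)
  have M: "Max I \<in> I" using fin i by (intro Max_in) auto
  show "inj_on (nx I) {j\<in>I. i \<le> j \<and> j < Max I}"
  proof (rule inj_onI)
    fix j k assume jk: "j \<in> {j\<in>I. i \<le> j \<and> j < Max I}" "k \<in> {j\<in>I. i \<le> j \<and> j < Max I}" "nx I j = nx I k"
    have "\<not> j < k" using nx_in(3)[OF fin, of k j] nx_in(2)[OF fin M, of k] jk by auto
    moreover have "\<not> k < j" using nx_in(3)[OF fin, of j k] nx_in(2)[OF fin M, of j] jk by auto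
    ultimately show "j = k" by simp
  qed
  show "nx I ` {j\<in>I. i \<le> j \<and> j < Max I} = {j\<in>I. i < j}"
  proof (intro set_eqI iffI)
    fix l assume "l \<in> nx I ` {j\<in>I. i \<le> j \<and> j < Max I}"
    then obtain j where "j \<in> I" "i \<le> j" "j < Max I" "l = nx I j" by auto
    then show "l \<in> {j\<in>I. i < j}" using nx_in(1,2)[OF fin M, of j] by auto
  next
    fix l assume l: "l \<in> {j\<in>I. i < j}"
    define j where "j = Max {k\<in>I. k < l}"
    have j: "j \<in> {k\<in>I. k < l}" unfolding j_def by (rule Max_in) (use fin i l in auto)
    have max: "k \<le> j" if "k \<in> I" "k < l" for k
      unfolding j_def by (rule Max_ge) (use fin that in auto)
    have "nx I j = l"
      by (rule nx_eqI[OF fin]) (use l j max in \<open>auto simp: not_less[symmetric]\<close>)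
    moreover have "i \<le> j" using max[of i] i l by simp
    moreover have "j < Max I"
      using j l Max_ge[OF fin, of l] by auto
    ultimately show "l \<in> nx I ` {j\<in>I. i \<le> j \<and> j < Max I}" using j by force
  qed
qed

lemma nextv_below_Max:
  assumes "finite I" "I \<noteq> {}" "j < Max I"
  shows "nextv I f v j = v (nx I j)"
proof -
  have "\<exists>k\<in>I. j < k" using Max_in[OF assms(1,2)] assms(3) by blast
  then show ?thesis by (simp add: nextv_def)
qed

lemma nextv_Max:
  assumes "finite I" "Max I \<le> j"
  shows "nextv I f v j = f (v (Min I))"
proof -
  have "\<not> j < k" if "k \<in> I" for k
    using Max_ge[OF assms(1) that] assms(2) by simp
  then show ?thesis by (auto simp: nextv_def)
qed

text \<open>Passing to the next element removes i from the range and appends the wrapped-around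
  least element. The product form collapses the factors above i; the sum form, with i the minimum,
  makes the final sum telescope.\<close>

lemma nextv_reindex:
  fixes h :: "'a \<Rightarrow> 'b::comm_monoid_mult" and h' :: "'a \<Rightarrow> 'c::comm_monoid_add"
  assumes fin: "finite I" and i: "i \<in> I"
  shows prod_nextv: "(\<Prod>j\<in>{j\<in>I. i \<le> j}. h (nextv I f v j)) = h (f (v (Min I))) * (\<Prod>j\<in>{j\<in>I. i < j}. h (v j))"
    and sum_nextv: "(\<Sum>j\<in>{j\<in>I. i \<le> j}. h' (nextv I f v j)) = h' (f (v (Min I))) + (\<Sum>j\<in>{j\<in>I. i < j}. h' (v j))"
proof -
  have ne: "I \<noteq> {}" using i by auto
  have M: "Max I \<in> I" by (rule Max_in[OF fin ne])
  have iM: "i \<le> Max I" using fin i by simp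
  have split: "{j\<in>I. i \<le> j} = insert (Max I) {j\<in>I. i \<le> j \<and> j < Max I}"
    using M iM Max_ge[OF fin] by (auto simp: le_less)
  have nm: "Max I \<notin> {j\<in>I. i \<le> j \<and> j < Max I}" "finite {j\<in>I. i \<le> j \<and> j < Max I}"
    using fin by auto
  have last: "nextv I f v (Max I) = f (v (Min I))" by (rule nextv_Max[OF fin order_refl])
  have "(\<Prod>j\<in>{j\<in>I. i \<le> j \<and> j < Max I}. h (nextv I f v j)) = (\<Prod>j\<in>{j\<in>I. i \<le> j \<and> j < Max I}. h (v (nx I j)))"
    by (rule prod.cong) (auto simp: nextv_below_Max[OF fin ne])
  also have "\<dots> = (\<Prod>j\<in>{j\<in>I. i < j}. h (v j))"
    by (rule prod.reindex_bij_betw[OF nx_bij_betw[OF fin i]])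
  finally show "(\<Prod>j\<in>{j\<in>I. i \<le> j}. h (nextv I f v j)) = h (f (v (Min I))) * (\<Prod>j\<in>{j\<in>I. i < j}. h (v j))"
    unfolding split using nm by (simp add: last)
  have "(\<Sum>j\<in>{j\<in>I. i \<le> j \<and> j < Max I}. h' (nextv I f v j)) = (\<Sum>j\<in>{j\<in>I. i \<le> j \<and> j < Max I}. h' (v (nx I j)))"
    by (rule sum.cong) (auto simp: nextv_below_Max[OF fin ne])
  also have "\<dots> = (\<Sum>j\<in>{j\<in>I. i < j}. h' (v j))"
    by (rule sum.reindex_bij_betw[OF nx_bij_betw[OF fin i]])
  finally show "(\<Sum>j\<in>{j\<in>I. i \<le> j}. h' (nextv I f v j)) = h' (f (v (Min I))) + (\<Sum>j\<in>{j\<in>I. i < j}. h' (v j))"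
    unfolding split using nm by (simp add: last)
qed

section \<open>Coefficients for a single x_i\<close>

definition pieri_factor :: "nat \<Rightarrow> nat \<Rightarrow> nat set \<Rightarrow> (nat \<Rightarrow> nat) \<Rightarrow> (nat \<Rightarrow> qt) \<Rightarrow> qt" where
  "pieri_factor n i I \<nu> y =
     (\<Prod>j\<in>{1..<i}. if j \<in> I then a_hat (y j) (nextv I ((*) qvar) y j) else b_hat (nextv I ((*) qvar) y j) (y j)) *
     (qvar ^ \<nu> (Min I) * (1 - qvar * tvar ^ (n - 1) * y (Min I)) / y (Min I)) *
     (\<Prod>j\<in>{Suc i..n}. if j \<in> I then - inverse tvar * a_hat (nextv I ((*) qvar) y j) (y j)
        else inverse tvar * b_hat (nextv I ((*) qvar) y j) (y j))"

text \<open>What the coefficients of I for the different i in I share. The power of t - 1 is one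
  below the cardinality because the position i itself contributes no a_hat.\<close>

definition pieri_common :: "nat \<Rightarrow> nat set \<Rightarrow> (nat \<Rightarrow> nat) \<Rightarrow> (nat \<Rightarrow> qt) \<Rightarrow> qt" where
  "pieri_common n I \<nu> y =
     (tvar - 1) ^ (card I - 1) * qvar ^ (\<nu> (Min I) + 1) * (1 - qvar * tvar ^ (n - 1) * y (Min I)) *
     (\<Prod>j\<in>I. y j / (y j - nextv I ((*) qvar) y j)) *
     (\<Prod>j\<in>{1..n} - I. b_hat (nextv I ((*) qvar) y j) (y j))"

text \<open>Above i the inverse generators contribute extra factors m_j/y_j, whose product over I
  collapses to q y_min/m_i, and y_min cancels. Completing the product of the y_j/(y_j - m_j) by the
  absent index i costs (y_i - m_i)/y_i; together this is 1/m_i - 1/y_i.\<close>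

lemma pieri_factor_eq:
  assumes I: "I \<subseteq> {1..n}" "i \<in> I" and nz: "\<And>j. j \<in> {1..n} \<Longrightarrow> y j \<noteq> 0"
    and ne: "\<And>j. j \<in> I \<Longrightarrow> y j \<noteq> nextv I ((*) qvar) y j"
  shows "tvar ^ (n - i) * pieri_factor n i I \<nu> y =
    pieri_common n I \<nu> y * (1 / nextv I ((*) qvar) y i - 1 / y i)"
proof -
  define m where "m = nextv I ((*) qvar) y"
  define g where "g j = y j / (y j - m j)" for j
  define b where "b j = b_hat (m j) (y j)" for j
  define A where "A j = (if j \<in> I then (tvar - 1) * g j else b j)" for j
  define Y where "Y = y (Min I)"
  have fin: "finite I" using I(1) by (rule finite_subset) simp
  have i: "1 \<le> i" "i \<le> n" using I by auto
  have Min: "Min I \<in> I" using fin I(2) by (intro Min_in) auto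
  have Max: "Max I \<in> I" using fin I(2) by (intro Max_in) auto
  have Y0: "Y \<noteq> 0" using nz Min I(1) by (auto simp: Y_def)
  have y0: "y k \<noteq> 0" if "k \<in> I" for k
    using nz[of k] I(1) that by blast
  have m0: "m j \<noteq> 0" for j
  proof (cases "\<exists>k\<in>I. j < k")
    case True
    then obtain k where "k \<in> I" "j < k" by blast
    then have "nx I j \<in> I" by (rule nx_in(1)[OF fin])
    then show ?thesis using True y0 by (simp add: m_def nextv_def)
  next
    case False
    then have "m j = qvar * y (Min I)" by (simp only: m_def nextv_def if_False)
    then show ?thesis using y0[OF Min] by simp
  qed
  have ne': "y j - m j \<noteq> 0" if "j \<in> I" for j
    using ne[OF that] by (simp add: m_def)
  have low: "(\<Prod>j\<in>{1..<i}. if j \<in> I then a_hat (y j) (m j) else b_hat (m j) (y j)) = (\<Prod>j\<in>{1..<i}. A j)"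
    by (rule prod.cong) (auto simp: A_def g_def b_def a_hat_def)
  have "(\<Prod>j\<in>{Suc i..n}. if j \<in> I then - inverse tvar * a_hat (m j) (y j) else inverse tvar * b_hat (m j) (y j))
      = (\<Prod>j\<in>{Suc i..n}. inverse tvar * (A j * (if j \<in> I then m j / y j else 1)))"
  proof (rule prod.cong[OF refl])
    fix j assume j: "j \<in> {Suc i..n}"
    have ah: "- a_hat (m j) (y j) = (tvar - 1) * g j * (m j / y j)" if "j \<in> I"
    proof -
      show ?thesis
        unfolding a_hat_def minus_divide_right minus_diff_eq
        using ne'[OF that] nz[of j] j i by (simp add: g_def)
    qed
    show "(if j \<in> I then - inverse tvar * a_hat (m j) (y j) else inverse tvar * b_hat (m j) (y j))
      = inverse tvar * (A j * (if j \<in> I then m j / y j else 1))"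
    proof (cases "j \<in> I")
      case True
      then show ?thesis
        by (simp only: A_def if_True ah[OF True, symmetric] mult_minus_left mult_minus_right)
    qed (simp add: A_def b_def)
  qed
  also have "\<dots> = inverse tvar ^ (n - i) * (\<Prod>j\<in>{Suc i..n}. A j) * (\<Prod>j\<in>{Suc i..n}. if j \<in> I then m j / y j else 1)"
    by (simp add: prod.distrib)
  also have "(\<Prod>j\<in>{Suc i..n}. if j \<in> I then m j / y j else 1) = (\<Prod>j\<in>{j\<in>I. i < j}. m j / y j)"
  proof -
    have "{j \<in> {Suc i..n}. j \<in> I} = {j\<in>I. i < j}" using I(1) by auto
    then show ?thesis by (simp flip: prod.inter_filter)
  qed
  also have "(\<Prod>j\<in>{j\<in>I. i < j}. m j / y j) = qvar * Y / m i"
  proof -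
    have "(\<Prod>j\<in>{j\<in>I. i \<le> j}. m j) = qvar * Y * (\<Prod>j\<in>{j\<in>I. i < j}. y j)"
      unfolding m_def Y_def using prod_nextv[OF fin I(2), of "\<lambda>x. x" "(*) qvar" y] by simp
    moreover have "{j\<in>I. i \<le> j} = insert i {j\<in>I. i < j}" using I(2) by auto
    ultimately have "m i * (\<Prod>j\<in>{j\<in>I. i < j}. m j) = qvar * Y * (\<Prod>j\<in>{j\<in>I. i < j}. y j)"
      using fin by simp
    moreover have "(\<Prod>j\<in>{j\<in>I. i < j}. y j) \<noteq> 0"
      using fin nz I(1) by auto
    ultimately show ?thesis
      using m0[of i] by (simp add: prod_dividef field_simps)
  qed
  finally have high: "(\<Prod>j\<in>{Suc i..n}. if j \<in> I then - inverse tvar * a_hat (m j) (y j) else inverse tvar * b_hat (m j) (y j))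
      = inverse tvar ^ (n - i) * (\<Prod>j\<in>{Suc i..n}. A j) * (qvar * Y / m i)" .
  have AA: "(\<Prod>j\<in>{1..<i}. A j) * (\<Prod>j\<in>{Suc i..n}. A j)
      = (tvar - 1) ^ (card I - 1) * (\<Prod>j\<in>I - {i}. g j) * (\<Prod>j\<in>{1..n} - I. b j)"
  proof -
    have "(\<Prod>j\<in>{1..<i}. A j) * (\<Prod>j\<in>{Suc i..n}. A j) = (\<Prod>j\<in>{1..<i} \<union> {Suc i..n}. A j)"
      by (rule prod.union_disjoint[symmetric]) auto
    also have "{1..<i} \<union> {Suc i..n} = {1..n} - {i}"
      using i by auto
    also have "{1..n} - {i} = (I - {i}) \<union> ({1..n} - I)"
      using I by auto
    also have "(\<Prod>j\<in>\<dots>. A j) = (\<Prod>j\<in>I - {i}. A j) * (\<Prod>j\<in>{1..n} - I. A j)"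
      by (rule prod.union_disjoint) (use fin in auto)
    also have "(\<Prod>j\<in>I - {i}. A j) = (\<Prod>j\<in>I - {i}. (tvar - 1) * g j)"
      by (rule prod.cong) (auto simp: A_def)
    also have "\<dots> = (tvar - 1) ^ (card I - 1) * (\<Prod>j\<in>I - {i}. g j)"
      using fin I(2) by (simp add: prod.distrib)
    also have "(\<Prod>j\<in>{1..n} - I. A j) = (\<Prod>j\<in>{1..n} - I. b j)"
      by (rule prod.cong) (auto simp: A_def)
    finally show ?thesis .
  qed
  define Q where "Q = 1 - qvar * tvar ^ (n - 1) * Y"
  define G where "G = (\<Prod>j\<in>I - {i}. g j)"
  define P1 P2 where "P1 = (\<Prod>j\<in>{1..<i}. A j)" and "P2 = (\<Prod>j\<in>{Suc i..n}. A j)"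
  have prodg: "(\<Prod>j\<in>I. g j) = y i / (y i - m i) * G"
    using prod.remove[OF fin I(2), of g] by (simp add: G_def g_def)
  have t: "tvar ^ (n - i) * inverse tvar ^ (n - i) = 1"
    by (simp flip: power_mult_distrib)
  have pf: "pieri_factor n i I \<nu> y = P1 * (qvar ^ \<nu> (Min I) * Q / Y) * (inverse tvar ^ (n - i) * P2 * (qvar * Y / m i))"
    unfolding pieri_factor_def m_def[symmetric] low high Y_def[symmetric] Q_def P1_def P2_def ..
  have pc: "pieri_common n I \<nu> y
      = (tvar - 1) ^ (card I - 1) * qvar ^ (\<nu> (Min I) + 1) * Q * (\<Prod>j\<in>I. g j) * (\<Prod>j\<in>{1..n} - I. b j)"
    unfolding pieri_common_def m_def[symmetric] Y_def[symmetric] Q_def g_def b_def ..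
  have "tvar ^ (n - i) * pieri_factor n i I \<nu> y
      = (tvar ^ (n - i) * inverse tvar ^ (n - i)) * (P1 * P2) * (qvar ^ \<nu> (Min I) * Q / Y * (qvar * Y / m i))"
    unfolding pf by (simp only: mult_ac)
  also have "\<dots> = (P1 * P2) * (qvar ^ (\<nu> (Min I) + 1) * Q / m i)"
    using Y0 by (simp add: t power_add)
  also have "\<dots> = (tvar - 1) ^ (card I - 1) * G * (\<Prod>j\<in>{1..n} - I. b j) * (qvar ^ (\<nu> (Min I) + 1) * Q / m i)"
    unfolding P1_def P2_def AA G_def ..
  also have "\<dots> = pieri_common n I \<nu> y * ((y i - m i) / (m i * y i))"
    unfolding pc prodg using ne'[OF I(2)] nz[of i] i m0[of i] by (simp add: field_simps)
  also have "(y i - m i) / (m i * y i) = 1 / m i - 1 / y i"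
    using nz[of i] i m0[of i] by (simp add: field_simps)
  finally show ?thesis by (simp add: m_def)
qed

lemma d'_cong:
  assumes "\<And>j. j \<in> {1..n} \<Longrightarrow> \<nu> j = \<nu>' j"
  shows "d' n \<nu> = d' n \<nu>'"
proof -
  have "leg n \<nu> i j = leg n \<nu>' i j" if "i \<in> {1..n}" for i j
    unfolding leg_eq_sum by (rule sum.cong) (use assms that in \<open>auto simp: in_leg_def\<close>)
  then show ?thesis
    unfolding d'_def by (intro prod.cong) (use assms in \<open>auto simp: arm_def\<close>)
qed

lemma revE_cong:
  assumes "1 \<le> n" "\<And>j. j \<in> {1..n} \<Longrightarrow> \<nu> j = \<nu>' j"
  shows "revE n M \<nu> = revE n M \<nu>'"
proof -
  have "nonsym_macdonald n (compl_rev n M \<nu>) = nonsym_macdonald n (compl_rev n M \<nu>')"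
  proof (rule nonsym_macdonald_cong[OF assms(1)])
    fix j assume "j \<in> {1..n}"
    then have "n + 1 - j \<in> {1..n}" by auto
    then show "compl_rev n M \<nu> j = compl_rev n M \<nu>' j"
      by (simp only: compl_rev_apply assms(2))
  qed
  then show ?thesis
    using d'_cong[of n \<nu> \<nu>'] assms(2) by (simp add: revE_def)
qed

text \<open>After \<open>coprod_Z_revE\<close> the outer product cancels the first i - 1 inverses.
  What remains is a path on the positions 1 to i, the raising step, and a path on the positions i to
  n.\<close>

lemma coprod_Z_revE_expansion:
  assumes i: "1 \<le> i" "i \<le> n" and bound: "parts_le n M \<nu>"
  shows "Const (tvar ^ (i - 1)) * (coprod_Z n (n + 1 - i) * revE n M \<nu>) =
    (\<Sum>I\<in>{I\<in>max_sets n \<nu>. i \<in> I}.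
       Const (pieri_factor n i I \<nu> (eta_bar n \<nu>)) * revE n (M + 1) (c_move I Suc \<nu>))"
proof -
  define y where "y = eta_bar n \<nu>"
  define T where "T k = T_op (n - k)" for k
  define R where "R k = T_inv (n - k)" for k
  define \<kappa> where "\<kappa> S = config 1 i S \<nu>" for S
  define w1 where "w1 S = path_weight a_hat 1 1 i S y" for S
  define c where "c \<mu> = qvar ^ \<mu> 1 * (1 - qvar * tvar ^ (n - 1) * eta_bar n \<mu> 1) / eta_bar n \<mu> 1" for \<mu>
  define \<alpha> where "\<alpha> x y = - inverse tvar * a_hat y x" for x y
  define w2 where "w2 S1 S2 = path_weight \<alpha> (inverse tvar) i n S2 (eta_bar n (phi n (\<kappa> S1)))" for S1 S2
  let ?A1 = "admissible 1 i \<nu>" and ?A2 = "\<lambda>S1. admissible i n (phi n (\<kappa> S1))"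
  have n: "1 \<le> n" using i by simp
  have Tlin: "foldr T xs (f + g) = foldr T xs f + foldr T xs g" "foldr T xs (Const a * f) = Const a * foldr T xs f"
    for xs a f g
    by (induction xs) (simp_all add: T_def T_op_add T_op_Const)
  have T0: "foldr T xs 0 = 0" for xs using Tlin(2)[of xs 0 0] by (simp add: Const_simps)
  have Tsum: "foldr T xs (sum g A) = (\<Sum>x\<in>A. foldr T xs (g x))" if "finite A" for xs g and A :: "nat set set"
    using that by (induction A) (simp_all add: T0 Tlin)
  have Rlin: "foldr R xs (Const a * f) = Const a * foldr R xs f" for xs a f
    by (induction xs) (simp_all add: R_def T_inv_Const)
  have cancel: "foldr T (rev [1..<i]) (foldr R [1..<n] f) = foldr R [i..<n] f" for f
  proof -
    have "foldr T (rev xs) (foldr R xs g) = g" for xs g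
      by (induction xs arbitrary: g) (simp_all add: T_def R_def)
    then show ?thesis using upt_split[OF i] by simp
  qed
  have path1: "foldr T [1..<i] (revE n M \<nu>) = (\<Sum>S\<in>?A1. Const (w1 S) * revE n M (\<kappa> S))"
    and path1': "\<And>S. S \<in> ?A1 \<Longrightarrow> parts_le n M (\<kappa> S)"
      "\<And>S j. S \<in> ?A1 \<Longrightarrow> j \<in> {1..n} \<Longrightarrow> eta_bar n (\<kappa> S) j = config 1 i S y j"
    using operator_path[of 1 i n M \<nu> T a_hat 1] i bound
    by (simp_all add: T_def T_op_add T_op_Const T_op_revE w1_def \<kappa>_def y_def)
  have path2: "foldr R [i..<n] (revE n (M + 1) (phi n (\<kappa> S1))) =
      (\<Sum>S2\<in>?A2 S1. Const (w2 S1 S2) * revE n (M + 1) (config i n S2 (phi n (\<kappa> S1))))" if S1: "S1 \<in> ?A1" for S1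
  proof -
    have "parts_le n (M + 1) (phi n (\<kappa> S1))"
      unfolding parts_le_def
    proof
      fix j assume "j \<in> {1..n}"
      then show "phi n (\<kappa> S1) j \<le> M + 1"
        using parts_leD[OF path1'(1)[OF S1], of 1] parts_leD[OF path1'(1)[OF S1], of "j + 1"] n
        by (auto simp: phi_def)
    qed
    then show ?thesis
      using operator_path[of i n n "M + 1" "phi n (\<kappa> S1)" R \<alpha> "inverse tvar"] i
      by (simp add: R_def T_inv_add T_inv_Const T_inv_revE \<alpha>_def w2_def)
  qed
  have "Const (tvar ^ (i - 1)) * (coprod_Z n (n + 1 - i) * revE n M \<nu>)
      = foldr T (rev [1..<i]) (coprod_Z n n * foldr T [1..<i] (revE n M \<nu>))"
    unfolding T_def using foldr_T_op_coprod_Z[OF i, of "revE n M \<nu>"] by simp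
  also have "coprod_Z n n * foldr T [1..<i] (revE n M \<nu>)
      = (\<Sum>S\<in>?A1. Const (w1 S) * (Const (c (\<kappa> S)) * foldr R [1..<n] (revE n (M + 1) (phi n (\<kappa> S)))))"
    unfolding path1 sum_distrib_left
  proof (rule sum.cong[OF refl])
    fix S assume "S \<in> ?A1"
    then have "coprod_Z n n * revE n M (\<kappa> S) = Const (c (\<kappa> S)) * foldr R [1..<n] (revE n (M + 1) (phi n (\<kappa> S)))"
      unfolding c_def R_def by (intro coprod_Z_revE[OF n] path1'(1))
    then show "coprod_Z n n * (Const (w1 S) * revE n M (\<kappa> S))
        = Const (w1 S) * (Const (c (\<kappa> S)) * foldr R [1..<n] (revE n (M + 1) (phi n (\<kappa> S))))"
      by (simp add: mult.left_commute)
  qed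
  also have "foldr T (rev [1..<i]) \<dots>
      = (\<Sum>S\<in>?A1. Const (w1 S) * (Const (c (\<kappa> S)) * foldr R [i..<n] (revE n (M + 1) (phi n (\<kappa> S)))))"
    by (simp add: Tsum admissible_finite Tlin cancel)
  also have "\<dots> = (\<Sum>S1\<in>?A1. \<Sum>S2\<in>?A2 S1.
      Const (w1 S1 * c (\<kappa> S1) * w2 S1 S2) * revE n (M + 1) (config i n S2 (phi n (\<kappa> S1))))"
    by (rule sum.cong[OF refl]) (simp add: path2 sum_distrib_left Const_simps mult.assoc)
  also have "\<dots> = (\<Sum>(S1, S2)\<in>(SIGMA S1:?A1. ?A2 S1).
      Const (w1 S1 * c (\<kappa> S1) * w2 S1 S2) * revE n (M + 1) (config i n S2 (phi n (\<kappa> S1))))"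
    by (rule sum.Sigma) (simp_all add: admissible_finite)
  also have "\<dots> = (\<Sum>(S1, S2)\<in>(SIGMA S1:?A1. ?A2 S1).
      Const (pieri_factor n i (joined n S1 S2) \<nu> y) * revE n (M + 1) (c_move (joined n S1 S2) Suc \<nu>))"
  proof (rule sum.cong[OF refl], clarify)
    fix S1 S2 assume S: "S1 \<in> ?A1" "S2 \<in> ?A2 S1"
    let ?I = "joined n S1 S2"
    interpret joined_paths n i S1 S2 ?I
      by unfold_locales (use i S in \<open>auto simp: admissible_def\<close>)
    have rev: "revE n (M + 1) (config i n S2 (phi n (\<kappa> S1))) = revE n (M + 1) (c_move ?I Suc \<nu>)"
      by (rule revE_cong[OF n]) (simp only: \<kappa>_def phi_eq_shift config_joined)
    have \<kappa>1: "\<kappa> S1 1 = \<nu> (Min ?I)" "eta_bar n (\<kappa> S1) 1 = y (Min ?I)"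
      using path1'(2)[OF S(1), of 1] i n by (simp_all add: \<kappa>_def config_def Min_I)
    have 1: "w1 S1 = (\<Prod>j\<in>{1..<i}. if j \<in> ?I then a_hat (y j) (nextv ?I ((*) qvar) y j)
        else b_hat (nextv ?I ((*) qvar) y j) (y j))"
      unfolding w1_def path_weight_def
      by (rule prod.cong) (use mem_le nx_low(2)[of _ "(*) qvar" y] in \<open>auto simp: less_imp_le\<close>)
    define w where "w = shift n ((*) qvar) (config 1 i S1 y)"
    have w: "w k = y (Suc k)" if "i \<le> k" "k < n" for k
      unfolding w_def by (rule shift_config(1)[OF that])
    have w': "w n = qvar * y (Min S1)"
      unfolding w_def by (rule shift_config(2))
    have eb: "eta_bar n (phi n (\<kappa> S1)) j = w j" if "j \<in> {1..n}" for j
      using eta_bar_phi[OF that, of "\<kappa> S1"] path1'(2)[OF S(1), of 1] path1'(2)[OF S(1), of "j + 1"] that n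
      by (auto simp: w_def shift_def simp flip: Suc_eq_plus1)
    have "w2 S1 S2 = (\<Prod>j\<in>{i..<n}. if Suc j \<in> ?I
        then - inverse tvar * a_hat (nextv ?I ((*) qvar) y (Suc j)) (y (Suc j))
        else inverse tvar * b_hat (nextv ?I ((*) qvar) y (Suc j)) (y (Suc j)))"
      unfolding w2_def path_weight_def
    proof (rule prod.cong[OF refl])
      fix j assume j: "j \<in> {i..<n}"
      then have jn: "i \<le> j" "j < n" by auto
      have "nx S2 j \<in> S2" by (rule nx_in(1)[OF fin(2) S2(2) jn(2)])
      then have "nx S2 j \<in> {1..n}" using S2(1) i by auto
      then have "eta_bar n (phi n (\<kappa> S1)) (nx S2 j) = w (nx S2 j)" by (rule eb)
      also have "\<dots> = nextv ?I ((*) qvar) y (Suc j)"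
        by (rule nx_high[of j w y "(*) qvar", OF jn w w'])
      finally have "eta_bar n (phi n (\<kappa> S1)) (nx S2 j) = nextv ?I ((*) qvar) y (Suc j)" .
      moreover have "eta_bar n (phi n (\<kappa> S1)) j = y (Suc j)"
        using eb[of j] w[OF jn] jn i by simp
      moreover have "Suc j \<in> ?I \<longleftrightarrow> j \<in> S2" using mem_gt[OF jn(1)] jn by simp
      ultimately show "(if j \<in> S2 then \<alpha> (eta_bar n (phi n (\<kappa> S1)) j) (eta_bar n (phi n (\<kappa> S1)) (nx S2 j))
          else inverse tvar * b_hat (eta_bar n (phi n (\<kappa> S1)) (nx S2 j)) (eta_bar n (phi n (\<kappa> S1)) j))
        = (if Suc j \<in> ?I then - inverse tvar * a_hat (nextv ?I ((*) qvar) y (Suc j)) (y (Suc j))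
        else inverse tvar * b_hat (nextv ?I ((*) qvar) y (Suc j)) (y (Suc j)))"
        by (simp add: \<alpha>_def)
    qed
    also have "\<dots> = (\<Prod>j\<in>{Suc i..n}. if j \<in> ?I then - inverse tvar * a_hat (nextv ?I ((*) qvar) y j) (y j)
        else inverse tvar * b_hat (nextv ?I ((*) qvar) y j) (y j))"
      by (rule prod.reindex_bij_witness[of _ "\<lambda>j. j - 1" Suc]) auto
    finally have 2: "w2 S1 S2 = \<dots>" .
    show "Const (w1 S1 * c (\<kappa> S1) * w2 S1 S2) * revE n (M + 1) (config i n S2 (phi n (\<kappa> S1)))
      = Const (pieri_factor n i ?I \<nu> y) * revE n (M + 1) (c_move ?I Suc \<nu>)"
      unfolding rev 1 2 c_def \<kappa>1 pieri_factor_def ..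
  qed
  also have "\<dots> = (\<Sum>I\<in>{I\<in>max_sets n \<nu>. i \<in> I}.
       Const (pieri_factor n i I \<nu> y) * revE n (M + 1) (c_move I Suc \<nu>))"
    unfolding \<kappa>_def by (rule joined_bij[OF i])
  finally show ?thesis by (simp add: y_def)
qed

section \<open>Summation over i\<close>

lemma elem_sym_eq_sum_coprod_Z:
  assumes "1 \<le> n"
  shows "elem_sym n (n - 1) = (\<Sum>i=1..n. coprod_Z n i)"
proof -
  have "{S. S \<subseteq> {1..n} \<and> card S = n - 1} = (\<lambda>i. {1..n} - {i}) ` {1..n}"
  proof (intro set_eqI iffI)
    fix S assume S: "S \<in> {S. S \<subseteq> {1..n} \<and> card S = n - 1}"
    then have "card ({1..n} - S) = 1"
      using assms by (subst card_Diff_subset) (auto intro: finite_subset)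
    then obtain i where "{1..n} - S = {i}" by (auto simp: card_1_singleton_iff One_nat_def)
    then show "S \<in> (\<lambda>i. {1..n} - {i}) ` {1..n}" using S by blast
  qed auto
  moreover have "inj_on (\<lambda>i. {1..n} - {i}) {1..n}"
    by (rule inj_onI) blast
  ultimately show ?thesis
    by (simp add: elem_sym_def coprod_Z_def sum.reindex comp_def)
qed

text \<open>Equality would put \<nu>_j one above \<nu>_k at equal rank, while a larger part ranks
  strictly earlier. It keeps denominators nonzero where the cyclic order wraps around.\<close>

lemma eta_bar_ne_qvar_mult:
  assumes "j \<in> {1..n}" "k \<in> {1..n}"
  shows "eta_bar n \<nu> j \<noteq> qvar * eta_bar n \<nu> k"
proof
  assume eq: "eta_bar n \<nu> j = qvar * eta_bar n \<nu> k"
  have "qvar powi int (\<nu> j) * tvar powi (- int (leg' n \<nu> j))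
      = qvar powi int (\<nu> k + 1) * tvar powi (- int (leg' n \<nu> k))"
    using eq by (simp only: eta_bar_def power_int_of_nat power_add power_one_right mult_ac)
  then have "\<nu> j = \<nu> k + 1" "leg' n \<nu> j = leg' n \<nu> k"
    by (auto simp only: qvar_tvar_powi_eq_iff of_nat_eq_iff minus_equation_iff minus_minus neg_equal_iff_equal)
  then show False
    using leg'_less[of \<nu> j k n] assms by (simp add: ranks_before_def)
qed

lemma eta_bar_ne_nextv:
  assumes I: "I \<subseteq> {1..n}" and j: "j \<in> {1..n}"
    and I0: "I \<noteq> {}"
  shows "eta_bar n \<nu> j \<noteq> nextv I ((*) qvar) (eta_bar n \<nu>) j"
proof (cases "\<exists>k\<in>I. j < k")
  case True
  have fin: "finite I" using I by (rule finite_subset) simp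
  from True obtain k where "k \<in> I" "j < k" by blast
  then have "nx I j \<in> I" "j < nx I j" using nx_in[OF fin] by auto
  then have "eta_bar n \<nu> j \<noteq> eta_bar n \<nu> (nx I j)"
    using I j by (intro eta_bar_inj) auto
  then show ?thesis using True by (simp add: nextv_def)
next
  case False
  have "finite I" using I by (rule finite_subset) simp
  then have "Min I \<in> {1..n}" using I Min_in[OF _ I0] by blast
  then have "eta_bar n \<nu> j \<noteq> qvar * eta_bar n \<nu> (Min I)" by (rule eta_bar_ne_qvar_mult[OF j])
  moreover have "nextv I ((*) qvar) (eta_bar n \<nu>) j = qvar * eta_bar n \<nu> (Min I)"
    using False by (simp only: nextv_def if_False)
  ultimately show ?thesis by simp
qed

lemma filter_Min:
  fixes I :: "'a::linorder set"
  assumes "finite I"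
  shows "{j\<in>I. Min I \<le> j} = I" "{j\<in>I. Min I < j} = I - {Min I}"
proof -
  have "Min I \<le> j" if "j \<in> I" for j using assms that by (rule Min_le)
  then show "{j\<in>I. Min I \<le> j} = I" "{j\<in>I. Min I < j} = I - {Min I}"
    by (fastforce simp: less_le)+
qed

text \<open>The coefficient before inversion of the parameters. Its last factor is the telescoped
  sum of the 1/m_i - 1/y_i, of which the terms 1/(q y_min) and -1/y_min survive.\<close>

definition pieri_value :: "nat \<Rightarrow> (nat \<Rightarrow> nat) \<Rightarrow> nat set \<Rightarrow> qt" where
  "pieri_value n \<nu> I = inverse tvar ^ (n - 1) * pieri_common n I \<nu> (eta_bar n \<nu>) *
     ((inverse qvar - 1) / eta_bar n \<nu> (Min I))"

lemma elem_sym_revE: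
  assumes n: "1 \<le> n" and bound: "parts_le n M \<nu>"
  shows "elem_sym n (n - 1) * revE n M \<nu> =
    (\<Sum>I\<in>max_sets n \<nu>. Const (pieri_value n \<nu> I) * revE n (M + 1) (c_move I Suc \<nu>))"
proof -
  define y where "y = eta_bar n \<nu>"
  define m where "m I = nextv I ((*) qvar) y" for I
  define V where "V i I = inverse tvar ^ (n - 1) * pieri_common n I \<nu> y * (1 / m I i - 1 / y i)" for i I
  let ?G = "\<lambda>I. revE n (M + 1) (c_move I Suc \<nu>)"
  have fin: "finite (max_sets n \<nu>)"
    by (rule finite_subset[of _ "Pow {1..n}"]) (auto simp: max_sets_def)
  have sub: "I \<subseteq> {1..n}" "I \<noteq> {}" if "I \<in> max_sets n \<nu>" for I
    using that by (auto simp: max_sets_def)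
  have each: "coprod_Z n (n + 1 - i) * revE n M \<nu> = (\<Sum>I\<in>{I\<in>max_sets n \<nu>. i \<in> I}. Const (V i I) * ?G I)"
    if i: "i \<in> {1..n}" for i
  proof -
    have "coprod_Z n (n + 1 - i) * revE n M \<nu>
        = Const (inverse (tvar ^ (i - 1))) * (Const (tvar ^ (i - 1)) * (coprod_Z n (n + 1 - i) * revE n M \<nu>))"
      by (rule Const_inverse_cancel[symmetric]) simp
    also have "\<dots> = (\<Sum>I\<in>{I\<in>max_sets n \<nu>. i \<in> I}. Const (inverse (tvar ^ (i - 1)) * pieri_factor n i I \<nu> y) * ?G I)"
      using coprod_Z_revE_expansion[of i n M \<nu>] i bound
      by (simp add: sum_distrib_left Const_simps mult.assoc y_def)
    also have "\<dots> = (\<Sum>I\<in>{I\<in>max_sets n \<nu>. i \<in> I}. Const (V i I) * ?G I)"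
    proof (rule sum.cong[OF refl])
      fix I assume "I \<in> {I\<in>max_sets n \<nu>. i \<in> I}"
      then have I: "I \<in> max_sets n \<nu>" "i \<in> I" by auto
      have "tvar ^ (n - i) * pieri_factor n i I \<nu> y = pieri_common n I \<nu> y * (1 / m I i - 1 / y i)"
        unfolding m_def
        by (rule pieri_factor_eq[OF sub(1)[OF I(1)] I(2)])
          (use eta_bar_ne_nextv[OF sub(1)[OF I(1)] _ sub(2)[OF I(1)]] sub(1)[OF I(1)] in \<open>auto simp: y_def\<close>)
      moreover have "n - 1 = (i - 1) + (n - i)" using i by auto
      then have "inverse (tvar ^ (i - 1)) = inverse tvar ^ (n - 1) * tvar ^ (n - i)"
        by (simp add: power_add field_simps)
      ultimately have "inverse (tvar ^ (i - 1)) * pieri_factor n i I \<nu> y = V i I"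
        by (simp add: V_def mult.assoc)
      then show "Const (inverse (tvar ^ (i - 1)) * pieri_factor n i I \<nu> y) * ?G I = Const (V i I) * ?G I" by simp
    qed
    finally show ?thesis .
  qed
  have "elem_sym n (n - 1) * revE n M \<nu> = (\<Sum>i=1..n. coprod_Z n (n + 1 - i) * revE n M \<nu>)"
  proof -
    have "(\<Sum>i=1..n. coprod_Z n i) = (\<Sum>i=1..n. coprod_Z n (n + 1 - i))"
      by (rule sum.reindex_bij_witness[of _ "\<lambda>i. n + 1 - i" "\<lambda>i. n + 1 - i"]) auto
    then show ?thesis by (simp add: elem_sym_eq_sum_coprod_Z[OF n] sum_distrib_right)
  qed
  also have "\<dots> = (\<Sum>i=1..n. \<Sum>I\<in>{I\<in>max_sets n \<nu>. i \<in> I}. Const (V i I) * ?G I)"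
    by (rule sum.cong[OF refl]) (rule each)
  also have "\<dots> = (\<Sum>I\<in>max_sets n \<nu>. \<Sum>i\<in>{i\<in>{1..n}. i \<in> I}. Const (V i I) * ?G I)"
    by (rule sum.swap_restrict) (use fin in auto)
  also have "\<dots> = (\<Sum>I\<in>max_sets n \<nu>. Const (pieri_value n \<nu> I) * ?G I)"
  proof (rule sum.cong[OF refl])
    fix I assume I: "I \<in> max_sets n \<nu>"
    have finI: "finite I" using sub(1)[OF I] by (rule finite_subset) simp
    have Min: "Min I \<in> I" by (rule Min_in[OF finI sub(2)[OF I]])
    note eqs = filter_Min[OF finI]
    have "(\<Sum>i\<in>I. 1 / m I i) = 1 / (qvar * y (Min I)) + (\<Sum>i\<in>I - {Min I}. 1 / y i)"
      using sum_nextv[OF finI Min, of "\<lambda>x. 1 / x" "(*) qvar" y] unfolding m_def eqs .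
    moreover have "(\<Sum>i\<in>I. 1 / y i) = 1 / y (Min I) + (\<Sum>i\<in>I - {Min I}. 1 / y i)"
      by (rule sum.remove[OF finI Min])
    ultimately have "(\<Sum>i\<in>I. 1 / m I i - 1 / y i) = (inverse qvar - 1) / y (Min I)"
      unfolding sum_subtractf by (simp add: divide_inverse left_diff_distrib)
    then have "(\<Sum>i\<in>I. V i I) = pieri_value n \<nu> I"
      by (simp add: V_def pieri_value_def y_def flip: sum_distrib_left)
    moreover have "{i\<in>{1..n}. i \<in> I} = I" using sub(1)[OF I] by auto
    ultimately show "(\<Sum>i\<in>{i\<in>{1..n}. i \<in> I}. Const (V i I) * ?G I) = Const (pieri_value n \<nu> I) * ?G I"
      by (simp only: ring_hom_sum[OF ring_hom_Const, symmetric] flip: sum_distrib_right)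
  qed
  finally show ?thesis .
qed

section \<open>The coefficients of the Pieri formula\<close>

locale enumerated_set =
  fixes I :: "nat set" and n :: nat
  assumes I: "I \<subseteq> {1..n}" "I \<noteq> {}"
begin

lemma fin: "finite I"
  using I(1) by (rule finite_subset) simp

lemma nth_strict: "1 \<le> u \<Longrightarrow> u < v \<Longrightarrow> v \<le> card I \<Longrightarrow> nth_elem I u < nth_elem I v"
  unfolding nth_elem_def by (auto intro!: sorted_wrt_nth_less[OF strict_sorted_list_of_set])

lemma nth_in: "1 \<le> u \<Longrightarrow> u \<le> card I \<Longrightarrow> nth_elem I u \<in> I"
proof -
  assume u: "1 \<le> u" "u \<le> card I"
  then have "sorted_list_of_set I ! (u - 1) \<in> set (sorted_list_of_set I)"
    by (intro nth_mem) simp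
  then show ?thesis using u fin by (simp add: nth_elem_def)
qed

lemma nth_ex: "k \<in> I \<Longrightarrow> \<exists>u\<in>{1..card I}. k = nth_elem I u"
proof -
  assume "k \<in> I"
  then obtain l where "l < card I" "k = sorted_list_of_set I ! l"
    using fin by (metis in_set_conv_nth length_sorted_list_of_set set_sorted_list_of_set)
  then show ?thesis by (intro bexI[of _ "l + 1"]) (auto simp: nth_elem_def)
qed

lemma nth_bij: "bij_betw (nth_elem I) {1..card I} I"
proof (rule bij_betw_imageI)
  show "inj_on (nth_elem I) {1..card I}"
  proof (rule inj_onI)
    fix u v assume "u \<in> {1..card I}" "v \<in> {1..card I}" "nth_elem I u = nth_elem I v"
    then show "u = v"
      using nth_strict[of u v] nth_strict[of v u] by (cases u v rule: linorder_cases) auto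
  qed
  show "nth_elem I ` {1..card I} = I"
    using nth_in nth_ex by (auto simp: image_iff)
qed

lemma card_pos: "1 \<le> card I"
  using fin I(2) by (simp add: Suc_le_eq card_gt_0_iff One_nat_def)

lemma nth_mono: "1 \<le> u \<Longrightarrow> u \<le> v \<Longrightarrow> v \<le> card I \<Longrightarrow> nth_elem I u \<le> nth_elem I v"
  using nth_strict[of u v] by (cases "u = v") auto

lemma nth_1: "nth_elem I 1 = Min I"
proof (rule Min_eqI[OF fin, symmetric])
  show "nth_elem I 1 \<in> I" using nth_in card_pos by simp
  fix k assume "k \<in> I"
  then obtain u where "u \<in> {1..card I}" "k = nth_elem I u" using nth_ex by blast
  then show "nth_elem I 1 \<le> k" using nth_mono[of 1 u] by simp
qed

lemma nth_card: "nth_elem I (card I) = Max I"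
proof (rule Max_eqI[OF fin, symmetric])
  show "nth_elem I (card I) \<in> I" using nth_in card_pos by simp
  fix k assume "k \<in> I"
  then obtain u where "u \<in> {1..card I}" "k = nth_elem I u" using nth_ex by blast
  then show "k \<le> nth_elem I (card I)" using nth_mono[of u "card I"] by simp
qed

lemma nx_between:
  assumes u: "1 \<le> u" "u \<le> card I" and j: "j < nth_elem I u" "u = 1 \<or> nth_elem I (u - 1) \<le> j"
  shows "nx I j = nth_elem I u"
proof (rule nx_eqI[OF fin nth_in[OF u] j(1)])
  fix l assume l: "l \<in> I" "j < l"
  then obtain v where v: "v \<in> {1..card I}" "l = nth_elem I v" using nth_ex by blast
  have "\<not> v < u"
  proof
    assume "v < u"
    then have "nth_elem I v \<le> nth_elem I (u - 1)" using nth_mono[of v "u - 1"] v u by auto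
    then show False using l v j(2) \<open>v < u\<close> by auto
  qed
  then show "nth_elem I u \<le> l" using nth_mono[of u v] v u by simp
qed

lemma nx_nth: "1 \<le> u \<Longrightarrow> u < card I \<Longrightarrow> nx I (nth_elem I u) = nth_elem I (u + 1)"
  by (rule nx_between) (use nth_strict[of u "u + 1"] in auto)

text \<open>Between consecutive elements of I the next element is constant, so the gaps are the
  fibres of \<open>nx I\<close> on the complement of I below \<open>Max I\<close>. The convention
  t_0 = 0 covers the first gap.\<close>

lemma gap:
  assumes u: "u \<in> {1..card I}"
  shows "{nth_elem I (u - 1)<..<nth_elem I u} = {j\<in>{j\<in>{1..n} - I. j < Max I}. nx I j = nth_elem I u}"
proof (intro set_eqI iffI)
  fix j assume j: "j \<in> {nth_elem I (u - 1)<..<nth_elem I u}"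
  have "nth_elem I u \<in> I" using nth_in u by simp
  then have "nth_elem I u \<le> n" "nth_elem I u \<le> Max I" using I fin by auto
  then have "j \<in> {1..n}" "j < Max I" using j by auto
  moreover have "j \<notin> I"
  proof
    assume "j \<in> I"
    then obtain v where v: "v \<in> {1..card I}" "j = nth_elem I v" using nth_ex by blast
    have "\<not> u \<le> v" using nth_mono[of u v] u v j by auto
    moreover have "\<not> v \<le> u - 1"
    proof
      assume "v \<le> u - 1"
      moreover have "u - 1 \<le> card I" using u by (auto intro: le_trans[OF diff_le_self])
      ultimately show False using nth_mono[of v "u - 1"] v j by simp
    qed
    ultimately show False by simp
  qed
  moreover have "nx I j = nth_elem I u"
    by (rule nx_between) (use u j in auto)
  ultimately show "j \<in> {j\<in>{j\<in>{1..n} - I. j < Max I}. nx I j = nth_elem I u}" by simp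
next
  fix j assume "j \<in> {j\<in>{j\<in>{1..n} - I. j < Max I}. nx I j = nth_elem I u}"
  then have j: "j \<in> {1..n}" "j \<notin> I" "j < Max I" "nx I j = nth_elem I u" by auto
  have M: "Max I \<in> I" by (rule Max_in[OF fin I(2)])
  have "j < nth_elem I u" using nx_in(2)[OF fin M j(3)] j(4) by simp
  moreover have "nth_elem I (u - 1) < j"
  proof (cases "u = 1")
    case True
    then show ?thesis using j by (simp add: nth_elem_def)
  next
    case False
    then have in1: "nth_elem I (u - 1) \<in> I" "nth_elem I (u - 1) < nth_elem I u"
      using u nth_in[of "u - 1"] nth_strict[of "u - 1" u] by auto
    then have "\<not> j < nth_elem I (u - 1)"
      using nx_in(3)[OF fin in1(1), of j] j(4) by auto
    moreover have "j \<noteq> nth_elem I (u - 1)" using j in1 by auto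
    ultimately show ?thesis by simp
  qed
  ultimately show "j \<in> {nth_elem I (u - 1)<..<nth_elem I u}" by simp
qed

lemma compl_split: "{1..n} - I = {j\<in>{1..n} - I. j < Max I} \<union> {Max I<..n}"
proof -
  have "Max I \<in> I" by (rule Max_in[OF fin I(2)])
  moreover have "j \<notin> I" if "Max I < j" for j
    using Max_ge[OF fin, of j] that by (auto simp: not_less)
  moreover have "j \<noteq> Max I \<Longrightarrow> \<not> j < Max I \<Longrightarrow> Max I < j" for j by simp
  moreover have "1 \<le> Max I" using \<open>Max I \<in> I\<close> I(1) by auto
  ultimately show ?thesis by (intro set_eqI iffI) (fastforce+)
qed

lemma prod_gaps:
  fixes h :: "nat \<Rightarrow> nat \<Rightarrow> qt"
  shows "(\<Prod>u=1..card I. \<Prod>j\<in>{nth_elem I (u - 1)<..<nth_elem I u}. h (nth_elem I u) j)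
    = (\<Prod>j\<in>{j\<in>{1..n} - I. j < Max I}. h (nx I j) j)"
proof -
  let ?S = "{j\<in>{1..n} - I. j < Max I}"
  have M: "Max I \<in> I" by (rule Max_in[OF fin I(2)])
  have "(\<Prod>u=1..card I. \<Prod>j\<in>{nth_elem I (u - 1)<..<nth_elem I u}. h (nth_elem I u) j)
      = (\<Prod>u=1..card I. \<Prod>j\<in>{j\<in>?S. nx I j = nth_elem I u}. h (nx I j) j)"
    by (rule prod.cong[OF refl], rule prod.cong[OF gap]) auto
  also have "\<dots> = (\<Prod>k\<in>I. \<Prod>j\<in>{j\<in>?S. nx I j = k}. h (nx I j) j)"
    by (rule prod.reindex_bij_betw[OF nth_bij])
  also have "\<dots> = (\<Prod>j\<in>?S. h (nx I j) j)"
    by (rule prod.group) (use fin nx_in(1)[OF fin M] in auto)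
  finally show ?thesis .
qed

lemma B_fun_eq:
  "B_fun n I z = (qvar * z (Min I) - tvar powi (- int n + 1)) *
     (\<Prod>j\<in>{1..n} - I. b_hat (nextv I ((*) qvar) z j) (z j))"
proof -
  have "(\<Prod>j\<in>{1..n} - I. b_hat (nextv I ((*) qvar) z j) (z j))
      = (\<Prod>j\<in>{j\<in>{1..n} - I. j < Max I}. b_hat (nextv I ((*) qvar) z j) (z j)) *
        (\<Prod>j\<in>{Max I<..n}. b_hat (nextv I ((*) qvar) z j) (z j))"
    by (subst compl_split, rule prod.union_disjoint) auto
  also have "(\<Prod>j\<in>{j\<in>{1..n} - I. j < Max I}. b_hat (nextv I ((*) qvar) z j) (z j))
      = (\<Prod>j\<in>{j\<in>{1..n} - I. j < Max I}. b_hat (z (nx I j)) (z j))"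
    by (rule prod.cong) (auto simp: nextv_below_Max[OF fin I(2)])
  also have "(\<Prod>j\<in>{Max I<..n}. b_hat (nextv I ((*) qvar) z j) (z j))
      = (\<Prod>j\<in>{Max I<..n}. b_hat (qvar * z (Min I)) (z j))"
    by (rule prod.cong) (auto simp: nextv_Max[OF fin])
  finally show ?thesis
    using prod_gaps[of "\<lambda>k j. b_hat (z k) (z j)"]
    by (simp add: B_fun_def nth_1 nth_card mult.assoc)
qed

lemma A_fun_eq:
  "A_fun I z = a_hat (z (Max I) / qvar) (z (Min I)) * (\<Prod>j\<in>I - {Max I}. a_hat (z j) (nextv I ((*) qvar) z j))"
proof -
  have M: "Max I \<in> I" by (rule Max_in[OF fin I(2)])
  have bij: "bij_betw (nth_elem I) {1..card I - 1} (I - {Max I})"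
  proof -
    have "{1..card I} - {card I} = {1..card I - 1}" using card_pos by auto
    moreover have "bij_betw (nth_elem I) ({1..card I} - {card I}) (I - {nth_elem I (card I)})"
      using card_pos by (intro bij_betw_DiffI nth_bij) (auto simp: bij_betw_def nth_in)
    ultimately show ?thesis by (simp add: nth_card)
  qed
  have "(\<Prod>j\<in>I - {Max I}. a_hat (z j) (nextv I ((*) qvar) z j)) = (\<Prod>j\<in>I - {Max I}. a_hat (z j) (z (nx I j)))"
  proof (rule prod.cong[OF refl])
    fix j assume "j \<in> I - {Max I}"
    then have "j < Max I" using fin by (simp add: less_le)
    then show "a_hat (z j) (nextv I ((*) qvar) z j) = a_hat (z j) (z (nx I j))"
      by (simp add: nextv_below_Max[OF fin I(2)])
  qed
  also have "\<dots> = (\<Prod>u=1..card I - 1. a_hat (z (nth_elem I u)) (z (nx I (nth_elem I u))))"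
    by (rule prod.reindex_bij_betw[OF bij, symmetric])
  also have "\<dots> = (\<Prod>u=1..card I - 1. a_hat (z (nth_elem I u)) (z (nth_elem I (u + 1))))"
    by (rule prod.cong) (auto simp: nx_nth)
  finally show ?thesis
    by (simp add: A_fun_def nth_1 nth_card)
qed

lemma c_comp_eq: "c_comp I \<nu> = c_move I Suc \<nu>"
proof
  fix j
  show "c_comp I \<nu> j = c_move I Suc \<nu> j"
  proof (cases "j \<in> I \<and> j \<noteq> Max I")
    case True
    then have "j < Max I" using fin by (simp add: less_le)
    then show ?thesis
      using True by (simp add: c_comp_def c_move_def nextv_below_Max[OF fin I(2)] nx_def)
  next
    case False
    then show ?thesis
      by (auto simp: c_comp_def c_move_def nextv_Max[OF fin])
  qed
qed

lemma maximal_iff: "I \<in> maximal_sets n \<nu> \<longleftrightarrow> I \<in> max_sets n \<nu>"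
proof -
  have M: "Max I \<in> I" by (rule Max_in[OF fin I(2)])
  have "(\<forall>u\<in>{1..card I}. \<forall>j\<in>{nth_elem I (u - 1)<..<nth_elem I u}. \<nu> j \<noteq> \<nu> (nth_elem I u))
      \<longleftrightarrow> (\<forall>u\<in>{1..card I}. \<forall>j\<in>{j\<in>{j\<in>{1..n} - I. j < Max I}. nx I j = nth_elem I u}. \<nu> j \<noteq> \<nu> (nth_elem I u))"
    by (rule ball_cong[OF refl]) (simp only: gap)
  also have "\<dots> \<longleftrightarrow> (\<forall>j\<in>{j\<in>{1..n} - I. j < Max I}. \<nu> j \<noteq> \<nu> (nx I j))"
  proof (intro iffI ballI)
    fix j assume A: "\<forall>u\<in>{1..card I}. \<forall>j\<in>{j\<in>{j\<in>{1..n} - I. j < Max I}. nx I j = nth_elem I u}. \<nu> j \<noteq> \<nu> (nth_elem I u)"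
      and j: "j \<in> {j\<in>{1..n} - I. j < Max I}"
    then have "nx I j \<in> I" using nx_in(1)[OF fin M] by simp
    then obtain u where "u \<in> {1..card I}" "nx I j = nth_elem I u" using nth_ex by blast
    then show "\<nu> j \<noteq> \<nu> (nx I j)" using A j by auto
  next
    fix u j assume "\<forall>j\<in>{j\<in>{1..n} - I. j < Max I}. \<nu> j \<noteq> \<nu> (nx I j)"
      and "j \<in> {j\<in>{j\<in>{1..n} - I. j < Max I}. nx I j = nth_elem I u}"
    then show "\<nu> j \<noteq> \<nu> (nth_elem I u)" by auto
  qed
  also have "\<dots> \<longleftrightarrow> (\<forall>j\<in>{j\<in>{1..n} - I. j < Max I}. \<nu> j \<noteq> nextv I Suc \<nu> j)"
    by (rule ball_cong[OF refl]) (simp add: nextv_below_Max[OF fin I(2)])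
  finally have 1: "(\<forall>u\<in>{1..card I}. \<forall>j\<in>{nth_elem I (u - 1)<..<nth_elem I u}. \<nu> j \<noteq> \<nu> (nth_elem I u))
      \<longleftrightarrow> (\<forall>j\<in>{j\<in>{1..n} - I. j < Max I}. \<nu> j \<noteq> nextv I Suc \<nu> j)" .
  have 2: "(\<forall>j\<in>{nth_elem I (card I)<..n}. \<nu> j \<noteq> \<nu> (nth_elem I 1) + 1)
      \<longleftrightarrow> (\<forall>j\<in>{Max I<..n}. \<nu> j \<noteq> nextv I Suc \<nu> j)"
    unfolding nth_1 nth_card by (rule ball_cong[OF refl]) (simp add: nextv_Max[OF fin] Suc_eq_plus1)
  have "(\<forall>j\<in>{1..n} - I. \<nu> j \<noteq> nextv I Suc \<nu> j) \<longleftrightarrow>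
      (\<forall>j\<in>{j\<in>{1..n} - I. j < Max I}. \<nu> j \<noteq> nextv I Suc \<nu> j) \<and> (\<forall>j\<in>{Max I<..n}. \<nu> j \<noteq> nextv I Suc \<nu> j)"
    by (subst compl_split) (rule ball_Un)
  then show ?thesis
    using I unfolding maximal_sets_def max_sets_def mem_Collect_eq 1 2 by simp
qed

end

lemma maximal_sets_eq: "maximal_sets n \<nu> = max_sets n \<nu>"
proof (rule set_eqI)
  fix I
  show "I \<in> maximal_sets n \<nu> \<longleftrightarrow> I \<in> max_sets n \<nu>"
  proof (cases "I \<subseteq> {1..n} \<and> I \<noteq> {}")
    case True
    then interpret enumerated_set I n by unfold_locales auto
    show ?thesis by (rule maximal_iff)
  qed (auto simp: maximal_sets_def max_sets_def)
qed

text \<open>Describes how b_hat transforms when t and the spectral entries are inverted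
  together.\<close>

lemma b_hat_inverse:
  assumes "x \<noteq> 0" "y \<noteq> 0" "x \<noteq> y"
  shows "(1 / x - inverse tvar * (1 / y)) / (1 / x - 1 / y) = inverse tvar * b_hat x y"
proof -
  have "1 / x - 1 / y = (y - x) / (x * y)" "1 / x - inverse tvar * (1 / y) = (y - inverse tvar * x) / (x * y)"
    using assms by (simp_all add: field_simps)
  then have "(1 / x - inverse tvar * (1 / y)) / (1 / x - 1 / y) = (y - inverse tvar * x) / (y - x)"
    using assms by simp
  also have "y - inverse tvar * x = - (inverse tvar * (x - tvar * y))"
    by (simp add: algebra_simps)
  also have "- (inverse tvar * (x - tvar * y)) / (y - x) = inverse tvar * (x - tvar * y) / (x - y)"
    by (metis minus_diff_eq minus_divide_divide minus_minus)
  finally show ?thesis by (simp add: b_hat_def)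
qed

lemma qt_inverted_eta_bar: "qt_inverted (eta_bar n \<nu> j) = 1 / eta_bar n \<nu> j"
  by (simp add: eta_bar_def ring_hom_simps[OF ring_hom_qt_inverted]
      field_hom_inverse[OF ring_hom_qt_inverted]
      qt_inverted_qvar qt_inverted_tvar power_int_minus power_inverse divide_inverse)

text \<open>Inversion multiplies each y_j/(y_j - m_j) by -m_j/y_j, and over I the quotients m_j/y_j
  multiply to q. The signs of these card I factors and of the card I - 1 factors t - 1 leave one
  minus sign, and all powers of t^-1 from I and its complement cancel against t^{n-1}.\<close>

lemma (in enumerated_set) qt_inverted_pieri_value:
  shows "qt_inverted (pieri_value n \<nu> I) =
    - (qvar - 1) * A_fun I (eta_bar n \<nu>) * B_fun n I (eta_bar n \<nu>) / (qvar ^ (\<nu> (Min I) + 1) * (tvar - 1))"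
proof -
  note h = ring_hom_qt_inverted
  define y where "y = eta_bar n \<nu>"
  define m where "m = nextv I ((*) qvar) y"
  define Y where "Y = y (Min I)"
  define b where "b j = b_hat (m j) (y j)" for j
  define g where "g j = y j / (y j - m j)" for j
  define k where "k = \<nu> (Min I) + 1"
  have M: "Max I \<in> I" and Min: "Min I \<in> I" using fin I(2) by (auto intro: Max_in Min_in)
  have y0: "y j \<noteq> 0" "Y \<noteq> 0" for j by (simp_all add: y_def Y_def)
  have m0: "m j \<noteq> 0" for j by (auto simp: m_def nextv_def y0)
  have ne: "m j \<noteq> y j" if "j \<in> {1..n}" for j
    using eta_bar_ne_nextv[OF I(1) that I(2), of \<nu>] by (simp add: m_def y_def)
  have iy: "qt_inverted (y j) = 1 / y j" for j
    by (simp add: y_def qt_inverted_eta_bar)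
  have im: "qt_inverted (m j) = 1 / m j" for j
    by (simp add: m_def nextv_def iy ring_hom_mult[OF h] qt_inverted_qvar divide_inverse)
  have ib: "qt_inverted (b j) = inverse tvar * b j" if "j \<in> {1..n}" for j
    unfolding b_def b_hat_inverse[OF m0 y0(1) ne[OF that], symmetric]
    by (simp only: b_hat_def field_hom_divide[OF h] ring_hom_simps[OF h] im iy qt_inverted_tvar)
  have ig: "qt_inverted (g j) = - (m j / y j) * g j" if "j \<in> I" for j
  proof -
    have "j \<in> {1..n}" using that I by blast
    then have "1 / y j - 1 / m j = - (y j - m j) / (y j * m j)" "y j - m j \<noteq> 0"
      using y0(1)[of j] m0[of j] ne[of j] by (simp_all add: field_simps)
    moreover have "m j / (m j - y j) = - (m j / (y j - m j))"
      by (metis minus_diff_eq minus_divide_right)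
    ultimately show ?thesis
      using y0(1)[of j] m0[of j]
      by (simp add: g_def field_hom_divide[OF h] ring_hom_simps[OF h] im iy)
  qed
  have prod_m: "(\<Prod>j\<in>I. m j) = qvar * (\<Prod>j\<in>I. y j)"
  proof -
    note eqs = filter_Min[OF fin]
    have "(\<Prod>j\<in>I. m j) = qvar * Y * (\<Prod>j\<in>I - {Min I}. y j)"
      using prod_nextv[OF fin Min, of "\<lambda>x. x" "(*) qvar" y] unfolding m_def Y_def eqs .
    also have "\<dots> = qvar * (\<Prod>j\<in>I. y j)"
      using prod.remove[OF fin Min, of y] by (simp add: Y_def mult.assoc)
    finally show ?thesis .
  qed
  have "qt_inverted (\<Prod>j\<in>I. g j) = (\<Prod>j\<in>I. - (m j / y j) * g j)"
    unfolding ring_hom_prod[OF h] by (rule prod.cong) (simp_all only: ig)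
  also have "\<dots> = (\<Prod>j\<in>I. - 1 * (m j * (1 / y j)) * g j)"
    by (rule prod.cong) simp_all
  also have "\<dots> = (- 1) ^ card I * ((\<Prod>j\<in>I. m j) * (\<Prod>j\<in>I. 1 / y j)) * (\<Prod>j\<in>I. g j)"
    by (simp only: prod.distrib prod_constant)
  also have "(\<Prod>j\<in>I. m j) * (\<Prod>j\<in>I. 1 / y j) = qvar"
    using y0(1) fin by (simp add: prod_m prod_dividef)
  finally have igs: "qt_inverted (\<Prod>j\<in>I. g j) = (- 1) ^ card I * qvar * (\<Prod>j\<in>I. g j)" .
  have "qt_inverted (\<Prod>j\<in>{1..n} - I. b j) = (\<Prod>j\<in>{1..n} - I. inverse tvar * b j)"
    unfolding ring_hom_prod[OF h] by (rule prod.cong) (simp_all only: ib Diff_iff)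
  also have "\<dots> = inverse tvar ^ (n - card I) * (\<Prod>j\<in>{1..n} - I. b j)"
    using fin I(1) by (simp add: prod.distrib card_Diff_subset)
  finally have ibs: "qt_inverted (\<Prod>j\<in>{1..n} - I. b j) = inverse tvar ^ (n - card I) * (\<Prod>j\<in>{1..n} - I. b j)" .
  define s where "s = card I - 1"
  have s: "card I = Suc s" using card_pos by (simp add: s_def)
  have sn: "card I \<le> n" using card_mono[of "{1..n}" I] I(1) by simp
  define G B where "G = (\<Prod>j\<in>I. g j)" and "B = (\<Prod>j\<in>{1..n} - I. b j)"
  have tpow: "tvar ^ (n - 1) * (inverse tvar ^ s * inverse tvar ^ (n - card I)) = 1"
  proof -
    have "s + (n - card I) = n - 1" using s sn by simp
    then show ?thesis by (simp flip: power_add power_mult_distrib)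
  qed
  have "inverse tvar - 1 = - 1 * (inverse tvar * (tvar - 1))"
    by (simp add: algebra_simps)
  then have tm: "(inverse tvar - 1) ^ s = (- 1) ^ s * (inverse tvar ^ s * (tvar - 1) ^ s)"
    by (simp only: power_mult_distrib)
  have sgn: "(- 1) ^ s * (- 1) ^ card I = (- 1 :: qt)"
    by (simp add: s flip: power_mult_distrib)
  have tn: "tvar powi (- int n + 1) = inverse tvar ^ (n - 1)"
  proof -
    have "- int n + 1 = - int (n - 1)" using sn s by simp
    then show ?thesis by (simp only: power_int_minus power_int_of_nat power_inverse)
  qed
  have pv: "pieri_value n \<nu> I = inverse tvar ^ (n - 1) *
      ((tvar - 1) ^ s * qvar ^ k * (1 - qvar * tvar ^ (n - 1) * Y) * G * B) * ((inverse qvar - 1) / Y)"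
    unfolding pieri_value_def pieri_common_def y_def[symmetric] m_def[symmetric] Y_def[symmetric]
      k_def[symmetric] s_def[symmetric] G_def B_def g_def b_def ..
  have iY: "qt_inverted Y = 1 / Y" by (simp add: Y_def iy)
  have "qt_inverted (pieri_value n \<nu> I) = tvar ^ (n - 1) *
      ((inverse tvar - 1) ^ s * inverse qvar ^ k * (1 - inverse qvar * inverse tvar ^ (n - 1) * (1 / Y)) *
        ((- 1) ^ card I * qvar * G) * (inverse tvar ^ (n - card I) * B)) * ((qvar - 1) / (1 / Y))"
    unfolding pv
    by (simp only: field_hom_divide[OF h] field_hom_inverse[OF h] ring_hom_simps[OF h] iY qt_inverted_qvar
        qt_inverted_tvar igs[folded G_def] ibs[folded B_def] inverse_inverse_eq)
  also have "\<dots> = (tvar ^ (n - 1) * (inverse tvar ^ s * inverse tvar ^ (n - card I))) * ((- 1) ^ s * (- 1) ^ card I) *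
      (tvar - 1) ^ s * inverse qvar ^ k * (qvar * Y * (1 - inverse qvar * inverse tvar ^ (n - 1) * (1 / Y))) * (qvar - 1) * G * B"
    unfolding tm using y0(2) by (simp add: mult_ac)
  \<comment> \<open>The q left over from the product over I and the inverted denominator y_min
    complete the leading factor of \<open>B_fun\<close>.\<close>
  also have "qvar * Y * (1 - inverse qvar * inverse tvar ^ (n - 1) * (1 / Y)) = qvar * Y - inverse tvar ^ (n - 1)"
    using y0(2) by (simp add: field_simps)
  finally have lhs: "qt_inverted (pieri_value n \<nu> I) =
      - (qvar - 1) * (tvar - 1) ^ s * (qvar * Y - inverse tvar ^ (n - 1)) * G * B / qvar ^ k"
    unfolding tpow sgn by (simp add: power_inverse field_simps)
  \<comment> \<open>a_hat is homogeneous of degree 0, so scaling by q identifies the first factor of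
    \<open>A_fun\<close> with the one where the cyclic order wraps around.\<close>
  have "a_hat (y (Max I) / qvar) Y = a_hat (y (Max I)) (m (Max I))"
  proof -
    have "m (Max I) = qvar * Y" by (simp add: m_def Y_def nextv_Max[OF fin])
    moreover have "y (Max I) / qvar - Y = (y (Max I) - qvar * Y) / qvar"
      by (simp add: field_simps)
    ultimately show ?thesis by (simp add: a_hat_def)
  qed
  then have "A_fun I y = (\<Prod>j\<in>I. a_hat (y j) (m j))"
    using prod.remove[OF fin M, of "\<lambda>j. a_hat (y j) (m j)"] by (simp add: A_fun_eq m_def[symmetric] Y_def[symmetric])
  also have "\<dots> = (\<Prod>j\<in>I. (tvar - 1) * g j)"
    by (rule prod.cong) (simp_all add: a_hat_def g_def)
  also have "\<dots> = (tvar - 1) ^ card I * G"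
    by (simp add: prod.distrib G_def)
  finally have A: "A_fun I y = (tvar - 1) * (tvar - 1) ^ s * G"
    by (simp add: s)
  have B: "B_fun n I y = (qvar * Y - inverse tvar ^ (n - 1)) * B"
    unfolding B_fun_eq tn m_def[symmetric] Y_def[symmetric] B_def b_def ..
  have t1: "tvar - 1 \<noteq> 0"
    using qvar_tvar_powi_eq_1[of 0 1] by auto
  show ?thesis
    unfolding lhs y_def[symmetric] A B k_def[symmetric] using t1 by simp
qed

section \<open>Inverting the parameters\<close>

definition invert_coeffs :: "zpoly \<Rightarrow> zpoly" where
  "invert_coeffs = Poly_Mapping.map qt_inverted"

lemma lookup_invert_coeffs: "lookup (invert_coeffs f) m = qt_inverted (lookup f m)"
  unfolding invert_coeffs_def by transfer (simp add: when_def ring_hom_0[OF ring_hom_qt_inverted])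

lemma invert_coeffs_add: "invert_coeffs (f + g) = invert_coeffs f + invert_coeffs g"
  by (rule poly_mapping_eqI) (simp add: lookup_invert_coeffs lookup_add ring_hom_add[OF ring_hom_qt_inverted])

lemma invert_coeffs_mon: "invert_coeffs (Const c * mon m) = Const (qt_inverted c) * mon m"
  by (rule poly_mapping_eqI)
    (simp add: lookup_invert_coeffs lookup_mon ring_hom_0[OF ring_hom_qt_inverted])

lemma ring_hom_invert_coeffs: "ring_hom invert_coeffs"
proof -
  note h = ring_hom_qt_inverted
  have eq: "Const c * mon m * (Const d * mon k) = Const (c * d) * mon (m + k)" for c d m k
    by (simp add: Const_simps mon_add)
  have mm: "invert_coeffs (Const c * mon m * (Const d * mon k))
      = invert_coeffs (Const c * mon m) * invert_coeffs (Const d * mon k)" for c d m k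
    by (simp only: eq invert_coeffs_mon ring_hom_mult[OF h])
  have "invert_coeffs (Const c * mon m * g) = invert_coeffs (Const c * mon m) * invert_coeffs g" for c m g
    by (induction g rule: zpoly_induct) (simp_all only: mm invert_coeffs_add distrib_left)
  then have "invert_coeffs (f * g) = invert_coeffs f * invert_coeffs g" for f g
    by (induction f rule: zpoly_induct) (simp_all only: invert_coeffs_add distrib_right)
  moreover have "invert_coeffs 1 = 1"
    using invert_coeffs_mon[of 1 0] by (simp add: mon_0 Const_simps ring_hom_1[OF h])
  ultimately show ?thesis by (simp add: ring_hom_def invert_coeffs_add)
qed

lemma invert_coeffs_Const: "invert_coeffs (Const c) = Const (qt_inverted c)"
  using invert_coeffs_mon[of c 0] by (simp add: mon_0)

lemma invert_coeffs_elem_sym: "invert_coeffs (elem_sym n r) = elem_sym n r"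
proof -
  have "invert_coeffs (Z i) = Z i" for i
    using invert_coeffs_mon[of 1 "Poly_Mapping.single i 1"] ring_hom_1[OF ring_hom_qt_inverted]
    by (simp add: mon_single Const_simps del: single_one)
  then show ?thesis
    by (simp add: elem_sym_def ring_hom_sum[OF ring_hom_invert_coeffs] ring_hom_prod[OF ring_hom_invert_coeffs])
qed

lemma e_top_power_macdonald:
  assumes "1 \<le> n"
  shows "e_top n ^ k * nonsym_macdonald n \<eta> = nonsym_macdonald n (\<lambda>i. \<eta> i + k)"
proof (induction k)
  case (Suc k)
  then show ?case
    using e_top_macdonald[OF assms, of "\<lambda>i. \<eta> i + k"] by (simp add: mult.assoc flip: Suc_eq_plus1)
qed simp

theorem proposition10:
  fixes n :: nat and \<eta> \<eta>' \<nu> :: "nat \<Rightarrow> nat"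
  assumes "n \<ge> 1"
    and "\<eta>' = (\<lambda>i. \<eta> i - min_part n \<eta>)"
    and "\<nu> = compl_rev n (max_part n \<eta>') \<eta>'"
  shows "elem_sym n (n - 1) * nonsym_macdonald_inverted n \<eta> =
    (\<Sum>I\<in>maximal_sets n \<nu>.
       Const (pieri_coeff n \<nu> I) *
       nonsym_macdonald_inverted n
         (\<lambda>i. compl_rev n (max_part n \<nu> + 1) (c_comp I \<nu>) i + min_part n \<eta>))"
proof -
  note n = assms(1)
  define M where "M = max_part n \<nu>"
  define k where "k = min_part n \<eta>"
  have ne: "{1..n} \<noteq> {}" using n by simp
  have \<eta>'_le: "\<eta>' j \<le> max_part n \<eta>'" if "j \<in> {1..n}" for j
    unfolding max_part_def using that by (intro Max_ge) auto
  have k_le: "k \<le> \<eta> j" if "j \<in> {1..n}" for j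
    unfolding k_def min_part_def using that by (intro Min_le) auto
  have "k \<in> \<eta> ` {1..n}" unfolding k_def min_part_def using ne by (intro Min_in) auto
  \<comment> \<open>Some part of \<eta>' is 0, so \<nu> attains \<open>max_part n \<eta>'\<close>,
    and complementing \<nu> with its own maximum returns \<eta>'.\<close>
  then obtain j0 where j0: "j0 \<in> {1..n}" "\<eta>' j0 = 0" by (auto simp: assms(2) k_def)
  have \<nu>_le: "\<nu> j \<le> M" if "j \<in> {1..n}" for j
    unfolding M_def max_part_def using that by (intro Max_ge) auto
  then have bound: "parts_le n M \<nu>" by (simp add: parts_le_def)
  have M: "M = max_part n \<eta>'"
  proof (rule antisym)
    show "M \<le> max_part n \<eta>'"
      unfolding M_def max_part_def[of n \<nu>] using ne by (intro Max.boundedI) (auto simp: assms(3) compl_rev_apply)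
    have "n + 1 - (n + 1 - j0) = j0" using j0 by simp
    then have "\<nu> (n + 1 - j0) = max_part n \<eta>'" by (simp only: assms(3) compl_rev_apply j0 diff_zero)
    moreover have "n + 1 - j0 \<in> {1..n}" using j0 by auto
    ultimately show "max_part n \<eta>' \<le> M" using \<nu>_le by metis
  qed
  have "nonsym_macdonald n (compl_rev n M \<nu>) = nonsym_macdonald n \<eta>'"
  proof (rule nonsym_macdonald_cong[OF n])
    fix j assume j: "j \<in> {1..n}"
    then have "n + 1 - (n + 1 - j) = j" by simp
    then show "compl_rev n M \<nu> j = \<eta>' j"
      using \<eta>'_le[OF j] by (simp only: assms(3) compl_rev_apply M diff_diff_cancel)
  qed
  moreover have "nonsym_macdonald n \<eta> = nonsym_macdonald n (\<lambda>i. \<eta>' i + k)"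
    by (rule nonsym_macdonald_cong[OF n]) (use k_le in \<open>simp add: assms(2) k_def\<close>)
  \<comment> \<open>The common shift by \<open>min_part n \<eta>\<close> is carried through the
    computation as a power of e_n.\<close>
  ultimately have E: "nonsym_macdonald n \<eta> = e_top n ^ k * nonsym_macdonald n (compl_rev n M \<nu>)"
    by (simp add: e_top_power_macdonald[OF n])
  define F where "F I = nonsym_macdonald n (\<lambda>i. compl_rev n (M + 1) (c_comp I \<nu>) i + k)" for I
  \<comment> \<open>Removing the normalization of \<open>revE\<close> on both sides produces the
    quotient of the two d'.\<close>
  define v where "v I = d' n \<nu> * pieri_value n \<nu> I / d' n (c_comp I \<nu>)" for I
  have I: "I \<subseteq> {1..n}" "I \<noteq> {}" if "I \<in> maximal_sets n \<nu>" for I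
    using that by (auto simp: maximal_sets_def)
  have c: "c_move I Suc \<nu> = c_comp I \<nu>" if "I \<in> maximal_sets n \<nu>" for I
  proof -
    interpret enumerated_set I n by unfold_locales (use I[OF that] in auto)
    show ?thesis by (rule c_comp_eq[symmetric])
  qed
  have revE: "nonsym_macdonald n (compl_rev n N \<mu>) = Const (d' n \<mu>) * revE n N \<mu>" for N \<mu>
    using Const_inverse_cancel[of "inverse (d' n \<mu>)" "nonsym_macdonald n (compl_rev n N \<mu>)"] by (simp add: revE_def)
  have "elem_sym n (n - 1) * nonsym_macdonald n \<eta>
      = e_top n ^ k * (Const (d' n \<nu>) * (elem_sym n (n - 1) * revE n M \<nu>))"
    by (simp add: E revE mult_ac)
  also have "elem_sym n (n - 1) * revE n M \<nu>
      = (\<Sum>I\<in>maximal_sets n \<nu>. Const (pieri_value n \<nu> I) * revE n (M + 1) (c_move I Suc \<nu>))"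
    unfolding maximal_sets_eq by (rule elem_sym_revE[OF n bound])
  also have "e_top n ^ k * (Const (d' n \<nu>) * \<dots>) = (\<Sum>I\<in>maximal_sets n \<nu>. Const (v I) * F I)"
    unfolding sum_distrib_left
  proof (rule sum.cong[OF refl])
    fix I assume "I \<in> maximal_sets n \<nu>"
    have "F I = e_top n ^ k * nonsym_macdonald n (compl_rev n (M + 1) (c_comp I \<nu>))"
      by (simp add: F_def e_top_power_macdonald[OF n])
    then show "e_top n ^ k * (Const (d' n \<nu>) * (Const (pieri_value n \<nu> I) * revE n (M + 1) (c_move I Suc \<nu>)))
        = Const (v I) * F I"
      by (simp only: c[OF \<open>I \<in> _\<close>] v_def revE_def divide_inverse Const_simps mult_ac)
  qed
  \<comment> \<open>The identity for q and t is complete; inversion is multiplicative and fixes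
    e_{n-1}, so only the scalars v and the polynomials F change.\<close>
  finally have "invert_coeffs (elem_sym n (n - 1) * nonsym_macdonald n \<eta>)
      = invert_coeffs (\<Sum>I\<in>maximal_sets n \<nu>. Const (v I) * F I)" by simp
  then have "elem_sym n (n - 1) * invert_coeffs (nonsym_macdonald n \<eta>)
      = (\<Sum>I\<in>maximal_sets n \<nu>. Const (qt_inverted (v I)) * invert_coeffs (F I))"
    by (simp add: ring_hom_mult[OF ring_hom_invert_coeffs] ring_hom_sum[OF ring_hom_invert_coeffs]
        invert_coeffs_elem_sym invert_coeffs_Const)
  also have "\<dots> = (\<Sum>I\<in>maximal_sets n \<nu>. Const (pieri_coeff n \<nu> I) * invert_coeffs (F I))"
  proof (rule sum.cong[OF refl])
    fix I assume "I \<in> maximal_sets n \<nu>"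
    then interpret enumerated_set I n by unfold_locales (use I in auto)
    have "qt_inverted (v I) = pieri_coeff n \<nu> I"
      unfolding v_def pieri_coeff_def
      by (simp add: field_hom_divide[OF ring_hom_qt_inverted] ring_hom_mult[OF ring_hom_qt_inverted]
          qt_inverted_d' qt_inverted_pieri_value mult_ac)
    then show "Const (qt_inverted (v I)) * invert_coeffs (F I) = Const (pieri_coeff n \<nu> I) * invert_coeffs (F I)"
      by simp
  qed
  finally show ?thesis
    by (simp add: nonsym_macdonald_inverted_def invert_coeffs_def F_def M_def k_def)
qed

end
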